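(* For any $q \geq 1$ and any permutation $\pi$ of $q$ symbols, the aperiodic subsystem $(I_{np},F_\pi)$ of the rotated odometer admits at most $q$ ergodic invariant (Borel probability) measures, and its unique minimal subsystem $(I^*_{min},F_\pi^* )$ is uniquely ergodic.
   Context: Rotated odometer: let $I=[0,1)$. The von Neumann–Kakutani map $\mathfrak a: I\to I$ is $\mathfrak a(x)=x-(1-3\cdot 2^{-n})$ for $x\in[1-2^{1-n},1-2^{-n})$, $n\ge 1$. For a permutation $\pi$ of $\{0,\dots,q-1\}$, $R_\pi:I\to I$ maps each $[\frac iq,\frac{i+1}q)$ by a translation onto $[\frac{\pi(i)}q,\frac{\pi(i)+1}q)$, and $F_\pi=\mathfrak a\circ R_\pi$. $I_{per}$ is the set of $F_\pi$-periodic points in $I$, $I_{np}=I\setminus I_{per}$. The map $F_\pi$ is injective and its range is $(0,1)$. Compactification: let $D_0\subset I$ consist of $0$, the points $R_\pi^{-1}(1-2^{-n})$, $n\ge0$, and all discontinuity points of $F_\pi$. Let $D$ be the union of the forward orbits of the points of $D_0$ and the backward orbits of the points of $D_0\setminus\{0\}$ under $F_\pi$. For each $x\in D\setminus\{0\}$ add a new point $x^-$; write $x^+:=x$ for $x\in D$, and $1^-:=1$. Set $I^*=I\cup\{x^-:x\in D\setminus\{0\}\}\cup\{1\}$, ordered by extending the order of $[0,1]$ so that $x^-$ is the immediate predecessor of $x^+$, and give $I^*$ the order topology. Let $\widehat x=\lim_{y\nearrow1}R_\pi^{-1}(y)\in(0,1]$. Define $F_\pi^*:I^*\to I^*$ by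 $F_\pi^*=F_\pi$ on $I$, $F_\pi^*(\widehat x^-)=0$, and $F^*_\pi(z^-)=\lim_{y\nearrow z}F_\pi(y)$ (limit in $I^*$) for all other added points $z^-$, $z\in (D\setminus\{0\})\cup\{1\}$. Let $I_{per}^*$ be the union of all order intervals $[x^+,y^-]\subset I^*$ with $x\in D$, $y\in D\cup\{1\}$, $[x,y)\subset I_{per}$, and $I_{np}^*=I^*\setminus I_{per}^*$. $I_{min}^*$ denotes the unique minimal set (non-empty, closed, invariant, with no proper such subset) of $(I_{np}^*,F_\pi^* )$. *)

theory Defs
  imports "HOL-Probability.Probability"
begin

section \<open>Topological and measurable dynamics\<close>

definition borel_of :: "'a topology \<Rightarrow> 'a measure" where
  "borel_of X = sigma (topspace X) {U. openin X U}"

definition invariant_measures :: "'a topology \<Rightarrow> ('a \<Rightarrow> 'a) \<Rightarrow> 'a measure set" where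
  "invariant_measures X T = {M. prob_space M \<and> sets M = sets (borel_of X) \<and>
     T \<in> M \<rightarrow>\<^sub>M M \<and> (\<forall>A\<in>sets M. emeasure M (T -` A \<inter> space M) = emeasure M A)}"

definition ergodic_measures :: "'a topology \<Rightarrow> ('a \<Rightarrow> 'a) \<Rightarrow> 'a measure set" where
  "ergodic_measures X T = {M \<in> invariant_measures X T.
     \<forall>A\<in>sets M. T -` A \<inter> space M = A \<longrightarrow> emeasure M A = 0 \<or> emeasure M A = 1}"

definition uniquely_ergodic :: "'a topology \<Rightarrow> ('a \<Rightarrow> 'a) \<Rightarrow> bool" where
  "uniquely_ergodic X T \<longleftrightarrow> (\<exists>!M. M \<in> invariant_measures X T)"

definition closed_invariant :: "'a topology \<Rightarrow> ('a \<Rightarrow> 'a) \<Rightarrow> 'a set \<Rightarrow> bool" where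
  "closed_invariant X T M \<longleftrightarrow> M \<noteq> {} \<and> closedin X M \<and> T ` M \<subseteq> M"

definition minimal_set :: "'a topology \<Rightarrow> ('a \<Rightarrow> 'a) \<Rightarrow> 'a set \<Rightarrow> bool" where
  "minimal_set X T M \<longleftrightarrow> closed_invariant X T M \<and> \<not> (\<exists>N. N \<subset> M \<and> closed_invariant X T N)"

text \<open>
  The order topology of the linearly ordered set \<open>S\<close> itself: the rays are taken relative to
  \<open>S\<close> and have end points in \<open>S\<close>.  In general this is coarser than the subspace topology
  inherited from an order topology on the surrounding type.
\<close>

definition order_topology_on :: "'a::linorder set \<Rightarrow> 'a topology" where
  "order_topology_on S = topology_generated_by
     (insert S ((\<lambda>a. {x \<in> S. x < a}) ` S \<union> (\<lambda>a. {x \<in> S. a < x}) ` S))"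


section \<open>Rotated odometers\<close>

text \<open>
  All maps are total functions on \<^typ>\<open>real\<close>; their values outside \<open>[0,1)\<close> are irrelevant.
\<close>

abbreviation unit_ivl :: "real set" where
  "unit_ivl \<equiv> {0..<1}"

definition kakutani :: "real \<Rightarrow> real" where
  "kakutani x =
     (let n = (THE n::nat. n \<ge> 1 \<and> 1 - 2 / 2 ^ n \<le> x \<and> x < 1 - 1 / 2 ^ n)
      in x - (1 - 3 / 2 ^ n))"

definition rot :: "nat \<Rightarrow> (nat \<Rightarrow> nat) \<Rightarrow> real \<Rightarrow> real" where
  "rot q \<pi> x = (let i = nat \<lfloor>real q * x\<rfloor> in x + (real (\<pi> i) - real i) / real q)"

definition rot_odo :: "nat \<Rightarrow> (nat \<Rightarrow> nat) \<Rightarrow> real \<Rightarrow> real" where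
  "rot_odo q \<pi> = kakutani \<circ> rot q \<pi>"

definition I_per :: "nat \<Rightarrow> (nat \<Rightarrow> nat) \<Rightarrow> real set" where
  "I_per q \<pi> = {x \<in> unit_ivl. \<exists>n\<ge>1. (rot_odo q \<pi> ^^ n) x = x}"

definition I_np :: "nat \<Rightarrow> (nat \<Rightarrow> nat) \<Rightarrow> real set" where
  "I_np q \<pi> = unit_ivl - I_per q \<pi>"


section \<open>The compactification\<close>

definition D0 :: "nat \<Rightarrow> (nat \<Rightarrow> nat) \<Rightarrow> real set" where
  "D0 q \<pi> = {0}
     \<union> {x \<in> unit_ivl. \<exists>n::nat. rot q \<pi> x = 1 - 1 / 2 ^ n}
     \<union> {x \<in> unit_ivl. \<not> continuous (at x within unit_ivl) (rot_odo q \<pi>)}"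

definition cut_points :: "nat \<Rightarrow> (nat \<Rightarrow> nat) \<Rightarrow> real set" where
  "cut_points q \<pi> =
     {y. \<exists>x\<in>D0 q \<pi>. \<exists>n. y = (rot_odo q \<pi> ^^ n) x}
     \<union> {y \<in> unit_ivl. \<exists>x\<in>D0 q \<pi> - {0}. \<exists>n. (rot_odo q \<pi> ^^ n) y = x}"

text \<open>
  \<open>Plus x\<close> stands for the point \<open>x\<close> of \<open>[0,1)\<close>, also written \<open>x\<^sup>+\<close> if \<open>x\<close> is a cut point,
  and \<open>Minus x\<close> for the added point \<open>x\<^sup>-\<close>; the point \<open>1 = 1\<^sup>-\<close> is \<open>Minus 1\<close>.
\<close>

datatype split_real = Minus real | Plus real

instantiation split_real :: linorder
begin

fun less_eq_split_real :: "split_real \<Rightarrow> split_real \<Rightarrow> bool" where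
  "Minus x \<le> Minus y \<longleftrightarrow> x \<le> y"
| "Minus x \<le> Plus y \<longleftrightarrow> x \<le> y"
| "Plus x \<le> Minus y \<longleftrightarrow> x < y"
| "Plus x \<le> Plus y \<longleftrightarrow> x \<le> y"

definition less_split_real :: "split_real \<Rightarrow> split_real \<Rightarrow> bool" where
  "less_split_real p r \<longleftrightarrow> p \<le> r \<and> \<not> r \<le> p"

instance
proof
  fix p r s :: split_real
  show "p < r \<longleftrightarrow> p \<le> r \<and> \<not> r \<le> p" by (rule less_split_real_def)
  show "p \<le> p" by (cases p) auto
  show "p \<le> r \<Longrightarrow> r \<le> s \<Longrightarrow> p \<le> s" by (cases p; cases r; cases s) auto
  show "p \<le> r \<Longrightarrow> r \<le> p \<Longrightarrow> p = r" by (cases p; cases r) auto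
  show "p \<le> r \<or> r \<le> p" by (cases p; cases r) auto
qed

end

definition I_star :: "nat \<Rightarrow> (nat \<Rightarrow> nat) \<Rightarrow> split_real set" where
  "I_star q \<pi> = Plus ` unit_ivl \<union> Minus ` (cut_points q \<pi> - {0}) \<union> {Minus 1}"

definition I_star_top :: "nat \<Rightarrow> (nat \<Rightarrow> nat) \<Rightarrow> split_real topology" where
  "I_star_top q \<pi> = order_topology_on (I_star q \<pi>)"

definition x_hat :: "nat \<Rightarrow> (nat \<Rightarrow> nat) \<Rightarrow> real" where
  "x_hat q \<pi> = Lim (at_left 1) (the_inv_into unit_ivl (rot q \<pi>))"

definition F_star :: "nat \<Rightarrow> (nat \<Rightarrow> nat) \<Rightarrow> split_real \<Rightarrow> split_real" where
  "F_star q \<pi> p = (case p of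
       Plus x \<Rightarrow> Plus (rot_odo q \<pi> x)
     | Minus z \<Rightarrow>
         if z = x_hat q \<pi> then Plus 0
         else (THE l. limitin (I_star_top q \<pi>) (\<lambda>y. Plus (rot_odo q \<pi> y)) l (at_left z)))"

text \<open>
  Degenerate pairs with \<open>y \<le> x\<close> (in particular \<open>y = 0\<close>) contribute nothing to the union,
  since then \<open>Minus y < Plus x\<close>.
\<close>

definition I_per_star :: "nat \<Rightarrow> (nat \<Rightarrow> nat) \<Rightarrow> split_real set" where
  "I_per_star q \<pi> = \<Union> {{Plus x..Minus y} \<inter> I_star q \<pi> | x y.
     x \<in> cut_points q \<pi> \<and> y \<in> cut_points q \<pi> \<union> {1} \<and> {x..<y} \<subseteq> I_per q \<pi>}"

definition I_np_star :: "nat \<Rightarrow> (nat \<Rightarrow> nat) \<Rightarrow> split_real set" where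
  "I_np_star q \<pi> = I_star q \<pi> - I_per_star q \<pi>"

definition I_np_star_top :: "nat \<Rightarrow> (nat \<Rightarrow> nat) \<Rightarrow> split_real topology" where
  "I_np_star_top q \<pi> = subtopology (I_star_top q \<pi>) (I_np_star q \<pi>)"

definition I_min_star :: "nat \<Rightarrow> (nat \<Rightarrow> nat) \<Rightarrow> split_real set" where
  "I_min_star q \<pi> = (THE M. minimal_set (I_np_star_top q \<pi>) (F_star q \<pi>) M)"

end

theory Submission imports Defs
begin

text \<open>
  Write \<open>F\<close> for the rotated odometer.  Cut \<open>[0,1)\<close> into \<open>q \<cdot> 2\<^sup>k\<close> equal cells; the first \<open>q\<close> of them,
  the base cells, fill the block \<open>[0, 2\<^sup>-\<^sup>k)\<close>.  The Kakutani map is self-similar: it is a permutation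
  of the dyadic intervals of length \<open>2\<^sup>-\<^sup>k\<close>, followed by a copy of itself on \<open>[0, 2\<^sup>-\<^sup>k)\<close>.  Therefore \<open>F\<close>
  moves the cells of level \<open>k\<close> by translations along a permutation \<open>P\<^sub>k\<close>, as long as it does not enter the
  block (\<open>cell_step\<close>).  Two facts follow.  Each cell either belongs to a tower over a base cell, or
  to a cycle of \<open>P\<^sub>k\<close> without base cells, and then it is periodic (\<open>cell_dichotomy\<close>,
  \<open>cyclic_cell_subset_I_per\<close>); as \<open>0\<close> is not a value of \<open>F\<close>, all periodic points arise like
  this.  And the first return map to the block is, up to scale, a rotated odometer for another
  permutation of \<open>q\<close> symbols (\<open>first_return\<close>).

  An invariant measure on the aperiodic part gives equal mass to all cells of a tower.  So if two
  invariant measures both give mass at least \<open>\<delta>\<close> to the same tower at infinitely many levels, then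
  they overlap: \<open>\<mu> B + \<nu> (- B) \<ge> \<delta>\<close> for all Borel sets \<open>B\<close> (\<open>overlap_of_shared_towers\<close>).  Distinct
  ergodic measures are mutually singular, hence do not overlap.  As there are \<open>q\<close> towers at each level and one
  of them has mass at least \<open>1 / q\<close>, there are at most \<open>q\<close> ergodic measures (\<open>card_ergodic_subset\<close>).

  In the split interval, the orbit of a point outside the periodic intervals enters every block,
  so it accumulates at \<open>Plus 0\<close> (\<open>zero_in_closed_invariant\<close>).  Hence the closure of the orbit of
  \<open>Plus 0\<close> is the only minimal set (\<open>minimal_set_iff\<close>).  It contains no periodic point, so its invariant
  measures have no atoms; they ignore the countably many points \<open>Minus z\<close> and come from invariant
  measures on the line that are carried by the cells visited by the orbit of \<open>0\<close>.  Since there are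
  only finitely many possible return maps, a neighbourhood \<open>[0, 2\<^sup>-\<^sup>k\<^sup>-\<^sup>N)\<close> of \<open>0\<close> follows \<open>0\<close> into
  every visited base cell of level \<open>k\<close>, with \<open>N\<close> independent of \<open>k\<close> (\<open>uniform_entrance\<close>).  So these base
  cells have comparable mass, and the highest tower over them has a mass bounded below uniformly
  in the level and in the measure (\<open>carried_common_tower\<close>).  Thus any two such measures overlap, by a
  uniform amount.  If there were two different ones, conditioning them on an invariant set that
  tells them apart and on its complement would give two without overlap
  (\<open>invariant_measure_unique_if_overlapping\<close>).  An invariant measure exists as a limit of the
  uniform distributions on initial pieces of the orbit of \<open>0\<close> (\<open>carried_measure_exists\<close>).
\<close>

section \<open>Invariant measures of a measurable map\<close>

lemma invariant_measuresD:
  assumes "M \<in> invariant_measures X T"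
  shows "prob_space M" "sets M = sets (borel_of X)" "T \<in> M \<rightarrow>\<^sub>M M"
    "A \<in> sets M \<Longrightarrow> measure M (T -` A \<inter> space M) = measure M A"
    "A \<in> sets M \<Longrightarrow> T -` A \<inter> space M \<in> sets M"
  using assms unfolding invariant_measures_def measure_def by (auto intro: measurable_sets)

lemma invariant_measures_same_sets:
  assumes "M \<in> invariant_measures X T" "N \<in> invariant_measures X T"
  shows "sets N = sets M" "space N = space M"
proof -
  show "sets N = sets M" using assms by (auto simp: invariant_measures_def)
  thus "space N = space M" by (rule sets_eq_imp_space_eq)
qed

lemma invariant_measure_funpow:
  assumes "M \<in> invariant_measures X T" "A \<in> sets M"
  shows "(T ^^ n) -` A \<inter> space M \<in> sets M \<and> measure M ((T ^^ n) -` A \<inter> space M) = measure M A"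
proof (induction n)
  case 0
  show ?case using sets.Int_space_eq2[OF assms(2)] assms(2) by simp
next
  case (Suc n)
  have "T x \<in> space M" if "x \<in> space M" for x
    using that invariant_measuresD(3)[OF assms(1)] by (auto simp: measurable_def)
  hence "(T ^^ Suc n) -` A \<inter> space M = T -` ((T ^^ n) -` A \<inter> space M) \<inter> space M"
    by (auto simp: funpow_swap1)
  thus ?case using Suc invariant_measuresD[OF assms(1)] by metis
qed

text \<open>
  A Hahn set \<open>Y\<close> of the signed measure \<open>d = \<mu> - \<nu>\<close> maximizes \<open>d\<close>.  Since \<open>d (A \<union> B) + d (A \<inter> B) = d A + d B\<close>,
  the maximizing sets are closed under unions and intersections, and by invariance under
  preimages; so \<open>limsup T\<^sup>-\<^sup>n Y\<close> is a maximizing set as well, and it equals its preimage.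
\<close>

lemma invariant_set_separating_measures:
  assumes M: "M \<in> invariant_measures X T" and N: "N \<in> invariant_measures X T" and "M \<noteq> N"
  obtains B where "B \<in> sets M" "T -` B \<inter> space M = B" "measure N B < measure M B"
proof -
  interpret M: prob_space M using M invariant_measuresD(1) by blast
  interpret N: prob_space N using N invariant_measuresD(1) by blast
  have sN: "sets N = sets M" "space N = space M"
    using invariant_measures_same_sets[OF M N] by auto
  define d where "d A = measure M A - measure N A" for A
  have d_compl: "d (space M - A) = - d A" if "A \<in> sets M" for A
    using M.prob_compl[OF that] N.prob_compl[of A] that sN by (simp add: d_def)
  have d_Un: "d (A \<union> B) + d (A \<inter> B) = d A + d B" if "A \<in> sets M" "B \<in> sets M" for A B
  proof -
    have 1: "measure M (A \<union> B) = measure M A + measure M (B - A)"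
      "measure N (A \<union> B) = measure N A + measure N (B - A)"
      using M.finite_measure_Union'[of A B] N.finite_measure_Union'[of A B] that sN by auto
    have 2: "measure M (B - A) = measure M B - measure M (A \<inter> B)"
      "measure N (B - A) = measure N B - measure N (A \<inter> B)"
      using M.finite_measure_Diff'[of B A] N.finite_measure_Diff'[of B A] that sN
      by (auto simp: Int_commute)
    show ?thesis unfolding d_def using 1 2 by simp
  qed
  have d_pre: "d (T -` A \<inter> space M) = d A" if "A \<in> sets M" for A
    using invariant_measuresD(4)[OF M that] invariant_measuresD(4)[OF N, of A] that sN
    by (simp add: d_def)
  obtain Y where Y: "Y \<in> sets M" "\<forall>A\<in>sets M. A \<subseteq> Y \<longrightarrow> N A \<le> M A"
      "\<forall>A\<in>sets M. A \<inter> Y = {} \<longrightarrow> M A \<le> N A"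
    using finite_unsigned_Hahn_decomposition[OF M.finite_measure_axioms N.finite_measure_axioms sN(1)]
    by auto
  have Y1: "0 \<le> d A" if "A \<in> sets M" "A \<subseteq> Y" for A
    using Y(2) that by (auto simp: d_def M.emeasure_eq_measure N.emeasure_eq_measure)
  have Y2: "d A \<le> 0" if "A \<in> sets M" "A \<inter> Y = {}" for A
    using Y(3) that by (auto simp: d_def M.emeasure_eq_measure N.emeasure_eq_measure)
  have max: "d A \<le> d Y" if A: "A \<in> sets M" for A
  proof -
    have "d A = d (A \<inter> Y) + d (A - Y)"
      using d_Un[of "A \<inter> Y" "A - Y"] A Y(1) by (simp add: Int_Diff_Un d_def Diff_Int_distrib2 Int_Diff Int_assoc)
    moreover have "d Y = d (A \<inter> Y) + d (Y - A)"
    proof -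
      have "(A \<inter> Y) \<union> (Y - A) = Y" "(A \<inter> Y) \<inter> (Y - A) = {}" by auto
      with d_Un[of "A \<inter> Y" "Y - A"] A Y(1) show ?thesis by (simp add: d_def)
    qed
    moreover have "d (A - Y) \<le> 0" "0 \<le> d (Y - A)"
      using Y1[of "Y - A"] Y2[of "A - Y"] A Y(1) by auto
    ultimately show ?thesis by linarith
  qed
  have maxUI: "d (A \<union> B) = d Y" if "A \<in> sets M" "B \<in> sets M" "d A = d Y" "d B = d Y" for A B
    using d_Un[OF that(1,2)] max[of "A \<union> B"] max[of "A \<inter> B"] that by (simp add: sets.Un sets.Int)
  define U where "U n = (\<Union>j\<in>{n..}. (T ^^ j) -` Y \<inter> space M)" for n
  have pre: "(T ^^ j) -` Y \<inter> space M \<in> sets M" "d ((T ^^ j) -` Y \<inter> space M) = d Y" for j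
    using invariant_measure_funpow[OF M Y(1)] invariant_measure_funpow[OF N, of Y] Y(1) sN
    by (auto simp: d_def)
  have U_sets: "U n \<in> sets M" for n unfolding U_def using pre(1) by (intro sets.countable_UN') auto
  have dU: "d (U n) = d Y" for n
  proof -
    define V where "V i = (\<Union>j\<in>{n..n+i}. (T ^^ j) -` Y \<inter> space M)" for i
    have V: "V i \<in> sets M \<and> d (V i) = d Y" for i
    proof (induction i)
      case 0 thus ?case using pre by (simp add: V_def)
    next
      case (Suc i)
      have "V (Suc i) = V i \<union> ((T ^^ (n + Suc i)) -` Y \<inter> space M)"
      proof -
        have "{n..n + Suc i} = insert (n + Suc i) {n..n + i}" by auto
        thus ?thesis unfolding V_def by (simp only: UN_insert Un_commute)
      qed
      moreover have "d (V i \<union> ((T ^^ (n + Suc i)) -` Y \<inter> space M)) = d Y"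
        using Suc by (intro maxUI pre) auto
      moreover have "V i \<union> ((T ^^ (n + Suc i)) -` Y \<inter> space M) \<in> sets M"
        using Suc by (intro sets.Un pre) auto
      ultimately show ?case by (simp only:)
    qed
    have inc: "incseq V" unfolding V_def by (force simp: incseq_def)
    have UV: "(\<Union>i. V i) = U n" unfolding V_def U_def using nat_le_iff_add by fastforce
    have "(\<lambda>i. measure M (V i)) \<longlonglongrightarrow> measure M (U n)"
      using M.finite_Lim_measure_incseq[OF _ inc] V UV by auto
    moreover have "(\<lambda>i. measure N (V i)) \<longlonglongrightarrow> measure N (U n)"
      using N.finite_Lim_measure_incseq[OF _ inc] V UV sN by auto
    ultimately have "(\<lambda>i. d (V i)) \<longlonglongrightarrow> d (U n)" unfolding d_def by (rule tendsto_diff)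
    moreover have "(\<lambda>i. d (V i)) \<longlonglongrightarrow> d Y" using V by simp
    ultimately show ?thesis by (rule LIMSEQ_unique)
  qed
  define B where "B = (\<Inter>n. U n)"
  have dec: "decseq U" unfolding U_def decseq_def by force
  have "(\<lambda>n. measure M (U n)) \<longlonglongrightarrow> measure M B"
    unfolding B_def using M.finite_Lim_measure_decseq[OF _ dec] U_sets by auto
  moreover have "(\<lambda>n. measure N (U n)) \<longlonglongrightarrow> measure N B"
    unfolding B_def using N.finite_Lim_measure_decseq[OF _ dec] U_sets sN by auto
  ultimately have "(\<lambda>n. d (U n)) \<longlonglongrightarrow> d B" unfolding d_def by (rule tendsto_diff)
  moreover have "(\<lambda>n. d (U n)) \<longlonglongrightarrow> d Y" using dU by simp
  ultimately have dB: "d B = d Y" by (rule LIMSEQ_unique)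
  have Tsp: "T x \<in> space M" if "x \<in> space M" for x
    using that invariant_measuresD(3)[OF M] by (auto simp: measurable_def)
  have TU: "T -` U n \<inter> space M = U (Suc n)" for n
  proof -
    have mem_U: "x \<in> U n \<longleftrightarrow> x \<in> space M \<and> (\<exists>j\<ge>n. (T ^^ j) x \<in> Y)" for x n
      unfolding U_def by auto
    have "(T ^^ j) (T x) = (T ^^ Suc j) x" for j x by (simp add: funpow_swap1)
    hence shift: "(\<exists>j\<ge>n. (T ^^ j) (T x) \<in> Y) \<longleftrightarrow> (\<exists>j\<ge>n. (T ^^ Suc j) x \<in> Y)" for x
      by (simp only:)
    have Suc_ex: "(\<exists>j\<ge>Suc n. P j) \<longleftrightarrow> (\<exists>j\<ge>n. P (Suc j))" for P :: "nat \<Rightarrow> bool"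
    proof
      assume "\<exists>j\<ge>Suc n. P j"
      then obtain j where "j \<ge> Suc n" "P j" by blast
      thus "\<exists>j\<ge>n. P (Suc j)" by (intro exI[of _ "j - 1"]) auto
    qed auto
    show ?thesis
    proof (rule set_eqI)
      fix x
      show "x \<in> T -` U n \<inter> space M \<longleftrightarrow> x \<in> U (Suc n)"
        using Tsp[of x] by (simp only: mem_U Int_iff vimage_eq shift Suc_ex) blast
    qed
  qed
  have "T -` B \<inter> space M = (\<Inter>n. T -` U n \<inter> space M)" unfolding B_def by auto
  also have "\<dots> = (\<Inter>n. U (Suc n))" by (simp only: TU)
  also have "\<dots> = B" unfolding B_def
  proof -
    have step: "U (Suc n) \<subseteq> U n" for n using dec by (simp add: decseq_Suc_iff)
    show "(\<Inter>n. U (Suc n)) = (\<Inter>n. U n)"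
    proof (intro equalityI INT_greatest)
      show "(\<Inter>n. U (Suc n)) \<subseteq> U n" for n using step[of n] by (meson INT_lower UNIV_I subset_trans)
      show "(\<Inter>n. U n) \<subseteq> U (Suc n)" for n by (rule INT_lower) simp
    qed
  qed
  finally have "T -` B \<inter> space M = B" .
  moreover have "B \<in> sets M" unfolding B_def using U_sets by auto
  moreover have "0 < d Y"
  proof (rule ccontr)
    assume "\<not> 0 < d Y"
    hence le: "d A \<le> 0" if "A \<in> sets M" for A using max[OF that] by linarith
    have "d A = 0" if "A \<in> sets M" for A
      using le[OF that] le[of "space M - A"] d_compl[OF that] that by auto
    hence "M = N"
      by (intro measure_eqI) (auto simp: sN d_def M.emeasure_eq_measure N.emeasure_eq_measure)
    with \<open>M \<noteq> N\<close> show False ..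
  qed
  ultimately show ?thesis using that[of B] dB unfolding d_def by auto
qed

lemma ergodic_measures_singular:
  assumes M: "M \<in> ergodic_measures X T" and N: "N \<in> ergodic_measures X T" and "M \<noteq> N"
  obtains B where "B \<in> sets M" "measure N B = 0" "measure M (space M - B) = 0"
proof -
  have M': "M \<in> invariant_measures X T" and N': "N \<in> invariant_measures X T"
    using M N by (auto simp: ergodic_measures_def)
  obtain B where B: "B \<in> sets M" "T -` B \<inter> space M = B" "measure N B < measure M B"
    using invariant_set_separating_measures[OF M' N' \<open>M \<noteq> N\<close>] .
  interpret M: prob_space M using M' invariant_measuresD(1) by blast
  interpret N: prob_space N using N' invariant_measuresD(1) by blast
  have sN: "sets N = sets M" "space N = space M"
    using invariant_measures_same_sets[OF M' N'] by auto
  have "measure M B = 0 \<or> measure M B = 1" "measure N B = 0 \<or> measure N B = 1"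
    using M N B(1,2) sN
    by (auto simp: ergodic_measures_def M.emeasure_eq_measure N.emeasure_eq_measure)
  hence "measure N B = 0" "measure M B = 1" using B(3) by auto
  thus ?thesis using that[of B] B(1) M.prob_compl[OF B(1)] by auto
qed

lemma invariant_measure_conditioned:
  assumes M: "M \<in> invariant_measures X T"
    and B: "B \<in> sets M" "T -` B \<inter> space M = B" "measure M B > 0"
  shows "uniform_measure M B \<in> invariant_measures X T"
proof -
  interpret M: prob_space M using M invariant_measuresD(1) by blast
  have pos: "emeasure M B \<noteq> 0" "emeasure M B \<noteq> \<infinity>" using B(3) by (auto simp: M.emeasure_eq_measure)
  have "emeasure M (B \<inter> (T -` A \<inter> space M)) = emeasure M (B \<inter> A)" if "A \<in> sets M" for A
  proof -
    have "B \<inter> (T -` A \<inter> space M) = T -` (B \<inter> A) \<inter> space M" using B(2) by auto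
    moreover have "emeasure M (T -` (B \<inter> A) \<inter> space M) = emeasure M (B \<inter> A)"
      using M sets.Int[OF B(1) that] unfolding invariant_measures_def by blast
    ultimately show ?thesis by (simp only:)
  qed
  moreover have "T \<in> uniform_measure M B \<rightarrow>\<^sub>M uniform_measure M B"
    using invariant_measuresD(3)[OF M] by (simp cong: measurable_cong_sets)
  ultimately show ?thesis using M B(1) prob_space_uniform_measure[OF pos]
    invariant_measuresD(5)[OF M] unfolding invariant_measures_def
    by (auto simp: emeasure_uniform_measure)
qed

text \<open>
  The hypothesis bounds the overlap of any two invariant measures from below, uniformly.  Were
  there two different ones, conditioning them on a separating invariant set and on its complement
  would produce two invariant measures without overlap.
\<close>

lemma invariant_measure_unique_if_overlapping:
  assumes "\<delta> > 0"
    and overlap: "\<And>M N B. M \<in> invariant_measures X T \<Longrightarrow> N \<in> invariant_measures X T \<Longrightarrow>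
      B \<in> sets M \<Longrightarrow> \<delta> \<le> measure M B + measure N (space M - B)"
    and M: "M \<in> invariant_measures X T" and N: "N \<in> invariant_measures X T"
  shows "M = N"
proof (rule ccontr)
  assume "M \<noteq> N"
  obtain B where B: "B \<in> sets M" "T -` B \<inter> space M = B" "measure N B < measure M B"
    using invariant_set_separating_measures[OF M N \<open>M \<noteq> N\<close>] .
  interpret M: prob_space M using M invariant_measuresD(1) by blast
  interpret N: prob_space N using N invariant_measuresD(1) by blast
  have sN: "sets N = sets M" "space N = space M"
    using invariant_measures_same_sets[OF M N] by auto
  define C where "C = space M - B"
  have "measure N B < 1" using B(3) M.prob_le_1[of B] by linarith
  moreover have "T -` C \<inter> space N = C"
  proof -
    have "x \<in> T -` C \<inter> space N \<longleftrightarrow> x \<in> C" for x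
    proof (cases "x \<in> space M")
      case True
      hence "T x \<in> space M" using invariant_measuresD(3)[OF M] by (auto simp: measurable_def)
      moreover have "x \<in> T -` B \<inter> space M \<longleftrightarrow> x \<in> B" by (simp only: B(2))
      ultimately show ?thesis using True by (simp add: C_def sN)
    qed (simp add: C_def sN)
    thus ?thesis by blast
  qed
  ultimately have C: "C \<in> sets N" "T -` C \<inter> space N = C" "measure N C > 0"
    using B(1) sN N.prob_compl[of B] unfolding C_def by auto
  have posM: "measure M B > 0" using B(3) by (meson measure_nonneg order.strict_trans1)
  have "\<delta> \<le> measure (uniform_measure N C) B + measure (uniform_measure M B) (space N - B)"
    using overlap[OF invariant_measure_conditioned[OF N C] invariant_measure_conditioned[OF M B(1,2) posM], of B]
      B(1) sN by auto
  moreover have "measure (uniform_measure N C) B = 0"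
    using C B(1) sN by (subst measure_uniform_measure) (auto simp: N.emeasure_eq_measure C_def Int_commute)
  moreover have "measure (uniform_measure M B) (space N - B) = 0"
    using posM B(1) sN by (subst measure_uniform_measure) (auto simp: M.emeasure_eq_measure)
  ultimately show False using \<open>\<delta> > 0\<close> by simp
qed

section \<open>The von Neumann--Kakutani map\<close>

lemma kakutani_piece:
  assumes "n \<ge> 1" "1 - 2 / 2 ^ n \<le> x" "x < 1 - 1 / 2 ^ n"
  shows "kakutani x = x - (1 - 3 / 2 ^ n)"
proof -
  have less: False if "m < n'" "x < 1 - 1 / 2 ^ m" "1 - 2 / 2 ^ n' \<le> x" for m n' :: nat
  proof -
    have "(2::real) ^ Suc m \<le> 2 ^ n'" using that(1) by (intro power_increasing) auto
    hence "2 / 2 ^ n' \<le> (2::real) / 2 ^ Suc m" by (intro divide_left_mono) auto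
    thus False using that by simp
  qed
  have "(THE n::nat. n \<ge> 1 \<and> 1 - 2 / 2 ^ n \<le> x \<and> x < 1 - 1 / 2 ^ n) = n"
  proof (rule the_equality)
    fix m :: nat assume m: "m \<ge> 1 \<and> 1 - 2 / 2 ^ m \<le> x \<and> x < 1 - 1 / 2 ^ m"
    have "\<not> m < n" "\<not> n < m" using less[of m n] less[of n m] m assms by blast+
    thus "m = n" by simp
  qed (use assms in blast)
  thus ?thesis by (simp add: kakutani_def)
qed

lemma kakutani_piece_exists:
  fixes x :: real
  assumes "0 \<le> x" "x < 1"
  obtains n :: nat where "n \<ge> 1" "1 - 2 / 2 ^ n \<le> x" "x < 1 - 1 / 2 ^ n"
proof -
  define P where "P n \<longleftrightarrow> x < 1 - 1 / 2 ^ n" for n :: nat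
  obtain n0 where "(1/2::real) ^ n0 < 1 - x" using real_arch_pow_inv[of "1 - x" "1/2"] assms by auto
  hence "P n0" by (simp add: P_def power_one_over field_simps)
  define n where "n = (LEAST n. P n)"
  have L: "P n" unfolding n_def using \<open>P n0\<close> by (rule LeastI)
  have "n \<noteq> 0" using L assms(1) by (intro notI) (simp add: P_def)
  hence "\<not> P (n - 1)" using not_less_Least[of "n - 1" P] by (simp add: n_def)
  moreover have "2 / 2 ^ n = (1::real) / 2 ^ (n - 1)" using \<open>n \<noteq> 0\<close> by (cases n) auto
  ultimately show ?thesis using that[of n] L \<open>n \<noteq> 0\<close> unfolding P_def by simp
qed

lemma kakutani_piece_exists_left:
  fixes x :: real
  assumes "0 < x" "x < 1"
  obtains n :: nat where "n \<ge> 1" "1 - 2 / 2 ^ n < x" "x \<le> 1 - 1 / 2 ^ n"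
proof -
  define P where "P n \<longleftrightarrow> x \<le> 1 - 1 / 2 ^ n" for n :: nat
  obtain n0 where "(1/2::real) ^ n0 < 1 - x" using real_arch_pow_inv[of "1 - x" "1/2"] assms by auto
  hence "P n0" by (simp add: P_def power_one_over field_simps)
  define n where "n = (LEAST n. P n)"
  have L: "P n" unfolding n_def using \<open>P n0\<close> by (rule LeastI)
  have "n \<noteq> 0" using L assms(1) by (intro notI) (simp add: P_def)
  hence "\<not> P (n - 1)" using not_less_Least[of "n - 1" P] by (simp add: n_def)
  moreover have "2 / 2 ^ n = (1::real) / 2 ^ (n - 1)" using \<open>n \<noteq> 0\<close> by (cases n) auto
  ultimately show ?thesis using that[of n] L \<open>n \<noteq> 0\<close> unfolding P_def by simp
qed

lemma kakutani_range:
  assumes "0 \<le> x" "x < 1"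
  shows "0 < kakutani x" "kakutani x < 1" "kakutani x \<le> 2 * (1 - x)"
proof -
  obtain n :: nat where n: "n \<ge> 1" "1 - 2 / 2 ^ n \<le> x" "x < 1 - 1 / 2 ^ n"
    using kakutani_piece_exists[OF assms] .
  have K: "kakutani x = x - (1 - 3 / 2 ^ n)" using kakutani_piece[OF n] .
  define h where "h = (1::real) / 2 ^ n"
  have "(2::real) ^ 1 \<le> 2 ^ n" using n(1) by (intro power_increasing) auto
  hence h: "h \<le> 1/2" "h > 0" by (auto simp: h_def field_simps)
  have "1 - 2 * h \<le> x" "x < 1 - h" "kakutani x = x - 1 + 3 * h"
    using n K by (simp_all add: h_def)
  thus "0 < kakutani x" "kakutani x < 1" "kakutani x \<le> 2 * (1 - x)"
    using h by simp_all
qed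

lemma kakutani_left_half:
  assumes "0 \<le> x" "x < 1/2"
  shows "kakutani x = x + 1/2"
  using kakutani_piece[of 1 x] assms by simp

lemma kakutani_right_half:
  assumes "1/2 \<le> x" "x < 1"
  shows "kakutani x = kakutani (2 * x - 1) / 2"
proof -
  obtain n :: nat where n: "n \<ge> 1" "1 - 2 / 2 ^ n \<le> 2 * x - 1" "2 * x - 1 < 1 - 1 / 2 ^ n"
    using kakutani_piece_exists[of "2 * x - 1"] assms by auto
  define h where "h = (3::real) / 2 ^ n"
  have "kakutani x = x - (1 - 3 / 2 ^ Suc n)"
    using n by (intro kakutani_piece) (auto simp: field_simps)
  hence "kakutani x = x - (1 - h / 2)" by (simp add: h_def)
  moreover have "kakutani (2 * x - 1) = 2 * x - 1 - (1 - h)"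
    using kakutani_piece[OF n] by (simp add: h_def)
  ultimately show ?thesis by simp
qed

section \<open>The action on cells\<close>

definition cell :: "nat \<Rightarrow> nat \<Rightarrow> nat \<Rightarrow> real set" where
  "cell q k c = {real c / (real q * 2 ^ k) ..< (real c + 1) / (real q * 2 ^ k)}"

definition swap_halves :: "nat \<Rightarrow> nat \<Rightarrow> nat" where
  "swap_halves q d = (if d < q then d + q else if d < 2 * q then d - q else d)"

text \<open>
  The cells of level \<open>k\<close> cut \<open>[0,1)\<close> into \<open>q \<cdot> 2\<^sup>k\<close> equal parts, the first \<open>q\<close> of which fill
  \<open>[0, 2\<^sup>-\<^sup>k)\<close>.  Every cell has two children, and the Kakutani map, seen at scale \<open>2\<^sup>-\<^sup>k\<close>, starts
  by exchanging the two halves of \<open>[0, 2\<^sup>-\<^sup>k)\<close>: this is the recursion for the permutation by which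
  the odometer moves the cells of level \<open>k\<close>, as long as it does not enter \<open>[0, 2\<^sup>-\<^sup>k)\<close>.
\<close>

primrec level_perm :: "nat \<Rightarrow> (nat \<Rightarrow> nat) \<Rightarrow> nat \<Rightarrow> nat \<Rightarrow> nat" where
  "level_perm q \<pi> 0 = \<pi>"
| "level_perm q \<pi> (Suc k) = (\<lambda>c. swap_halves q (2 * level_perm q \<pi> k (c div 2) + c mod 2))"

locale rotated_odometer =
  fixes q :: nat and \<pi> :: "nat \<Rightarrow> nat"
  assumes q_pos: "q \<ge> 1" and perm: "\<pi> permutes {..<q}"
begin

abbreviation "F \<equiv> rot_odo q \<pi>"
abbreviation "P \<equiv> level_perm q \<pi>"

lemma in_cell: "x \<in> cell q k c \<longleftrightarrow> real c \<le> real q * 2 ^ k * x \<and> real q * 2 ^ k * x < real c + 1"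
  using q_pos by (auto simp: cell_def field_simps)

lemma cell_unique: "x \<in> cell q k c \<Longrightarrow> x \<in> cell q k d \<Longrightarrow> c = d"
  by (auto simp: in_cell)

lemma cell_shift:
  "x \<in> cell q k c \<Longrightarrow> x + (real d - real c) / (real q * 2 ^ k) \<in> cell q k d"
  using q_pos by (auto simp: in_cell distrib_left)

lemma cell_exists:
  assumes "x \<in> unit_ivl"
  obtains c where "c < q * 2 ^ k" "x \<in> cell q k c"
proof -
  define c where "c = nat \<lfloor>real q * 2 ^ k * x\<rfloor>"
  have nonneg: "0 \<le> real q * 2 ^ k * x" using assms by simp
  hence c: "real c = of_int \<lfloor>real q * 2 ^ k * x\<rfloor>" unfolding c_def by simp
  have "real q * 2 ^ k * x < real q * 2 ^ k" using assms q_pos by simp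
  hence "real c < real q * 2 ^ k" using c by linarith
  hence "real c < real (q * 2 ^ k)" by simp
  hence "c < q * 2 ^ k" by (simp only: of_nat_less_iff)
  moreover have "x \<in> cell q k c" unfolding in_cell c by linarith
  ultimately show ?thesis using that by blast
qed

lemma cell_subset_unit:
  assumes "c < q * 2 ^ k" "x \<in> cell q k c" shows "x \<in> unit_ivl"
proof -
  have "c + 1 \<le> q * 2 ^ k" using assms(1) by simp
  hence "real (c + 1) \<le> real (q * 2 ^ k)" by (simp only: of_nat_le_iff)
  hence "real c + 1 \<le> real q * 2 ^ k" by simp
  hence "real q * 2 ^ k * x < real q * 2 ^ k * 1" using assms(2) by (simp add: in_cell)
  moreover have "real q * 2 ^ k > 0" using q_pos by simp
  ultimately have "x < 1" using mult_less_cancel_left_pos by blast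
  moreover have "0 \<le> x"
  proof -
    have "0 \<le> real q * 2 ^ k * x" using assms(2) by (auto simp: in_cell intro: order_trans[rotated])
    thus ?thesis using \<open>real q * 2 ^ k > 0\<close> by (simp add: zero_le_mult_iff)
  qed
  ultimately show ?thesis by simp
qed

lemma cell_children: "x \<in> cell q (Suc k) c \<Longrightarrow> x \<in> cell q k (c div 2)"
proof -
  assume x: "x \<in> cell q (Suc k) c"
  have "real c = 2 * real (c div 2) + real (c mod 2)"
    by (metis mult_div_mod_eq of_nat_add of_nat_mult of_nat_numeral)
  moreover have "real (c mod 2) \<le> 1" "real (c mod 2) \<ge> 0"
    using of_nat_mono[of "c mod 2" 1] by auto
  moreover have "2 * real (c div 2) + 2 = 2 * (real (c div 2) + 1)" by simp
  ultimately show ?thesis using x by (simp add: in_cell algebra_simps)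
qed

lemma cell_first_block:
  assumes "x \<in> cell q k c" shows "x < 1 / 2 ^ k \<longleftrightarrow> c < q"
proof -
  have *: "x < 1 / 2 ^ k \<longleftrightarrow> real q * 2 ^ k * x < real q"
    using q_pos by (simp add: field_simps)
  show ?thesis
  proof
    assume "c < q"
    hence "real c + 1 \<le> real q" by simp
    hence "real q * 2 ^ k * x < real q" using assms unfolding in_cell by linarith
    thus "x < 1 / 2 ^ k" using * by blast
  next
    assume "x < 1 / 2 ^ k"
    hence "real q * 2 ^ k * x < real q" using * by blast
    hence "real c < real q" using assms unfolding in_cell by linarith
    thus "c < q" by simp
  qed
qed

lemma swap_halves_inj: "swap_halves q c = swap_halves q d \<Longrightarrow> c = d"
  by (auto simp: swap_halves_def split: if_splits)

lemma swap_halves_less: "2 * q \<le> n \<Longrightarrow> c < n \<Longrightarrow> swap_halves q c < n"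
  by (auto simp: swap_halves_def)

lemma P_less: "c < q * 2 ^ k \<Longrightarrow> P k c < q * 2 ^ k"
proof (induction k arbitrary: c)
  case 0 thus ?case using permutes_in_image[OF perm, of c] by simp
next
  case (Suc k)
  have "c div 2 < q * 2 ^ k" using Suc.prems by simp
  hence "P k (c div 2) < q * 2 ^ k" by (rule Suc.IH)
  hence "2 * P k (c div 2) + c mod 2 < q * 2 ^ Suc k" by simp
  moreover have "2 * q \<le> q * 2 ^ Suc k" by simp
  ultimately show ?case using swap_halves_less by simp
qed

lemma P_inj: "P k c = P k d \<Longrightarrow> c < q * 2 ^ k \<Longrightarrow> d < q * 2 ^ k \<Longrightarrow> c = d"
proof (induction k arbitrary: c d)
  case 0 thus ?case using permutes_inj[OF perm] by (auto dest: injD)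
next
  case (Suc k)
  have eq: "2 * P k (c div 2) + c mod 2 = 2 * P k (d div 2) + d mod 2"
    using Suc.prems(1) swap_halves_inj by simp
  have "P k (c div 2) = P k (d div 2)" "c mod 2 = d mod 2"
    using arg_cong[OF eq, of "\<lambda>n. n div 2"] arg_cong[OF eq, of "\<lambda>n. n mod 2"] by simp_all
  moreover have "c div 2 < q * 2 ^ k" "d div 2 < q * 2 ^ k" using Suc.prems by simp_all
  ultimately have "c div 2 = d div 2" using Suc.IH by blast
  thus ?case using \<open>c mod 2 = d mod 2\<close> by (metis div_mult_mod_eq)
qed

lemma P_bij: "bij_betw (P k) {..<q * 2 ^ k} {..<q * 2 ^ k}"
proof -
  have inj: "inj_on (P k) {..<q * 2 ^ k}" using P_inj by (auto intro!: inj_onI)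
  moreover have "P k ` {..<q * 2 ^ k} \<subseteq> {..<q * 2 ^ k}" using P_less by auto
  ultimately show ?thesis by (simp add: bij_betw_def endo_inj_surj)
qed

text \<open>
  Each level resolves one more step of the self-similar Kakutani map: if the first \<open>k\<close> levels send
  \<open>x\<close> into \<open>[0, 2\<^sup>-\<^sup>k)\<close>, then what remains is a copy of that map, which is a translation on its left
  half and a smaller copy of itself on its right half.
\<close>

lemma cell_step:
  assumes "x \<in> cell q k c" "c < q * 2 ^ k"
  shows "F x = (let y = x + (real (P k c) - real c) / (real q * 2 ^ k) in
    if P k c < q then kakutani (2 ^ k * y) / 2 ^ k else y)"
  using assms
proof (induction k arbitrary: c)
  case 0
  have "\<lfloor>real q * x\<rfloor> = int c" using 0 by (auto simp: in_cell floor_eq_iff)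
  moreover have "\<pi> c < q" using permutes_in_image[OF perm, of c] 0 by simp
  ultimately show ?case by (simp add: rot_odo_def rot_def Let_def)
next
  case (Suc k)
  define c0 where "c0 = c div 2"
  define D where "D = 2 * P k c0 + c mod 2"
  have c: "c = 2 * c0 + c mod 2" unfolding c0_def by simp
  have c0: "c0 < q * 2 ^ k" unfolding c0_def using Suc.prems by simp
  have PS: "P (Suc k) c = swap_halves q D" by (simp add: D_def c0_def)
  have x0: "x \<in> cell q k c0" unfolding c0_def using cell_children Suc.prems by simp
  define y where "y = x + (real (P k c0) - real c0) / (real q * 2 ^ k)"
  have qp: "real q > 0" using q_pos by simp
  have Dc: "real D - real c = 2 * (real (P k c0) - real c0)"
    using arg_cong[OF c, of real] unfolding D_def by simp
  have y: "y = x + (real D - real c) / (real q * 2 ^ Suc k)"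
  proof -
    have "a / (b * c) = 2 * a / (b * (2 * c))" for a b c :: real by simp
    thus ?thesis unfolding y_def Dc power_Suc by (simp only:)
  qed
  have yD: "y \<in> cell q (Suc k) D" unfolding y using cell_shift[OF Suc.prems(1)] by blast
  have IH: "F x = (if P k c0 < q then kakutani (2 ^ k * y) / 2 ^ k else y)"
    using Suc.IH[OF x0 c0] by (simp add: y_def Let_def)
  consider "q \<le> P k c0" | "P k c0 < q" "D < q" | "P k c0 < q" "q \<le> D" by linarith
  thus ?case
  proof cases
    case 1
    hence "2 * q \<le> D" unfolding D_def by simp
    hence "P (Suc k) c = D" "\<not> D < q" using q_pos unfolding PS by (auto simp: swap_halves_def)
    thus ?thesis using 1 IH y by (simp add: Let_def)
  next
    case 2
    have PD: "P (Suc k) c = D + q" unfolding PS using 2 by (simp add: swap_halves_def)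
    have "D < q * 2 ^ Suc k" using P_less[OF c0] unfolding D_def by simp
    hence "0 \<le> 2 ^ k * y" using cell_subset_unit[OF _ yD] by simp
    moreover have "2 ^ k * y < 1/2"
      using cell_first_block[OF yD] 2 by (simp add: field_simps)
    ultimately have "F x = y + 1 / 2 ^ Suc k" using IH 2 by (simp add: kakutani_left_half field_simps)
    also have "\<dots> = x + (real (P (Suc k) c) - real c) / (real q * 2 ^ Suc k)"
      unfolding y PD using qp by (simp add: field_simps)
    finally show ?thesis using PD by (simp add: Let_def)
  next
    case 3
    have D2: "D < 2 * q" using 3 unfolding D_def by simp
    hence PD: "P (Suc k) c = D - q" unfolding PS using 3 by (simp add: swap_halves_def)
    hence Pq: "P (Suc k) c < q" using D2 3 by simp
    have "1/2 \<le> 2 ^ k * y" using cell_first_block[OF yD] 3 by (simp add: field_simps)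
    moreover have "2 ^ k * y < 1"
      using cell_first_block[of y k "D div 2"] cell_children[OF yD] D2 by (simp add: field_simps)
    ultimately have "F x = kakutani (2 ^ Suc k * y - 1) / 2 ^ Suc k"
      using IH 3 by (simp add: kakutani_right_half mult.assoc)
    moreover have "2 ^ Suc k * y - 1 = 2 ^ Suc k * (x + (real (P (Suc k) c) - real c) / (real q * 2 ^ Suc k))"
      unfolding y PD using 3 qp by (simp add: of_nat_diff field_simps)
    ultimately show ?thesis using Pq by (simp add: Let_def)
  qed
qed

lemma F_translation:
  "x \<in> cell q k c \<Longrightarrow> c < q * 2 ^ k \<Longrightarrow> q \<le> P k c \<Longrightarrow>
    F x = x + (real (P k c) - real c) / (real q * 2 ^ k)"
  by (simp add: cell_step Let_def)

lemma F_into_block: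
  assumes "x \<in> cell q k c" "c < q * 2 ^ k" "P k c < q"
  shows "0 < F x" "F x < 1 / 2 ^ k"
proof -
  define y where "y = x + (real (P k c) - real c) / (real q * 2 ^ k)"
  have y: "y \<in> cell q k (P k c)" unfolding y_def using cell_shift[OF assms(1)] .
  have "0 \<le> y" using cell_subset_unit[OF P_less[OF assms(2)] y] by simp
  moreover have "y < 1 / 2 ^ k" using cell_first_block[OF y] assms(3) by simp
  ultimately have "0 \<le> 2 ^ k * y" "2 ^ k * y < 1" by (auto simp: field_simps)
  note r = kakutani_range[OF this]
  have "F x = kakutani (2 ^ k * y) / 2 ^ k"
    using cell_step[OF assms(1,2)] assms(3) unfolding y_def by (simp add: Let_def)
  thus "0 < F x" "F x < 1 / 2 ^ k" using r by (simp_all add: divide_strict_right_mono)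
qed

lemma F_range: "x \<in> unit_ivl \<Longrightarrow> 0 < F x \<and> F x < 1"
proof -
  assume "x \<in> unit_ivl"
  then obtain c where c: "c < q * 2 ^ 0" "x \<in> cell q 0 c" using cell_exists by blast
  have "P 0 c < q" using P_less[OF c(1)] by simp
  thus ?thesis using F_into_block[OF c(2,1)] by simp
qed

lemma F_unit: "x \<in> unit_ivl \<Longrightarrow> F x \<in> unit_ivl" using F_range[of x] by simp

lemma funpow_unit: "x \<in> unit_ivl \<Longrightarrow> (F ^^ n) x \<in> unit_ivl"
  by (induction n) (auto simp: F_range less_imp_le)

lemma funpow_pos: "x \<in> unit_ivl \<Longrightarrow> n > 0 \<Longrightarrow> 0 < (F ^^ n) x"
  using F_range[OF funpow_unit[of x "n - 1"]] by (cases n) auto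

lemma F_in_block_iff:
  assumes "x \<in> cell q k c" "c < q * 2 ^ k" shows "F x < 1 / 2 ^ k \<longleftrightarrow> P k c < q"
proof
  assume F: "F x < 1 / 2 ^ k"
  show "P k c < q"
  proof (rule ccontr)
    assume "\<not> P k c < q"
    hence "F x = x + (real (P k c) - real c) / (real q * 2 ^ k)" using F_translation assms by simp
    hence "F x \<in> cell q k (P k c)" using cell_shift[OF assms(1)] by simp
    thus False using cell_first_block F \<open>\<not> P k c < q\<close> by blast
  qed
qed (use F_into_block assms in blast)

lemma F_cell:
  assumes "x \<in> cell q k c" "c < q * 2 ^ k" "q \<le> P k c" shows "F x \<in> cell q k (P k c)"
  using F_translation[OF assms] cell_shift[OF assms(1), of "P k c"] by simp

lemma F_cell_iff:
  assumes x: "x \<in> unit_ivl" and c: "c < q * 2 ^ k" and q: "q \<le> P k c"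
  shows "F x \<in> cell q k (P k c) \<longleftrightarrow> x \<in> cell q k c"
proof
  assume Fx: "F x \<in> cell q k (P k c)"
  obtain d where d: "d < q * 2 ^ k" "x \<in> cell q k d" using cell_exists[OF x] .
  have "\<not> F x < 1 / 2 ^ k" using cell_first_block[OF Fx] q by simp
  hence qd: "q \<le> P k d" using F_in_block_iff[OF d(2,1)] by simp
  hence "F x \<in> cell q k (P k d)" using F_cell d by simp
  hence "P k d = P k c" using Fx cell_unique by blast
  hence "d = c" using P_inj d c by blast
  thus "x \<in> cell q k c" using d by simp
qed (use F_cell assms in blast)

lemma block_small: "0 < x \<Longrightarrow> \<exists>k. (1::real) / 2 ^ k \<le> x"
  using real_arch_pow_inv[of x "1/2"] by (auto simp: power_one_over intro: less_imp_le)

lemma translation_cell: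
  assumes "x \<in> unit_ivl"
  obtains k c where "c < q * 2 ^ k" "x \<in> cell q k c" "q \<le> P k c"
proof -
  obtain k where k: "(1::real) / 2 ^ k \<le> F x" using block_small F_range[OF assms] by blast
  obtain c where c: "c < q * 2 ^ k" "x \<in> cell q k c" using cell_exists[OF assms] .
  have "q \<le> P k c" using F_in_block_iff[OF c(2,1)] k by simp
  thus ?thesis using that c by blast
qed

lemma F_inj: "inj_on F unit_ivl"
proof (rule inj_onI)
  fix x y assume x: "x \<in> unit_ivl" and y: "y \<in> unit_ivl" and eq: "F x = F y"
  obtain k c where c: "c < q * 2 ^ k" "x \<in> cell q k c" "q \<le> P k c" using translation_cell[OF x] .
  have "F y \<in> cell q k (P k c)" using F_cell[OF c(2,1,3)] eq by (simp only:)
  hence "y \<in> cell q k c" using F_cell_iff[OF y c(1,3)] by blast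
  thus "x = y" using F_translation[OF c(2,1,3)] F_translation[OF _ c(1,3), of y] eq by linarith
qed

lemma funpow_inj: "inj_on (F ^^ n) unit_ivl"
proof (induction n)
  case (Suc n)
  have "inj_on (F \<circ> (F ^^ n)) unit_ivl"
    using Suc funpow_unit by (intro comp_inj_on inj_on_subset[OF F_inj]) auto
  thus ?case by (simp add: comp_def)
qed simp

lemma F_diff_rational: "x \<in> unit_ivl \<Longrightarrow> F x - x \<in> \<rat>"
proof -
  assume "x \<in> unit_ivl"
  then obtain k c where c: "c < q * 2 ^ k" "x \<in> cell q k c" "q \<le> P k c" by (rule translation_cell)
  show ?thesis using F_translation[OF c(2,1,3)] by simp
qed

lemma funpow_diff_rational: "x \<in> unit_ivl \<Longrightarrow> (F ^^ n) x - x \<in> \<rat>"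
proof (induction n)
  case (Suc n)
  have "(F ^^ Suc n) x - x = (F ((F ^^ n) x) - (F ^^ n) x) + ((F ^^ n) x - x)" by simp
  moreover have "(F ((F ^^ n) x) - (F ^^ n) x) + ((F ^^ n) x - x) \<in> \<rat>"
    by (intro Rats_add F_diff_rational funpow_unit Suc)
  ultimately show ?case by (simp only:)
qed simp

lemma right_translation:
  assumes "x \<in> unit_ivl"
  shows "\<exists>e>0. \<forall>y\<in>{x..<x+e}. y < 1 \<and> F y = F x + (y - x)"
proof -
  obtain k c where c: "c < q * 2 ^ k" "x \<in> cell q k c" "q \<le> P k c" using translation_cell[OF assms] .
  define e where "e = (real c + 1) / (real q * 2 ^ k) - x"
  have "e > 0" using c(2) by (simp add: cell_def e_def)
  moreover have "y \<in> cell q k c" if "y \<in> {x..<x+e}" for y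
    using that c(2) by (auto simp: cell_def e_def)
  moreover have "y < 1 \<and> F y = F x + (y - x)" if "y \<in> cell q k c" for y
    using cell_subset_unit[OF c(1) that] F_translation[OF that c(1,3)] F_translation[OF c(2,1,3)]
    by simp
  ultimately show ?thesis by blast
qed

lemma right_translation_funpow:
  assumes "x \<in> unit_ivl"
  shows "\<exists>e>0. \<forall>s\<le>n. \<forall>y\<in>{x..<x+e}. (F ^^ s) y = (F ^^ s) x + (y - x)"
proof (induction n)
  case 0 show ?case by (intro exI[of _ 1]) simp
next
  case (Suc n)
  then obtain e where e: "e > 0" "\<And>s y. s \<le> n \<Longrightarrow> y \<in> {x..<x+e} \<Longrightarrow> (F ^^ s) y = (F ^^ s) x + (y - x)"
    by blast
  obtain e' where e': "e' > 0" "\<And>y. y \<in> {(F ^^ n) x..<(F ^^ n) x + e'} \<Longrightarrow>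
      F y = F ((F ^^ n) x) + (y - (F ^^ n) x)"
    using right_translation[OF funpow_unit[OF assms]] by blast
  have "(F ^^ s) y = (F ^^ s) x + (y - x)" if "s \<le> Suc n" "y \<in> {x..<x + min e e'}" for s y
  proof -
    have y: "x \<le> y" "y < x + e" "y < x + e'" using that(2) by auto
    show ?thesis
    proof (cases "s = Suc n")
      case False
      thus ?thesis using e(2)[of s y] that(1) y by simp
    next
      case True
      have n: "(F ^^ n) y = (F ^^ n) x + (y - x)" using e(2)[of n y] y by simp
      hence "F ((F ^^ n) y) = F ((F ^^ n) x) + ((F ^^ n) y - (F ^^ n) x)"
        using e'(2)[of "(F ^^ n) y"] y by simp
      thus ?thesis using n True by simp
    qed
  qed
  moreover have "min e e' > 0" using e(1) e'(1) by simp
  ultimately show ?case by blast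
qed

end

section \<open>Towers and periodic cells\<close>

lemma inj_on_funpow_recurrent:
  assumes "finite A" "inj_on f A" "f ` A \<subseteq> A" "x \<in> A"
  obtains n where "n \<ge> 1" "(f ^^ n) x = x"
proof -
  have mem: "(f ^^ n) x \<in> A" for n using assms(3,4) by (induction n) auto
  have "\<not> inj (\<lambda>n. (f ^^ n) x)"
  proof
    assume "inj (\<lambda>n. (f ^^ n) x)"
    moreover have "finite (range (\<lambda>n. (f ^^ n) x))" using mem assms(1) by (meson finite_subset image_subsetI)
    ultimately show False using finite_imageD infinite_UNIV_nat by blast
  qed
  then obtain m n where "m \<noteq> n" "(f ^^ m) x = (f ^^ n) x" by (auto simp: inj_def)
  hence "\<exists>m d. d \<ge> 1 \<and> (f ^^ m) x = (f ^^ (m + d)) x"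
  proof (induction m n rule: linorder_wlog)
    case (le m n)
    thus ?case by (intro exI[of _ m] exI[of _ "n - m"]) simp
  next
    case (sym m n)
    thus ?case by simp
  qed
  then obtain m d where d: "d \<ge> 1" "(f ^^ m) x = (f ^^ (m + d)) x" by blast
  from d(2) have "(f ^^ d) x = x"
  proof (induction m)
    case (Suc m)
    hence "f ((f ^^ m) x) = f ((f ^^ (m + d)) x)" by simp
    thus ?case using Suc.IH inj_onD[OF assms(2)] mem by blast
  qed simp
  thus ?thesis using that d(1) by blast
qed

lemma funpow_multiple_fixed: "(f ^^ n) x = x \<Longrightarrow> (f ^^ (n * m)) x = x"
  by (induction m) (simp_all add: funpow_add)

context rotated_odometer
begin

lemma P_funpow_less: "c < q * 2 ^ k \<Longrightarrow> (P k ^^ t) c < q * 2 ^ k"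
  by (induction t) (auto intro: P_less)

lemma P_recurrent:
  assumes "c < q * 2 ^ k" obtains n where "n \<ge> 1" "(P k ^^ n) c = c"
proof -
  have "inj_on (P k) {..<q * 2 ^ k}" "P k ` {..<q * 2 ^ k} \<subseteq> {..<q * 2 ^ k}" "c \<in> {..<q * 2 ^ k}"
    using P_bij[of k] assms by (simp_all add: bij_betw_def)
  thus ?thesis using that by (rule inj_on_funpow_recurrent[OF finite_lessThan])
qed

lemma P_funpow_inj:
  "(P k ^^ t) c = (P k ^^ t) d \<Longrightarrow> c < q * 2 ^ k \<Longrightarrow> d < q * 2 ^ k \<Longrightarrow> c = d"
  by (induction t) (auto dest: P_inj P_funpow_less)

lemma funpow_cell_iff:
  assumes "x \<in> unit_ivl" "c < q * 2 ^ k" "\<And>s. 0 < s \<Longrightarrow> s \<le> t \<Longrightarrow> q \<le> (P k ^^ s) c"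
  shows "(F ^^ t) x \<in> cell q k ((P k ^^ t) c) \<longleftrightarrow> x \<in> cell q k c"
  using assms(3)
proof (induction t)
  case (Suc t)
  have "q \<le> P k ((P k ^^ t) c)" using Suc.prems[of "Suc t"] by simp
  hence "(F ^^ Suc t) x \<in> cell q k ((P k ^^ Suc t) c) \<longleftrightarrow> (F ^^ t) x \<in> cell q k ((P k ^^ t) c)"
    using F_cell_iff[OF funpow_unit[OF assms(1)] P_funpow_less[OF assms(2)]] by simp
  thus ?case using Suc by simp
qed simp

lemma funpow_translation:
  assumes "x \<in> cell q k c" "c < q * 2 ^ k" "\<And>s. 0 < s \<Longrightarrow> s \<le> t \<Longrightarrow> q \<le> (P k ^^ s) c"
  shows "(F ^^ t) x = x + (real ((P k ^^ t) c) - real c) / (real q * 2 ^ k)"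
  using assms(3)
proof (induction t)
  case (Suc t)
  have "q \<le> P k ((P k ^^ t) c)" using Suc.prems[of "Suc t"] by simp
  moreover have "(F ^^ t) x \<in> cell q k ((P k ^^ t) c)"
    using funpow_cell_iff[of x c k t] cell_subset_unit assms(1,2) Suc.prems by simp
  ultimately have "(F ^^ Suc t) x = (F ^^ t) x
      + (real ((P k ^^ Suc t) c) - real ((P k ^^ t) c)) / (real q * 2 ^ k)"
    using F_translation P_funpow_less[OF assms(2)] by simp
  also have "(F ^^ t) x = x + (real ((P k ^^ t) c) - real c) / (real q * 2 ^ k)"
    using Suc by simp
  finally show ?case by (simp add: diff_divide_distrib)
qed simp

text \<open>The Rokhlin tower over the base cell \<open>j < q\<close>, as a set of indices of cells of level \<open>k\<close>.\<close>

definition tower :: "nat \<Rightarrow> nat \<Rightarrow> nat set" where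
  "tower k j = {c. \<exists>t. (P k ^^ t) j = c \<and> (\<forall>s. 0 < s \<and> s \<le> t \<longrightarrow> q \<le> (P k ^^ s) j)}"

lemma base_less: "j < q \<Longrightarrow> j < q * 2 ^ k"
  by (metis less_le_trans mult.right_neutral mult_le_mono2 one_le_numeral one_le_power)

lemma tower_less: "j < q \<Longrightarrow> tower k j \<subseteq> {..<q * 2 ^ k}"
  using P_funpow_less base_less by (auto simp: tower_def)

lemma finite_tower: "j < q \<Longrightarrow> finite (tower k j)"
  using tower_less finite_subset by blast

lemma base_in_tower: "j \<in> tower k j"
  unfolding tower_def by (auto intro!: exI[of _ 0])

text \<open>
  If the cycle of \<open>P k\<close> through \<open>c\<close> meets the base \<open>{..<q}\<close>, then the last base cell before \<open>c\<close> is
  the one whose tower contains \<open>c\<close>.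
\<close>

lemma cell_dichotomy:
  assumes "c < q * 2 ^ k"
  shows "(\<exists>j<q. c \<in> tower k j) \<or> (\<forall>s. q \<le> (P k ^^ s) c)"
proof (rule disjCI)
  assume "\<not> (\<forall>s. q \<le> (P k ^^ s) c)"
  then obtain s0 where s0: "(P k ^^ s0) c < q" by (auto simp: not_le)
  obtain n where n: "n \<ge> 1" "(P k ^^ n) c = c" using P_recurrent[OF assms] .
  define N where "N = n * s0"
  have N: "(P k ^^ N) c = c" "s0 \<le> N" using n funpow_multiple_fixed by (auto simp: N_def)
  define S where "S = {s. s \<le> N \<and> (P k ^^ s) c < q}"
  have S: "finite S" "s0 \<in> S" using s0 N by (auto simp: S_def)
  define s where "s = Max S"
  have s: "s \<in> S" using S unfolding s_def by (intro Max_in) auto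
  define j where "j = (P k ^^ s) c"
  have shift: "(P k ^^ t) j = (P k ^^ (t + s)) c" for t unfolding j_def by (simp add: funpow_add)
  have "(P k ^^ (N - s)) j = c" using shift[of "N - s"] s N by (simp add: S_def)
  moreover have "q \<le> (P k ^^ t) j" if "0 < t" "t \<le> N - s" for t
  proof (rule ccontr)
    assume "\<not> q \<le> (P k ^^ t) j"
    hence "t + s \<in> S" using that s by (auto simp: S_def shift)
    hence "t + s \<le> s" unfolding s_def using S by (intro Max_ge) auto
    thus False using that by simp
  qed
  ultimately have "c \<in> tower k j" unfolding tower_def by blast
  moreover have "j < q" using s by (simp add: S_def j_def)
  ultimately show "\<exists>j<q. c \<in> tower k j" by blast
qed

definition cyclic_cells :: "nat \<Rightarrow> nat set" where
  "cyclic_cells k = {c. c < q * 2 ^ k \<and> (\<forall>s. q \<le> (P k ^^ s) c)}"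

lemma cyclic_cell_period:
  assumes "c \<in> cyclic_cells k"
  obtains n where "n \<ge> 1" "\<And>x. x \<in> cell q k c \<Longrightarrow> (F ^^ n) x = x"
proof -
  obtain n where n: "n \<ge> 1" "(P k ^^ n) c = c"
    using P_recurrent assms by (auto simp: cyclic_cells_def)
  have "(F ^^ n) x = x" if "x \<in> cell q k c" for x
    using funpow_translation[OF that, of n] assms n(2) by (simp add: cyclic_cells_def)
  thus ?thesis using that n(1) by blast
qed

lemma cyclic_cell_subset_I_per:
  assumes "c \<in> cyclic_cells k" shows "cell q k c \<subseteq> I_per q \<pi>"
proof
  fix x assume x: "x \<in> cell q k c"
  obtain n where "n \<ge> 1" "(F ^^ n) x = x" using cyclic_cell_period[OF assms] x by blast
  thus "x \<in> I_per q \<pi>"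
    using cell_subset_unit[OF _ x] assms by (auto simp: I_per_def cyclic_cells_def)
qed

lemma avoiding_block_imp_cyclic:
  assumes "x \<in> cell q k c" "c < q * 2 ^ k" "\<And>t. 1 / 2 ^ k \<le> (F ^^ t) x"
  shows "c \<in> cyclic_cells k"
proof -
  have "(F ^^ s) x \<in> cell q k ((P k ^^ s) c) \<and> q \<le> (P k ^^ s) c" for s
  proof (induction s)
    case 0 show ?case using cell_first_block[OF assms(1)] assms(1) assms(3)[of 0] by simp
  next
    case (Suc s)
    have l: "(P k ^^ s) c < q * 2 ^ k" using P_funpow_less assms(2) .
    have "q \<le> P k ((P k ^^ s) c)"
      using F_in_block_iff[OF conjunct1[OF Suc] l] assms(3)[of "Suc s"] by simp
    thus ?case using F_cell[OF conjunct1[OF Suc] l] by simp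
  qed
  thus ?thesis using assms(2) by (simp add: cyclic_cells_def)
qed

lemma np_enters_block:
  assumes "x \<in> I_np q \<pi>"
  shows "\<exists>t. (F ^^ t) x < 1 / 2 ^ k"
proof (rule ccontr)
  assume no: "\<not> ?thesis"
  have "x \<in> unit_ivl" using assms by (simp add: I_np_def)
  then obtain c where "c < q * 2 ^ k" "x \<in> cell q k c" by (rule cell_exists)
  hence "c \<in> cyclic_cells k" "x \<in> cell q k c" using avoiding_block_imp_cyclic no by (auto simp: not_less)
  hence "x \<in> I_per q \<pi>" using cyclic_cell_subset_I_per by blast
  thus False using assms by (simp add: I_np_def)
qed

text \<open>
  A periodic orbit is finite and consists of values of the map, so it keeps a distance from \<open>0\<close>,
  which is not a value.
\<close>

lemma I_per_in_cyclic_cell: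
  assumes "x \<in> I_per q \<pi>"
  obtains k c where "c \<in> cyclic_cells k" "x \<in> cell q k c"
proof -
  obtain n where x: "x \<in> unit_ivl" and n: "n \<ge> 1" "(F ^^ n) x = x" using assms by (auto simp: I_per_def)
  define m where "m = Min ((\<lambda>t. (F ^^ t) x) ` {..<n})"
  have pos: "0 < (F ^^ t) x" for t
    using funpow_pos[OF x, of t] funpow_pos[OF x, of n] n by (cases "t = 0") auto
  have "{..<n} \<noteq> {}" using n(1) by (auto simp: lessThan_empty_iff)
  hence "0 < m" unfolding m_def by (subst Min_gr_iff) (auto intro: pos)
  then obtain k where k: "(1::real) / 2 ^ k \<le> m" using block_small by blast
  have "m \<le> (F ^^ t) x" for t
  proof -
    have "(F ^^ (t mod n)) x = (F ^^ t) x" using funpow_mod_eq[OF n(2)] .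
    moreover have "m \<le> (F ^^ (t mod n)) x" unfolding m_def using n(1) by (intro Min_le) auto
    ultimately show ?thesis by simp
  qed
  hence av: "1 / 2 ^ k \<le> (F ^^ t) x" for t using k order_trans by blast
  obtain c where c: "c < q * 2 ^ k" "x \<in> cell q k c" using cell_exists[OF x] .
  show ?thesis using that[OF avoiding_block_imp_cyclic[OF c(2,1) av] c(2)] .
qed

lemma I_per_eq: "I_per q \<pi> = (\<Union>k. \<Union>c\<in>cyclic_cells k. cell q k c)"
proof (intro equalityI subsetI)
  fix x assume "x \<in> I_per q \<pi>"
  then obtain k c where "c \<in> cyclic_cells k" "x \<in> cell q k c" by (rule I_per_in_cyclic_cell)
  thus "x \<in> (\<Union>k. \<Union>c\<in>cyclic_cells k. cell q k c)" by blast
qed (use cyclic_cell_subset_I_per in blast)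

lemma I_np_unit: "x \<in> I_np q \<pi> \<Longrightarrow> x \<in> unit_ivl" by (simp add: I_np_def)

lemma zero_not_periodic: "n \<ge> 1 \<Longrightarrow> (F ^^ n) 0 \<noteq> 0"
  using funpow_pos[of 0 n] by simp

lemma zero_np: "0 \<in> I_np q \<pi>"
  using zero_not_periodic by (auto simp: I_np_def I_per_def)

lemma F_np_iff:
  assumes x: "x \<in> unit_ivl" shows "F x \<in> I_np q \<pi> \<longleftrightarrow> x \<in> I_np q \<pi>"
proof -
  have "(F ^^ n) (F x) = F x \<longleftrightarrow> (F ^^ n) x = x" for n
    using inj_onD[OF F_inj _ funpow_unit[OF x] x] by (metis funpow_swap1)
  thus ?thesis using x F_unit[OF x] by (simp add: I_np_def I_per_def)
qed

lemma funpow_np: "x \<in> I_np q \<pi> \<Longrightarrow> (F ^^ n) x \<in> I_np q \<pi>"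
  by (induction n) (auto simp: F_np_iff[OF I_np_unit])

text \<open>The positive numbers \<open>F\<^sup>s 0\<close> with \<open>0 < s < R\<close> have a minimum, and near \<open>0\<close> these iterates are translations.\<close>

lemma return_time_unbounded:
  obtains k0 where "\<And>k y s. k \<ge> k0 \<Longrightarrow> 0 \<le> y \<Longrightarrow> y < 1 / 2 ^ k \<Longrightarrow> 0 < s \<Longrightarrow> s < R \<Longrightarrow>
    1 / 2 ^ k \<le> (F ^^ s) y"
proof -
  have "(0::real) \<in> unit_ivl" by simp
  from right_translation_funpow[OF this, of R] obtain e where e: "e > 0"
    "\<And>s y. s \<le> R \<Longrightarrow> y \<in> {0..<0+e} \<Longrightarrow> (F ^^ s) y = (F ^^ s) 0 + (y - 0)"
    by blast
  define m where "m = Min (insert e ((\<lambda>s. (F ^^ s) 0) ` {1..<R}))"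
  have "0 < m" unfolding m_def using e(1) funpow_pos[of 0] by (subst Min_gr_iff) auto
  then obtain k0 where k0: "(1::real) / 2 ^ k0 \<le> m" using block_small by blast
  show ?thesis
  proof (rule that)
    fix k s :: nat and y :: real assume a: "k \<ge> k0" "0 \<le> y" "y < 1 / 2 ^ k" "0 < s" "s < R"
    have "(1::real) / 2 ^ k \<le> 1 / 2 ^ k0" using a(1) by (intro divide_left_mono power_increasing) auto
    hence km: "1 / 2 ^ k \<le> m" using k0 by linarith
    have "m \<le> e" unfolding m_def by (intro Min_le) auto
    moreover have "m \<le> (F ^^ s) 0"
      unfolding m_def using a by (intro Min_le insertI2 image_eqI[of _ _ s]) auto
    moreover have "(F ^^ s) y = (F ^^ s) 0 + y" using e(2)[of s y] a km \<open>m \<le> e\<close> by auto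
    ultimately show "1 / 2 ^ k \<le> (F ^^ s) y" using km a by linarith
  qed
qed

section \<open>Renormalization\<close>

definition return_time :: "nat \<Rightarrow> nat \<Rightarrow> nat" where
  "return_time k i = (LEAST t. t \<ge> 1 \<and> (P k ^^ t) i < q)"

definition return_perm :: "nat \<Rightarrow> nat \<Rightarrow> nat" where
  "return_perm k i = (if i < q then (P k ^^ return_time k i) i else i)"

lemma return_time:
  assumes "i < q"
  shows "return_time k i \<ge> 1" "(P k ^^ return_time k i) i < q"
    "\<And>s. 0 < s \<Longrightarrow> s < return_time k i \<Longrightarrow> q \<le> (P k ^^ s) i"
proof -
  obtain n where "n \<ge> 1" "(P k ^^ n) i = i" using P_recurrent base_less assms by blast
  hence "\<exists>t. t \<ge> 1 \<and> (P k ^^ t) i < q" using assms by metis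
  hence *: "return_time k i \<ge> 1 \<and> (P k ^^ return_time k i) i < q"
    unfolding return_time_def by (rule LeastI_ex)
  thus "return_time k i \<ge> 1" "(P k ^^ return_time k i) i < q" by auto
  show "q \<le> (P k ^^ s) i" if "0 < s" "s < return_time k i" for s
    using not_less_Least[of s "\<lambda>t. t \<ge> 1 \<and> (P k ^^ t) i < q"] that
    unfolding return_time_def by auto
qed

lemma return_perm_permutes: "return_perm k permutes {..<q}"
proof (rule bij_imp_permutes)
  have le: "i = j" if "i < q" "j < q" "return_perm k i = return_perm k j"
    "return_time k i \<le> return_time k j" for i j
  proof -
    define d where "d = return_time k j - return_time k i"
    have "return_time k j = return_time k i + d" using that(4) by (simp add: d_def)
    hence "(P k ^^ return_time k i) i = (P k ^^ return_time k i) ((P k ^^ d) j)"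
      using that by (simp add: return_perm_def funpow_add)
    hence i: "i = (P k ^^ d) j"
      using P_funpow_inj base_less[OF that(1)] P_funpow_less[OF base_less[OF that(2)]] by blast
    have "d < return_time k j" using return_time(1)[OF that(1), of k] return_time(1)[OF that(2), of k]
      unfolding d_def by linarith
    hence "d = 0" using return_time(3)[OF that(2), of d k] i that(1) by auto
    thus "i = j" using i by simp
  qed
  have inj: "inj_on (return_perm k) {..<q}"
    by (rule inj_onI) (metis le lessThan_iff nle_le)
  have "return_perm k ` {..<q} \<subseteq> {..<q}" using return_time(2) by (auto simp: return_perm_def)
  with inj show "bij_betw (return_perm k) {..<q} {..<q}" by (simp add: bij_betw_def endo_inj_surj)
qed (simp add: return_perm_def)

text \<open>
  Because the rescaled first return map is given by another permutation of the same \<open>q\<close> symbols,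
  only finitely many maps arise in this way.  A constant that depends on the return map alone is
  therefore bounded uniformly in \<open>k\<close>.
\<close>

lemma first_return:
  assumes "x \<in> cell q k i" "i < q"
  shows "(F ^^ return_time k i) x = rot_odo q (return_perm k) (2 ^ k * x) / 2 ^ k"
    and "\<And>s. 0 < s \<Longrightarrow> s < return_time k i \<Longrightarrow> 1 / 2 ^ k \<le> (F ^^ s) x"
proof -
  define r where "r = return_time k i - 1"
  have r: "return_time k i = Suc r" using return_time(1)[OF assms(2), of k] by (simp add: r_def)
  note i = base_less[OF assms(2), of k]
  have ge: "q \<le> (P k ^^ s) i" if "0 < s" "s \<le> r" for s
    using return_time(3)[OF assms(2), of s k] that r by simp
  have xu: "x \<in> unit_ivl" using cell_subset_unit[OF i assms(1)] .
  show "1 / 2 ^ k \<le> (F ^^ s) x" if "0 < s" "s < return_time k i" for s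
  proof -
    have "(F ^^ s) x \<in> cell q k ((P k ^^ s) i)"
      using funpow_cell_iff[OF xu i, of s] ge that r assms(1) by simp
    thus ?thesis using cell_first_block ge[of s] that r by (metis less_Suc_eq_le linorder_not_less)
  qed
  define d where "d = (P k ^^ r) i"
  have y: "(F ^^ r) x \<in> cell q k d" unfolding d_def
    using funpow_cell_iff[OF xu i, of r] ge assms(1) by simp
  have yx: "(F ^^ r) x = x + (real d - real i) / (real q * 2 ^ k)"
    unfolding d_def using funpow_translation[OF assms(1) i, of r] ge by simp
  have d: "d < q * 2 ^ k" unfolding d_def using P_funpow_less[OF i] .
  have Pd: "P k d = return_perm k i" using assms(2) r by (simp add: d_def return_perm_def)
  have lt: "P k d < q" unfolding Pd using return_time(2)[OF assms(2), of k] assms(2)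
    by (simp add: return_perm_def)
  have "(F ^^ return_time k i) x
      = kakutani (2 ^ k * ((F ^^ r) x + (real (P k d) - real d) / (real q * 2 ^ k))) / 2 ^ k"
    using cell_step[OF y d] lt r by (simp add: Let_def)
  also have "2 ^ k * ((F ^^ r) x + (real (P k d) - real d) / (real q * 2 ^ k))
      = 2 ^ k * x + (real (return_perm k i) - real i) / real q"
    unfolding yx Pd using q_pos by (simp add: field_simps)
  also have "\<dots> = rot q (return_perm k) (2 ^ k * x)"
  proof -
    have "\<lfloor>real q * (2 ^ k * x)\<rfloor> = int i"
      using assms(1) by (simp add: in_cell floor_eq_iff mult.assoc)
    thus ?thesis by (simp add: rot_def Let_def)
  qed
  also have "kakutani (rot q (return_perm k) (2 ^ k * x)) = rot_odo q (return_perm k) (2 ^ k * x)"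
    by (simp add: rot_odo_def)
  finally show "(F ^^ return_time k i) x = rot_odo q (return_perm k) (2 ^ k * x) / 2 ^ k" .
qed

lemma block_cell:
  assumes "0 \<le> x" "x < 1 / 2 ^ k" obtains i where "i < q" "x \<in> cell q k i"
proof -
  have "(1::real) / 2 ^ k \<le> 1" by simp
  hence "x < 1" using assms(2) by (rule order.strict_trans2[rotated])
  hence "x \<in> unit_ivl" using assms(1) by simp
  then obtain i where "x \<in> cell q k i" by (rule cell_exists)
  thus ?thesis using that cell_first_block assms(2) by blast
qed

lemma block_visit_is_return:
  assumes "0 \<le> x" "x < 1 / 2 ^ k" "(F ^^ t) x < 1 / 2 ^ k"
  shows "\<exists>s. (F ^^ t) x = (rot_odo q (return_perm k) ^^ s) (2 ^ k * x) / 2 ^ k"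
  using assms
proof (induction t arbitrary: x rule: less_induct)
  case (less t)
  show ?case
  proof (cases "t = 0")
    case True thus ?thesis by (intro exI[of _ 0]) simp
  next
    case False
    obtain i where i: "i < q" "x \<in> cell q k i" using block_cell[OF less.prems(1,2)] .
    define r where "r = return_time k i"
    have r: "r \<ge> 1" unfolding r_def using return_time(1)[OF i(1)] .
    have rt: "r \<le> t"
    proof (rule ccontr)
      assume "\<not> r \<le> t"
      hence "1 / 2 ^ k \<le> (F ^^ t) x" using first_return(2)[OF i(2,1), of t] False by (simp add: r_def)
      thus False using less.prems(3) by simp
    qed
    define y where "y = (F ^^ r) x"
    have y: "2 ^ k * y = rot_odo q (return_perm k) (2 ^ k * x)"
      unfolding y_def r_def using first_return(1)[OF i(2,1)] by simp
    interpret R: rotated_odometer q "return_perm k"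
      using q_pos return_perm_permutes by unfold_locales
    have "2 ^ k * x \<in> unit_ivl" using less.prems by (auto simp: field_simps)
    hence "0 < 2 ^ k * y" "2 ^ k * y < 1" using R.F_range unfolding y by blast+
    hence yb: "0 \<le> y" "y < 1 / 2 ^ k" by (simp_all add: zero_less_mult_iff field_simps)
    have ty: "(F ^^ (t - r)) y = (F ^^ t) x"
      unfolding y_def using rt by (metis comp_apply funpow_add le_add_diff_inverse2)
    obtain s where "(F ^^ t) x = (rot_odo q (return_perm k) ^^ s) (2 ^ k * y) / 2 ^ k"
      using less.IH[of "t - r" y] yb r rt less.prems(3) ty by auto
    hence "(F ^^ t) x = (rot_odo q (return_perm k) ^^ Suc s) (2 ^ k * x) / 2 ^ k"
      unfolding y by (simp add: funpow_swap1)
    thus ?thesis by blast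
  qed
qed

text \<open>
  Iterates are right continuous at \<open>0\<close>, and cells contain their left end points: a short interval
  \<open>[0, e)\<close> is moved by translations and does not reach the right ends of the cells it visits.
\<close>

lemma common_itinerary:
  "\<exists>e>0. \<forall>s\<le>n. \<exists>j<q. \<forall>y\<in>{0..<e}. (F ^^ s) y \<in> cell q 0 j"
proof (induction n)
  case 0
  have "y \<in> cell q 0 0" if "y \<in> {0..<1 / real q}" for y
    using that q_pos by (auto simp: in_cell field_simps)
  hence "\<exists>j<q. \<forall>y\<in>{0..<1 / real q}. (F ^^ s) y \<in> cell q 0 j" if "s \<le> 0" for s
    using q_pos that by (intro exI[of _ 0]) auto
  moreover have "1 / real q > 0" using q_pos by simp
  ultimately show ?case by blast
next
  case (Suc n)
  then obtain e where e: "e > 0" "\<And>s. s \<le> n \<Longrightarrow> \<exists>j<q. \<forall>y\<in>{0..<e}. (F ^^ s) y \<in> cell q 0 j" by blast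
  have "(0::real) \<in> unit_ivl" by simp
  from right_translation_funpow[OF this, of "Suc n"] obtain e1 where e1: "e1 > 0"
    "\<And>y. y \<in> {0..<0+e1} \<Longrightarrow> (F ^^ Suc n) y = (F ^^ Suc n) 0 + (y - 0)" by blast
  have "(F ^^ Suc n) 0 \<in> unit_ivl" by (rule funpow_unit) simp
  then obtain j where "j < q * 2 ^ 0" and j: "(F ^^ Suc n) 0 \<in> cell q 0 j" by (rule cell_exists)
  hence jq: "j < q" by simp
  define e2 where "e2 = (real j + 1) / real q - (F ^^ Suc n) 0"
  have e2: "e2 > 0" using j by (simp add: e2_def cell_def)
  define e' where "e' = min e (min e1 e2)"
  have e': "e' \<le> e" "e' \<le> e1" "e' \<le> e2" "e' > 0" using e(1) e1(1) e2 by (auto simp: e'_def)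
  have "(F ^^ Suc n) y \<in> cell q 0 j" if "y \<in> {0..<e'}" for y
  proof -
    have "(F ^^ Suc n) y = (F ^^ Suc n) 0 + y" using e1(2)[of y] that e' by auto
    moreover have "y < e2" "0 \<le> y" using that e' by auto
    ultimately show ?thesis using j unfolding cell_def e2_def by auto
  qed
  moreover have "\<exists>j<q. \<forall>y\<in>{0..<e'}. (F ^^ s) y \<in> cell q 0 j" if "s \<le> n" for s
    using e(2)[OF that] e'(1) by (meson atLeastLessThan_iff less_le_trans)
  ultimately show ?case using e'(4) jq by (metis le_SucE)
qed

text \<open>
  How long it takes a whole neighbourhood \<open>[0, 2\<^sup>-\<^sup>k\<^sup>-\<^sup>N)\<close> of \<open>0\<close> to follow \<open>0\<close> into a base cell of
  level \<open>k\<close> depends only on the return map at level \<open>k\<close>; so \<open>N\<close> can be chosen once for all \<open>k\<close>.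
\<close>

lemma uniform_entrance:
  obtains N where "\<And>k i t. i < q \<Longrightarrow> (F ^^ t) 0 \<in> cell q k i \<Longrightarrow>
    \<exists>T. \<forall>x\<in>{0..<1 / 2 ^ (k + N)}. (F ^^ T) x \<in> cell q k i"
proof -
  \<comment> \<open>All points of \<open>[0, 2\<^sup>-\<^sup>N)\<close> follow \<open>0\<close> through the same cells for \<open>t\<close> steps and end in cell \<open>i\<close>.\<close>
  define good where "good \<sigma> i N t \<longleftrightarrow>
    (\<forall>s\<le>t. \<exists>j<q. \<forall>x\<in>{0..<1 / 2 ^ N}. (rot_odo q \<sigma> ^^ s) x \<in> cell q 0 j) \<and>
    (\<forall>x\<in>{0..<1 / 2 ^ N}. (rot_odo q \<sigma> ^^ t) x \<in> cell q 0 i)" for \<sigma> i t and N :: nat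
  have ex: "\<exists>N t. good \<sigma> i N t"
    if \<sigma>: "\<sigma> permutes {..<q}" and hit: "(rot_odo q \<sigma> ^^ t) 0 \<in> cell q 0 i" for \<sigma> i t
  proof -
    interpret R: rotated_odometer q \<sigma> using q_pos \<sigma> by unfold_locales
    obtain e where e: "e > 0" "\<And>s. s \<le> t \<Longrightarrow> \<exists>j<q. \<forall>y\<in>{0..<e}. (R.F ^^ s) y \<in> cell q 0 j"
      using R.common_itinerary by blast
    obtain N where N: "(1::real) / 2 ^ N \<le> e" using R.block_small e(1) by blast
    obtain j where j: "\<And>y. y \<in> {0..<e} \<Longrightarrow> (R.F ^^ t) y \<in> cell q 0 j" using e(2)[of t] by blast
    have "j = i" using j[of 0] hit e(1) R.cell_unique by simp
    moreover have sub: "x \<in> {0..<e}" if "x \<in> {0..<1 / 2 ^ N}" for x using that N by auto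
    ultimately have "good \<sigma> i N t" unfolding good_def using e(2) j by (meson sub)
    thus ?thesis by blast
  qed
  define A where "A = {\<sigma>. \<sigma> permutes {..<q}} \<times> {..<q}"
  define n where "n p = (SOME N. \<exists>t. good (fst p) (snd p) N t)" for p
  define N where "N = Max (n ` A)"
  have finA: "finite A" unfolding A_def by (intro finite_cartesian_product finite_permutations) auto
  have "\<exists>T. \<forall>x\<in>{0..<1 / 2 ^ (k + N)}. (F ^^ T) x \<in> cell q k i"
    if i: "i < q" and hit: "(F ^^ t) 0 \<in> cell q k i" for k i t
  proof -
    define \<sigma> where "\<sigma> = return_perm k"
    have \<sigma>: "\<sigma> permutes {..<q}" unfolding \<sigma>_def by (rule return_perm_permutes)
    have "(F ^^ t) 0 < 1 / 2 ^ k" using cell_first_block[OF hit] i by simp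
    then obtain s where "(F ^^ t) 0 = (rot_odo q \<sigma> ^^ s) 0 / 2 ^ k"
      using block_visit_is_return[of 0 k t] unfolding \<sigma>_def by auto
    hence "(rot_odo q \<sigma> ^^ s) 0 \<in> cell q 0 i" using hit by (simp add: in_cell)
    hence "\<exists>N t. good \<sigma> i N t" using ex[OF \<sigma>] by blast
    hence "\<exists>t. good \<sigma> i (n (\<sigma>, i)) t" unfolding n_def fst_conv snd_conv by (rule someI_ex)
    then obtain t where good: "good \<sigma> i (n (\<sigma>, i)) t" ..
    define M where "M = n (\<sigma>, i)"
    have MN: "M \<le> N" unfolding M_def N_def using finA \<sigma> i by (intro Max_ge) (auto simp: A_def)
    have "\<exists>T. \<forall>x\<in>{0..<1 / 2 ^ (k + M)}. (F ^^ T) x = (rot_odo q \<sigma> ^^ s) (2 ^ k * x) / 2 ^ k"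
      if "s \<le> t" for s
      using that
    proof (induction s)
      case 0 show ?case by (intro exI[of _ 0]) simp
    next
      case (Suc s)
      from Suc.IH[OF Suc_leD[OF Suc.prems]] obtain T where T: "\<And>x. x \<in> {0..<1 / 2 ^ (k + M)} \<Longrightarrow>
          (F ^^ T) x = (rot_odo q \<sigma> ^^ s) (2 ^ k * x) / 2 ^ k" by blast
      obtain j where j: "j < q" "\<And>x. x \<in> {0..<1 / 2 ^ M} \<Longrightarrow> (rot_odo q \<sigma> ^^ s) x \<in> cell q 0 j"
        using good Suc.prems unfolding good_def M_def by (meson Suc_leD)
      have "(F ^^ (return_time k j + T)) x = (rot_odo q \<sigma> ^^ Suc s) (2 ^ k * x) / 2 ^ k"
        if x: "x \<in> {0..<1 / 2 ^ (k + M)}" for x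
      proof -
        have "2 ^ k * x \<in> {0..<1 / 2 ^ M}" using x by (auto simp: power_add field_simps)
        hence "(rot_odo q \<sigma> ^^ s) (2 ^ k * x) \<in> cell q 0 j" by (rule j(2))
        hence "(F ^^ T) x \<in> cell q k j" unfolding T[OF x] by (simp add: in_cell)
        hence "(F ^^ return_time k j) ((F ^^ T) x) = rot_odo q \<sigma> (2 ^ k * (F ^^ T) x) / 2 ^ k"
          using first_return(1) j(1) unfolding \<sigma>_def by blast
        thus ?thesis by (simp add: funpow_add T[OF x])
      qed
      thus ?case by blast
    qed
    from this[OF order_refl] obtain T where T: "\<And>x. x \<in> {0..<1 / 2 ^ (k + M)} \<Longrightarrow>
        (F ^^ T) x = (rot_odo q \<sigma> ^^ t) (2 ^ k * x) / 2 ^ k" by blast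
    have "(F ^^ T) x \<in> cell q k i" if "x \<in> {0..<1 / 2 ^ (k + N)}" for x
    proof -
      have "(1::real) / 2 ^ (k + N) \<le> 1 / 2 ^ (k + M)"
        using MN by (intro divide_left_mono power_increasing) auto
      hence x: "x \<in> {0..<1 / 2 ^ (k + M)}" using that by auto
      hence "2 ^ k * x \<in> {0..<1 / 2 ^ M}" by (auto simp: power_add field_simps)
      hence "(rot_odo q \<sigma> ^^ t) (2 ^ k * x) \<in> cell q 0 i" using good unfolding good_def M_def by blast
      thus ?thesis unfolding T[OF x] by (simp add: in_cell)
    qed
    thus ?thesis by blast
  qed
  thus ?thesis using that by blast
qed

end

section \<open>Invariant measures on the aperiodic part\<close>

lemma borel_of_top_of_set:
  "sets (borel_of (top_of_set S)) = sets (restrict_space borel S)"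
  "space (borel_of (top_of_set S)) = S"
proof -
  have opens: "{U. openin (top_of_set S) U} = (\<inter>) S ` {U. open U}"
    by (auto simp: openin_open)
  have "sets (borel_of (top_of_set S)) = sigma_sets S ((\<inter>) S ` {U. open U})"
    unfolding borel_of_def topspace_euclidean_subtopology opens by (rule sets_measure_of) auto
  also have "(\<inter>) S ` {U. open U} = {(\<lambda>x. x) -` U \<inter> S |U. U \<in> {U. open U}}" by auto
  also have "sigma_sets S \<dots> = {(\<lambda>x. x) -` U \<inter> S |U. U \<in> sigma_sets UNIV {U. open U}}"
    by (rule sigma_sets_vimage_commute[symmetric]) simp
  also have "\<dots> = (\<inter>) S ` sigma_sets UNIV {U. open U}" by auto
  also have "\<dots> = sets (restrict_space borel S)"
    by (simp add: sets_restrict_space borel_def)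
  finally show "sets (borel_of (top_of_set S)) = sets (restrict_space borel S)" .
  show "space (borel_of (top_of_set S)) = S"
    unfolding borel_of_def by (simp add: space_measure_of_conv)
qed

context rotated_odometer
begin

abbreviation "np_measures \<equiv> invariant_measures (top_of_set (I_np q \<pi>)) F"

definition mass :: "real measure \<Rightarrow> real set \<Rightarrow> real" where
  "mass M A = measure M (A \<inter> I_np q \<pi>)"

lemma cell_borel [measurable]: "cell q k c \<in> sets borel" by (simp add: cell_def)

lemma np_measureD:
  assumes "M \<in> np_measures"
  shows "prob_space M" "space M = I_np q \<pi>" "sets M = sets (restrict_space borel (I_np q \<pi>))"
    "A \<in> sets borel \<Longrightarrow> A \<inter> I_np q \<pi> \<in> sets M"
proof -
  show "prob_space M" using invariant_measuresD(1)[OF assms] .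
  show s: "sets M = sets (restrict_space borel (I_np q \<pi>))"
    using invariant_measuresD(2)[OF assms] borel_of_top_of_set by simp
  show "space M = I_np q \<pi>" using sets_eq_imp_space_eq[OF s] by (simp add: space_restrict_space)
  show "A \<inter> I_np q \<pi> \<in> sets M" if "A \<in> sets borel"
    unfolding s sets_restrict_space using that by auto
qed

lemma mass_mono:
  assumes "M \<in> np_measures" "B \<in> sets borel" "A \<inter> I_np q \<pi> \<subseteq> B"
  shows "mass M A \<le> mass M B"
proof -
  interpret prob_space M using np_measureD(1)[OF assms(1)] .
  show ?thesis unfolding mass_def using np_measureD(4)[OF assms(1,2)] assms(3)
    by (intro finite_measure_mono) auto
qed

lemma mass_nonneg: "0 \<le> mass M A" by (simp add: mass_def)

lemma mass_compl:
  assumes "M \<in> np_measures" "A \<in> sets borel" shows "mass M (- A) = 1 - mass M A"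
proof -
  interpret prob_space M using np_measureD(1)[OF assms(1)] .
  have "- A \<inter> I_np q \<pi> = space M - (A \<inter> I_np q \<pi>)" using np_measureD(2)[OF assms(1)] by auto
  thus ?thesis unfolding mass_def using prob_compl np_measureD(4)[OF assms] by simp
qed

lemma mass_UN:
  assumes "M \<in> np_measures" "finite C" "\<And>c. c \<in> C \<Longrightarrow> A c \<in> sets borel"
  shows "mass M (\<Union>c\<in>C. A c) \<le> (\<Sum>c\<in>C. mass M (A c))"
proof -
  interpret prob_space M using np_measureD(1)[OF assms(1)] .
  have "(\<Union>c\<in>C. A c) \<inter> I_np q \<pi> = (\<Union>c\<in>C. A c \<inter> I_np q \<pi>)" by auto
  thus ?thesis unfolding mass_def
    using finite_measure_subadditive_finite[OF assms(2), of "\<lambda>c. A c \<inter> I_np q \<pi>"]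
      np_measureD(4)[OF assms(1)] assms(3) by (simp add: image_subset_iff)
qed

lemma mass_cells:
  assumes "M \<in> np_measures" "finite C"
  shows "mass M (\<Union>c\<in>C. cell q k c) = (\<Sum>c\<in>C. mass M (cell q k c))"
proof -
  interpret prob_space M using np_measureD(1)[OF assms(1)] .
  have "(\<Union>c\<in>C. cell q k c) \<inter> I_np q \<pi> = (\<Union>c\<in>C. cell q k c \<inter> I_np q \<pi>)" by auto
  moreover have "disjoint_family_on (\<lambda>c. cell q k c \<inter> I_np q \<pi>) C"
    using cell_unique unfolding disjoint_family_on_def by blast
  ultimately show ?thesis unfolding mass_def
    using finite_measure_finite_Union[OF assms(2), of "\<lambda>c. cell q k c \<inter> I_np q \<pi>"]
      np_measureD(4)[OF assms(1)] by (simp add: image_subset_iff)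
qed

lemma mass_preimage_funpow:
  assumes "M \<in> np_measures" "A \<in> sets borel"
  shows "measure M {x \<in> I_np q \<pi>. (F ^^ t) x \<in> A} = mass M A"
proof -
  have "(F ^^ t) -` (A \<inter> I_np q \<pi>) \<inter> space M = {x \<in> I_np q \<pi>. (F ^^ t) x \<in> A}"
    using np_measureD(2)[OF assms(1)] funpow_np by auto
  thus ?thesis using invariant_measure_funpow[OF assms(1) np_measureD(4)[OF assms], of t]
    by (simp add: mass_def)
qed

lemma mass_tower:
  assumes "M \<in> np_measures" "j < q" "c \<in> tower k j"
  shows "mass M (cell q k c) = mass M (cell q k j)"
proof -
  obtain t where t: "(P k ^^ t) j = c" "\<And>s. 0 < s \<Longrightarrow> s \<le> t \<Longrightarrow> q \<le> (P k ^^ s) j"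
    using assms(3) by (auto simp: tower_def)
  have "(F ^^ t) x \<in> cell q k c \<longleftrightarrow> x \<in> cell q k j" if "x \<in> I_np q \<pi>" for x
    using funpow_cell_iff[OF I_np_unit[OF that] base_less[OF assms(2)], where k = k and t = t] t by simp
  hence "{x \<in> I_np q \<pi>. (F ^^ t) x \<in> cell q k c} = cell q k j \<inter> I_np q \<pi>" by blast
  thus ?thesis using mass_preimage_funpow[OF assms(1) cell_borel, of t k c] by (simp add: mass_def)
qed

lemma mass_cyclic: "c \<in> cyclic_cells k \<Longrightarrow> mass M (cell q k c) = 0"
  using cyclic_cell_subset_I_per[of c k] by (auto simp: mass_def I_np_def intro!: arg_cong[of _ "{}" "measure M", simplified])

lemma mass_zero: assumes "M \<in> np_measures" shows "mass M {0} = 0"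
proof -
  have eq: "{x \<in> I_np q \<pi>. (F ^^ 1) x \<in> {0}} = {}" using F_range I_np_unit by fastforce
  show ?thesis using mass_preimage_funpow[OF assms, of "{0}" 1] unfolding eq by simp
qed

definition tower_set :: "nat \<Rightarrow> nat \<Rightarrow> real set" where
  "tower_set k j = (\<Union>c\<in>tower k j. cell q k c)"

lemma mass_tower_set:
  assumes "M \<in> np_measures" "j < q"
  shows "mass M (tower_set k j) = card (tower k j) * mass M (cell q k j)"
  unfolding tower_set_def using mass_cells[OF assms(1) finite_tower[OF assms(2)]] mass_tower[OF assms]
  by simp

lemma tower_sets_cover: "I_np q \<pi> \<subseteq> (\<Union>j<q. tower_set k j)"
proof
  fix x assume x: "x \<in> I_np q \<pi>"
  obtain c where c: "c < q * 2 ^ k" "x \<in> cell q k c" using cell_exists[OF I_np_unit[OF x]] .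
  have "c \<notin> cyclic_cells k" using cyclic_cell_subset_I_per[of c k] c x by (auto simp: I_np_def)
  hence "\<exists>j<q. c \<in> tower k j" using cell_dichotomy[OF c(1)] c(1) by (auto simp: cyclic_cells_def)
  thus "x \<in> (\<Union>j<q. tower_set k j)" using c by (auto simp: tower_set_def)
qed

lemma tower_sets_mass:
  assumes M: "M \<in> np_measures" shows "1 \<le> (\<Sum>j<q. mass M (tower_set k j))"
proof -
  have b: "tower_set k j \<in> sets borel" if "j < q" for j
    unfolding tower_set_def using finite_tower[OF that] by (intro sets.finite_UN) auto
  have "1 = mass M UNIV"
    using prob_space.prob_space[OF np_measureD(1)[OF M]] np_measureD(2)[OF M] by (simp add: mass_def)
  also have "\<dots> \<le> mass M (\<Union>j\<in>{..<q}. tower_set k j)"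
    using tower_sets_cover b by (intro mass_mono[OF M] sets.finite_UN) auto
  also have "\<dots> \<le> (\<Sum>j<q. mass M (tower_set k j))" using b by (intro mass_UN[OF M]) auto
  finally show ?thesis .
qed

lemma mass_cell_le_block:
  assumes M: "M \<in> np_measures" and c: "c < q * 2 ^ k"
  shows "mass M (cell q k c) \<le> mass M {0..<1 / 2 ^ k}"
proof (cases "\<exists>j<q. c \<in> tower k j")
  case True
  then obtain j where j: "j < q" "c \<in> tower k j" by blast
  have "cell q k j \<subseteq> {0..<1 / 2 ^ k}"
    using cell_first_block j(1) cell_subset_unit[OF base_less[OF j(1)]] by auto
  thus ?thesis unfolding mass_tower[OF M j] by (intro mass_mono[OF M]) auto
next
  case False
  hence "c \<in> cyclic_cells k" using cell_dichotomy[OF c] c by (auto simp: cyclic_cells_def)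
  thus ?thesis using mass_cyclic mass_nonneg by simp
qed

text \<open>
  The block \<open>[0, 2\<^sup>-\<^sup>k)\<close> consists of \<open>2 q\<close> cells of level \<open>k + 1\<close>, each of which is a null set or an
  image of a base cell of that level: so the masses of the blocks do not decay too fast.
\<close>

lemma mass_block_step:
  assumes M: "M \<in> np_measures"
  shows "mass M {0..<1 / 2 ^ k} \<le> (2 * real q) ^ N * mass M {0..<1 / 2 ^ (k + N)}"
proof (induction N)
  case (Suc N)
  define n where "n = k + N"
  have sub: "{0..<1 / 2 ^ n} \<subseteq> (\<Union>c\<in>{..<2 * q}. cell q (Suc n) c)"
  proof
    fix x :: real assume x: "x \<in> {0..<1 / 2 ^ n}"
    have "(1::real) / 2 ^ n \<le> 1" by simp
    moreover have "x < 1 / 2 ^ n" using x by simp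
    ultimately have "x < 1" by (rule order.strict_trans2[rotated])
    hence "x \<in> unit_ivl" using x by simp
    then obtain c where c: "x \<in> cell q (Suc n) c" by (rule cell_exists)
    have "c div 2 < q" using cell_first_block[OF cell_children[OF c]] x by simp
    thus "x \<in> (\<Union>c\<in>{..<2 * q}. cell q (Suc n) c)" using c by (intro UN_I[of c]) auto
  qed
  have "mass M {0..<1 / 2 ^ n} \<le> mass M (\<Union>c\<in>{..<2 * q}. cell q (Suc n) c)"
    using sub by (intro mass_mono[OF M] sets.finite_UN) auto
  also have "\<dots> = (\<Sum>c<2 * q. mass M (cell q (Suc n) c))" by (intro mass_cells[OF M]) auto
  also have "\<dots> \<le> (\<Sum>c<2 * q. mass M {0..<1 / 2 ^ Suc n})"
  proof (intro sum_mono mass_cell_le_block[OF M])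
    fix c assume "c \<in> {..<2 * q}"
    moreover have "2 * q \<le> q * 2 ^ Suc n" by simp
    ultimately show "c < q * 2 ^ Suc n" by (meson lessThan_iff less_le_trans)
  qed
  finally have step: "mass M {0..<1 / 2 ^ n} \<le> 2 * real q * mass M {0..<1 / 2 ^ Suc n}" by simp
  have "(2 * real q) ^ N * mass M {0..<1 / 2 ^ n} \<le> (2 * real q) ^ N * (2 * real q * mass M {0..<1 / 2 ^ Suc n})"
    by (intro mult_left_mono step) simp
  thus ?case using Suc.IH by (simp add: n_def mult_ac)
qed simp

subsection \<open>Overlap of measures sharing a tower\<close>

text \<open>
  The cells with index below \<open>q\<close>, which fill \<open>[0, 2\<^sup>-\<^sup>k)\<close>, are left out: the other cells are
  images of single cells.
\<close>

definition inner_cells :: "nat \<Rightarrow> real set \<Rightarrow> nat set" where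
  "inner_cells k U = {c. q \<le> c \<and> c < q * 2 ^ k \<and> cell q k c \<subseteq> U}"

lemma finite_inner_cells: "finite (inner_cells k U)"
  by (rule finite_subset[of _ "{..<q * 2 ^ k}"]) (auto simp: inner_cells_def)

lemma inner_cells_mono: "incseq (\<lambda>k. \<Union>c\<in>inner_cells k U. cell q k c)"
proof (rule incseq_SucI, rule subsetI)
  fix k x assume "x \<in> (\<Union>c\<in>inner_cells k U. cell q k c)"
  then obtain c where c: "q \<le> c" "c < q * 2 ^ k" "cell q k c \<subseteq> U" "x \<in> cell q k c"
    by (auto simp: inner_cells_def)
  obtain d where d: "d < q * 2 ^ Suc k" "x \<in> cell q (Suc k) d"
    using cell_exists[OF cell_subset_unit[OF c(2,4)]] .
  have dc: "d div 2 = c" using cell_unique[OF cell_children[OF d(2)] c(4)] .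
  hence "q \<le> d" using c(1) by linarith
  moreover have "cell q (Suc k) d \<subseteq> U" using cell_children[of _ k d] dc c(3) by blast
  ultimately show "x \<in> (\<Union>c\<in>inner_cells (Suc k) U. cell q (Suc k) c)"
    using d by (auto simp: inner_cells_def)
qed

lemma inner_cells_union:
  assumes "open U"
  shows "(\<Union>k. \<Union>c\<in>inner_cells k U. cell q k c) = U \<inter> {0<..<1}"
proof (intro equalityI subsetI)
  fix x assume "x \<in> (\<Union>k. \<Union>c\<in>inner_cells k U. cell q k c)"
  then obtain k c where c: "q \<le> c" "c < q * 2 ^ k" "cell q k c \<subseteq> U" "x \<in> cell q k c"
    by (auto simp: inner_cells_def)
  have "\<not> x < 1 / 2 ^ k" using cell_first_block[OF c(4)] c(1) by simp
  moreover have "(0::real) < 1 / 2 ^ k" by simp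
  ultimately have "0 < x" by linarith
  thus "x \<in> U \<inter> {0<..<1}" using cell_subset_unit[OF c(2,4)] c by auto
next
  fix x assume x: "x \<in> U \<inter> {0<..<1}"
  then obtain e where e: "e > 0" "ball x e \<subseteq> U" using assms open_contains_ball by blast
  obtain k where k: "(1::real) / 2 ^ k \<le> x" "(1::real) / 2 ^ k \<le> e"
    using block_small[of "min x e"] x e(1) by auto
  obtain c where c: "c < q * 2 ^ k" "x \<in> cell q k c" using cell_exists[of x] x by auto
  have "q \<le> c" using cell_first_block[OF c(2)] k by simp
  moreover have "y \<in> U" if y: "y \<in> cell q k c" for y
  proof -
    have "\<bar>y - x\<bar> < (real c + 1) / (real q * 2 ^ k) - real c / (real q * 2 ^ k)"
      using y c(2) by (auto simp: cell_def)
    also have "\<dots> = 1 / (real q * 2 ^ k)" by (simp add: add_divide_distrib)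
    also have "\<dots> \<le> 1 / 2 ^ k" using q_pos by (intro divide_left_mono) auto
    finally have "dist x y < e" using k by (simp add: dist_real_def)
    thus ?thesis using e(2) by auto
  qed
  ultimately show "x \<in> (\<Union>k. \<Union>c\<in>inner_cells k U. cell q k c)"
    using c by (auto simp: inner_cells_def)
qed

text \<open>
  Any invariant measure gives the same mass to all cells of a tower, so a union \<open>V\<close> of cells has
  the same share of the tower for both measures: this is the overlap for sets of the form \<open>V\<close>.
  A Borel set is approximated by an open one from outside, and that one by unions of cells from
  inside.
\<close>

lemma overlap_of_shared_towers:
  assumes M: "M \<in> np_measures" and N: "N \<in> np_measures"
    and shared: "\<And>K. \<exists>k\<ge>K. \<exists>j<q. \<delta> \<le> mass M (tower_set k j) \<and> \<delta> \<le> mass N (tower_set k j)"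
    and A: "A \<in> sets M"
  shows "\<delta> \<le> measure M A + measure N (space M - A)"
proof -
  interpret M: prob_space M using np_measureD(1)[OF M] .
  interpret N: prob_space N using np_measureD(1)[OF N] .
  have level: "\<delta> \<le> mass M (\<Union>c\<in>C. cell q k c) + mass N (- (\<Union>c\<in>C. cell q k c))"
    if j: "j < q" "\<delta> \<le> mass M (tower_set k j)" "\<delta> \<le> mass N (tower_set k j)" and fC: "finite C" for k j C
  proof -
    define T where "T = tower k j"
    have fT: "finite T" unfolding T_def using finite_tower[OF j(1)] .
    have "T \<noteq> {}" unfolding T_def using base_in_tower by blast
    hence n: "real (card T) > 0" using fT by (simp add: card_gt_0_iff)
    \<comment> \<open>The share of the tower that lies in \<open>C\<close>, for both measures.\<close>
    define a where "a = real (card (T \<inter> C)) / real (card T)"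
    have aT: "card (T \<inter> C) = a * card T" unfolding a_def using n by simp
    have "card (T \<inter> C) \<le> card T" using fT by (intro card_mono) auto
    hence a: "0 \<le> a" "a \<le> 1" unfolding a_def using n by auto
    have "card (T - C) = card T - card (T \<inter> C)" using fT by (simp add: card_Diff_subset_Int)
    hence bT: "real (card (T - C)) = (1 - a) * card T"
      using \<open>card (T \<inter> C) \<le> card T\<close> aT by (simp add: of_nat_diff algebra_simps)
    have "a * \<delta> \<le> a * mass M (tower_set k j)" using a j by (intro mult_left_mono) auto
    also have "\<dots> = (\<Sum>c\<in>T \<inter> C. mass M (cell q k c))"
      using mass_tower[OF M j(1)] aT by (simp add: mass_tower_set[OF M j(1)] T_def)
    also have "\<dots> = mass M (\<Union>c\<in>T \<inter> C. cell q k c)" using fT by (intro mass_cells[OF M, symmetric]) auto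
    also have "\<dots> \<le> mass M (\<Union>c\<in>C. cell q k c)" using fC by (intro mass_mono[OF M] sets.finite_UN) auto
    finally have 1: "a * \<delta> \<le> mass M (\<Union>c\<in>C. cell q k c)" .
    have "(1 - a) * \<delta> \<le> (1 - a) * mass N (tower_set k j)" using a j by (intro mult_left_mono) auto
    also have "\<dots> = (\<Sum>c\<in>T - C. mass N (cell q k c))"
      using mass_tower[OF N j(1)] bT by (simp add: mass_tower_set[OF N j(1)] T_def)
    also have "\<dots> = mass N (\<Union>c\<in>T - C. cell q k c)" using fT by (intro mass_cells[OF N, symmetric]) auto
    also have "\<dots> \<le> mass N (- (\<Union>c\<in>C. cell q k c))"
    proof (intro mass_mono[OF N])
      show "- (\<Union>c\<in>C. cell q k c) \<in> sets borel" using fC by (intro borel_comp sets.finite_UN) auto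
      show "(\<Union>c\<in>T - C. cell q k c) \<inter> I_np q \<pi> \<subseteq> - (\<Union>c\<in>C. cell q k c)"
        using cell_unique by blast
    qed
    finally show ?thesis using 1 by (simp add: algebra_simps)
  qed
  obtain B where B: "B \<in> sets borel" "A = B \<inter> I_np q \<pi>"
    using A np_measureD(3)[OF M] by (auto simp: sets_restrict_space)
  have MA: "measure M A = mass M B" by (simp add: mass_def B(2))
  have NA: "measure N (space M - A) = mass N (- B)"
  proof -
    have "space M - A = - B \<inter> I_np q \<pi>" using np_measureD(2)[OF M] B(2) by auto
    thus ?thesis by (simp add: mass_def)
  qed
  show ?thesis
  proof (rule field_le_epsilon)
    fix \<epsilon> :: real assume \<epsilon>: "0 < \<epsilon>"
    have idm: "(\<lambda>x. x) \<in> M \<rightarrow>\<^sub>M borel"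
    proof -
      have "(\<lambda>x. x) \<in> restrict_space borel (I_np q \<pi>) \<rightarrow>\<^sub>M borel" by (intro measurable_restrict_space1) auto
      thus ?thesis using np_measureD(3)[OF M] by (simp cong: measurable_cong_sets)
    qed
    define M' where "M' = distr M borel (\<lambda>x. x)"
    have em: "emeasure M' D = ennreal (mass M D)" if "D \<in> sets borel" for D
      unfolding M'_def using that idm np_measureD(2)[OF M]
      by (simp add: emeasure_distr M.emeasure_eq_measure mass_def)
    have "emeasure M' B = (INF U\<in>{U. B \<subseteq> U \<and> open U}. emeasure M' U)"
      using em[of UNIV] B(1) by (intro outer_regular) (auto simp: M'_def)
    moreover have "emeasure M' B < ennreal (mass M B + \<epsilon> / 2)"
      using em[OF B(1)] \<epsilon> mass_nonneg[of M B] by (simp add: ennreal_less_iff)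
    ultimately have "(INF U\<in>{U. B \<subseteq> U \<and> open U}. emeasure M' U) < ennreal (mass M B + \<epsilon> / 2)"
      by (rule ord_eq_less_trans[OF sym])
    then obtain U where U: "B \<subseteq> U" "open U" "emeasure M' U < ennreal (mass M B + \<epsilon> / 2)"
      by (auto simp: INF_less_iff)
    have MU: "mass M U \<le> mass M B + \<epsilon> / 2"
      using U(3) em[of U] U(2) mass_nonneg[of M U] by (simp add: ennreal_less_iff)
    define V where "V k = (\<Union>c\<in>inner_cells k U. cell q k c)" for k
    have Vb: "V k \<in> sets borel" for k unfolding V_def using finite_inner_cells by (intro sets.finite_UN) auto
    have Vinc: "incseq (\<lambda>k. V k \<inter> I_np q \<pi>)"
      using inner_cells_mono[of U] unfolding V_def incseq_def by blast
    have VU: "(\<Union>k. V k) = U \<inter> {0<..<1}" unfolding V_def using inner_cells_union[OF U(2)] .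
    have "(\<lambda>k. measure N (V k \<inter> I_np q \<pi>)) \<longlonglongrightarrow> measure N (\<Union>k. V k \<inter> I_np q \<pi>)"
      using N.finite_Lim_measure_incseq[OF _ Vinc] np_measureD(4)[OF N Vb] by auto
    hence lim: "(\<lambda>k. mass N (V k)) \<longlonglongrightarrow> mass N (U \<inter> {0<..<1})"
      unfolding mass_def VU[symmetric] by simp
    have "U \<inter> I_np q \<pi> \<subseteq> (\<Union>b\<in>{False, True}. if b then {0} else U \<inter> {0<..<1})"
    proof
      fix x assume "x \<in> U \<inter> I_np q \<pi>"
      thus "x \<in> (\<Union>b\<in>{False, True}. if b then {0} else U \<inter> {0<..<1})"
        using I_np_unit[of x] by auto
    qed
    hence "mass N U \<le> mass N (\<Union>b\<in>{False, True}. if b then {0} else U \<inter> {0<..<1})"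
      using U(2) by (intro mass_mono[OF N]) auto
    also have "\<dots> \<le> (\<Sum>b\<in>{False, True}. mass N (if b then {0} else U \<inter> {0<..<1}))"
      using U(2) by (intro mass_UN[OF N]) auto
    finally have NU: "mass N U \<le> mass N (U \<inter> {0<..<1})" using mass_zero[OF N] by simp
    have "mass N B \<le> mass N U" using U by (intro mass_mono[OF N]) auto
    hence "mass N B - \<epsilon> / 2 < mass N (U \<inter> {0<..<1})" using NU \<epsilon> by linarith
    hence "eventually (\<lambda>k. mass N B - \<epsilon> / 2 < mass N (V k)) sequentially"
      using lim order_tendstoD(1) by blast
    then obtain K where K: "\<And>k. k \<ge> K \<Longrightarrow> mass N B - \<epsilon> / 2 < mass N (V k)"
      by (auto simp: eventually_sequentially)
    obtain k j where kj: "k \<ge> K" "j < q" "\<delta> \<le> mass M (tower_set k j)" "\<delta> \<le> mass N (tower_set k j)"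
      using shared by blast
    have "\<delta> \<le> mass M (V k) + mass N (- V k)"
      unfolding V_def using level[OF kj(2-4) finite_inner_cells] .
    also have "mass M (V k) \<le> mass M U"
    proof (rule mass_mono[OF M])
      show "V k \<inter> I_np q \<pi> \<subseteq> U" using VU by blast
    qed (use U(2) in auto)
    also have "mass N (- V k) \<le> mass N (- B) + \<epsilon> / 2"
      using K[OF kj(1)] mass_compl[OF N Vb] mass_compl[OF N B(1)] by simp
    finally show "\<delta> \<le> measure M A + measure N (space M - A) + \<epsilon>" unfolding MA NA using MU by simp
  qed
qed

subsection \<open>At most \<open>q\<close> ergodic measures\<close>

text \<open>
  At each level every invariant measure gives mass at least \<open>1 / q\<close> to some tower.  Two mutually
  singular measures cannot both do so with the same tower at infinitely many levels, so at a high
  level the choice of a heavy tower is injective on \<open>X\<close>.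
\<close>

lemma card_ergodic_subset:
  assumes "finite X" "X \<subseteq> ergodic_measures (top_of_set (I_np q \<pi>)) F"
  shows "card X \<le> q"
proof -
  have np: "M \<in> np_measures" if "M \<in> X" for M using that assms(2) by (auto simp: ergodic_measures_def)
  define sep where "sep M N k \<longleftrightarrow> (\<forall>j<q. \<not> (1 / q \<le> mass M (tower_set k j) \<and> 1 / q \<le> mass N (tower_set k j)))"
    for M N k
  have "\<exists>K. \<forall>k\<ge>K. sep M N k" if "M \<in> X" "N \<in> X" "M \<noteq> N" for M N
  proof (rule ccontr)
    assume no: "\<not> ?thesis"
    have "M \<in> ergodic_measures (top_of_set (I_np q \<pi>)) F" "N \<in> ergodic_measures (top_of_set (I_np q \<pi>)) F"
      using that assms(2) by auto
    then obtain B where B: "B \<in> sets M" "measure N B = 0" "measure M (space M - B) = 0"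
      using ergodic_measures_singular \<open>M \<noteq> N\<close> by blast
    have sN: "sets N = sets M" "space N = space M"
      using invariant_measures_same_sets[OF np[OF that(1)] np[OF that(2)]] by blast+
    have "1 / q \<le> measure N B + measure M (space N - B)"
    proof (rule overlap_of_shared_towers[OF np np])
      show "\<exists>k\<ge>K. \<exists>j<q. 1 / q \<le> mass N (tower_set k j) \<and> 1 / q \<le> mass M (tower_set k j)" for K
        using no unfolding sep_def by blast
    qed (use that B sN in auto)
    thus False using B sN q_pos by simp
  qed
  then obtain K where K: "\<And>M N k. M \<in> X \<Longrightarrow> N \<in> X \<Longrightarrow> M \<noteq> N \<Longrightarrow> k \<ge> K M N \<Longrightarrow> sep M N k" by metis
  define k where "k = Max (insert 0 ((\<lambda>(M, N). K M N) ` (X \<times> X)))"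
  have k: "K M N \<le> k" if "M \<in> X" "N \<in> X" for M N
    unfolding k_def using that assms(1) by (intro Max_ge) auto
  have big: "\<exists>j<q. 1 / q \<le> mass M (tower_set k j)" if "M \<in> X" for M
  proof (rule ccontr)
    assume "\<not> ?thesis"
    hence "(\<Sum>j<q. mass M (tower_set k j)) < (\<Sum>j<q. 1 / real q)"
      using q_pos by (intro sum_strict_mono) (auto simp: not_le lessThan_empty_iff)
    thus False using tower_sets_mass[OF np[OF that], of k] q_pos by simp
  qed
  then obtain f where f: "\<And>M. M \<in> X \<Longrightarrow> f M < q \<and> 1 / q \<le> mass M (tower_set k (f M))" by metis
  have "inj_on f X"
  proof (rule inj_onI, rule ccontr)
    fix M N assume MN: "M \<in> X" "N \<in> X" "f M = f N" "M \<noteq> N"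
    have "sep M N k" using K[OF MN(1,2,4) k[OF MN(1,2)]] .
    moreover have "f M < q" "1 / q \<le> mass M (tower_set k (f M))" "1 / q \<le> mass N (tower_set k (f M))"
      using f[OF MN(1)] f[OF MN(2)] MN(3) by auto
    ultimately show False unfolding sep_def by blast
  qed
  moreover have "f ` X \<subseteq> {..<q}" using f by auto
  ultimately show ?thesis using card_inj_on_le[of f X "{..<q}"] by simp
qed

subsection \<open>Measures carried by the cells visited by the orbit of \<open>0\<close>\<close>

definition carried :: "real measure \<Rightarrow> bool" where
  "carried M \<longleftrightarrow> (\<forall>k i. i < q \<longrightarrow> (\<forall>t. (F ^^ t) 0 \<notin> cell q k i) \<longrightarrow> mass M (cell q k i) = 0)"

text \<open>
  A block \<open>[0, 2\<^sup>-\<^sup>k\<^sup>-\<^sup>N)\<close> near \<open>0\<close> is mapped into each base cell visited by the orbit of \<open>0\<close>, so all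
  these cells have a mass comparable to that of \<open>[0, 2\<^sup>-\<^sup>k)\<close>.  The highest tower over them therefore
  carries a fixed share of the whole mass, and its choice does not depend on the measure.
\<close>

lemma carried_common_tower:
  obtains \<delta> :: real where "\<delta> > 0"
    "\<And>k. \<exists>j<q. \<forall>M\<in>np_measures. carried M \<longrightarrow> \<delta> \<le> mass M (tower_set k j)"
proof -
  obtain N where N: "\<And>k i t. i < q \<Longrightarrow> (F ^^ t) 0 \<in> cell q k i \<Longrightarrow>
    \<exists>T. \<forall>x\<in>{0..<1 / 2 ^ (k + N)}. (F ^^ T) x \<in> cell q k i" using uniform_entrance by blast
  define C where "C = (2 * real q) ^ N"
  have C: "C > 0" using q_pos by (simp add: C_def)
  have visited: "mass M {0..<1 / 2 ^ k} \<le> C * mass M (cell q k i)"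
    if M: "M \<in> np_measures" and i: "i < q" "(F ^^ t) 0 \<in> cell q k i" for M k i t
  proof -
    obtain T where T: "\<And>x. x \<in> {0..<1 / 2 ^ (k + N)} \<Longrightarrow> (F ^^ T) x \<in> cell q k i"
      using N[OF i] by blast
    interpret prob_space M using np_measureD(1)[OF M] .
    have "mass M {0..<1 / 2 ^ (k + N)} \<le> measure M {x \<in> I_np q \<pi>. (F ^^ T) x \<in> cell q k i}"
      unfolding mass_def
    proof (rule finite_measure_mono)
      have "(F ^^ T) -` (cell q k i \<inter> I_np q \<pi>) \<inter> space M \<in> sets M"
        using invariant_measure_funpow[OF M np_measureD(4)[OF M cell_borel]] by blast
      also have "(F ^^ T) -` (cell q k i \<inter> I_np q \<pi>) \<inter> space M = {x \<in> I_np q \<pi>. (F ^^ T) x \<in> cell q k i}"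
        using np_measureD(2)[OF M] funpow_np by auto
      finally show "{x \<in> I_np q \<pi>. (F ^^ T) x \<in> cell q k i} \<in> sets M" .
    qed (use T in auto)
    also have "\<dots> = mass M (cell q k i)" by (rule mass_preimage_funpow[OF M cell_borel])
    finally have "C * mass M {0..<1 / 2 ^ (k + N)} \<le> C * mass M (cell q k i)"
      using C by (intro mult_left_mono) auto
    thus ?thesis using mass_block_step[OF M, of k N] unfolding C_def by linarith
  qed
  \<comment> \<open>At most \<open>q\<close> towers, none higher than the chosen one, and base masses equal up to the factor \<open>C\<close>.\<close>
  define \<delta> where "\<delta> = 1 / (real q * C)"
  have "\<exists>j<q. \<forall>M\<in>np_measures. carried M \<longrightarrow> \<delta> \<le> mass M (tower_set k j)" for k
  proof -
    define S where "S = {i. i < q \<and> (\<exists>t. (F ^^ t) 0 \<in> cell q k i)}"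
    have "0 \<in> cell q k 0" by (simp add: in_cell)
    hence "0 \<in> S" using q_pos by (auto simp: S_def intro!: exI[of _ 0])
    have fS: "finite S" by (rule finite_subset[of _ "{..<q}"]) (auto simp: S_def)
    define h where "h = Max ((\<lambda>i. card (tower k i)) ` S)"
    have "h \<in> (\<lambda>i. card (tower k i)) ` S" unfolding h_def using fS \<open>0 \<in> S\<close> by (intro Max_in) auto
    then obtain j where j: "j \<in> S" "card (tower k j) = h" by auto
    have hmax: "card (tower k i) \<le> h" if "i \<in> S" for i
      unfolding h_def using fS that by (intro Max_ge) auto
    have jq: "j < q" using j by (simp add: S_def)
    have "\<delta> \<le> mass M (tower_set k j)" if M: "M \<in> np_measures" and carr: "carried M" for M
    proof -
      define L where "L = mass M {0..<1 / 2 ^ k}"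
      have "1 \<le> (\<Sum>i<q. mass M (tower_set k i))" using tower_sets_mass[OF M] .
      also have "\<dots> \<le> (\<Sum>i<q. h * L)"
      proof (rule sum_mono)
        fix i assume i: "i \<in> {..<q}"
        show "mass M (tower_set k i) \<le> h * L"
        proof (cases "i \<in> S")
          case True
          have "mass M (cell q k i) \<le> L"
            unfolding L_def using i by (intro mass_cell_le_block[OF M] base_less) simp
          thus ?thesis using hmax[OF True] i mass_nonneg
            by (simp add: mass_tower_set[OF M]) (intro mult_mono, auto)
        next
          case False
          hence "mass M (cell q k i) = 0" using carr i by (auto simp: carried_def S_def)
          thus ?thesis using i mass_nonneg[of M] by (simp add: mass_tower_set[OF M] L_def)
        qed
      qed
      also have "\<dots> = q * (h * L)" by simp
      also have "\<dots> \<le> q * (h * (C * mass M (cell q k j)))"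
        using visited[OF M jq] j(1) unfolding L_def S_def by (intro mult_left_mono) auto
      also have "\<dots> = q * C * mass M (tower_set k j)"
        by (simp add: mass_tower_set[OF M jq] j(2))
      finally show ?thesis unfolding \<delta>_def using C q_pos by (simp add: field_simps)
    qed
    thus ?thesis using jq by blast
  qed
  moreover have "\<delta> > 0" using C q_pos by (simp add: \<delta>_def)
  ultimately show ?thesis using that by blast
qed

lemma carried_overlap:
  obtains \<delta> :: real where "\<delta> > 0"
    "\<And>M N A. M \<in> np_measures \<Longrightarrow> N \<in> np_measures \<Longrightarrow> carried M \<Longrightarrow> carried N \<Longrightarrow> A \<in> sets M \<Longrightarrow>
      \<delta> \<le> measure M A + measure N (space M - A)"
proof -
  obtain \<delta> :: real where \<delta>: "\<delta> > 0"
    "\<And>k. \<exists>j<q. \<forall>M\<in>np_measures. carried M \<longrightarrow> \<delta> \<le> mass M (tower_set k j)"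
    using carried_common_tower by blast
  have "\<delta> \<le> measure M A + measure N (space M - A)"
    if "M \<in> np_measures" "N \<in> np_measures" "carried M" "carried N" "A \<in> sets M" for M N A
    using that \<delta>(2) by (intro overlap_of_shared_towers) blast+
  thus ?thesis using that \<delta>(1) by blast
qed

end

section \<open>An invariant measure from the frequencies of visits\<close>

context rotated_odometer
begin

lemma F_borel:
  assumes A: "A \<in> sets borel" shows "{x \<in> unit_ivl. F x \<in> A} \<in> sets borel"
proof -
  define S where "S k c = cell q k c \<inter> (\<lambda>x. x + (real (P k c) - real c) / (real q * 2 ^ k)) -` A" for k c
  have S: "S k c \<in> sets borel" for k c
  proof -
    have "(\<lambda>x. x + (real (P k c) - real c) / (real q * 2 ^ k)) -` A \<inter> space borel \<in> sets borel"
      by (rule measurable_sets[OF _ A]) simp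
    thus ?thesis unfolding S_def by simp
  qed
  have "{x \<in> unit_ivl. F x \<in> A} = (\<Union>k. \<Union>c\<in>{c. c < q * 2 ^ k \<and> q \<le> P k c}. S k c)"
  proof (intro equalityI subsetI)
    fix x assume x: "x \<in> {x \<in> unit_ivl. F x \<in> A}"
    have xu: "x \<in> unit_ivl" using x by simp
    obtain k c where c: "c < q * 2 ^ k" "x \<in> cell q k c" "q \<le> P k c" using translation_cell[OF xu] .
    have "F x = x + (real (P k c) - real c) / (real q * 2 ^ k)" using F_translation[OF c(2,1,3)] .
    hence "x \<in> S k c" using x c(2) by (simp add: S_def)
    thus "x \<in> (\<Union>k. \<Union>c\<in>{c. c < q * 2 ^ k \<and> q \<le> P k c}. S k c)" using c by blast
  next
    fix x assume "x \<in> (\<Union>k. \<Union>c\<in>{c. c < q * 2 ^ k \<and> q \<le> P k c}. S k c)"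
    then obtain k c where c: "c < q * 2 ^ k" "q \<le> P k c" "x \<in> S k c" by blast
    hence xc: "x \<in> cell q k c" by (simp add: S_def)
    show "x \<in> {x \<in> unit_ivl. F x \<in> A}"
      using cell_subset_unit[OF c(1) xc] F_translation[OF xc c(1,2)] c(3) by (simp add: S_def)
  qed
  also have "\<dots> \<in> sets borel" using S by (intro sets.countable_UN' sets.countable_UN) auto
  finally show ?thesis .
qed

lemma I_per_borel: "I_per q \<pi> \<in> sets borel"
  unfolding I_per_eq by (intro sets.countable_UN' countableI_type) auto

lemma I_np_borel: "I_np q \<pi> \<in> sets borel"
  unfolding I_np_def using I_per_borel by (intro sets.Diff) auto

definition orbit :: "nat \<Rightarrow> real" where "orbit t = (F ^^ t) 0"

lemma orbit_np: "orbit t \<in> I_np q \<pi>" unfolding orbit_def by (rule funpow_np[OF zero_np])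

lemma orbit_unit: "orbit t \<in> unit_ivl" using orbit_np I_np_unit by blast

lemma orbit_add: "orbit (s + t) = (F ^^ t) (orbit s)"
  unfolding orbit_def by (metis add.commute comp_apply funpow_add)

lemma orbit_inj: "inj orbit"
proof (rule linorder_injI)
  fix s t :: nat assume st: "s < t"
  show "orbit s \<noteq> orbit t"
  proof
    assume "orbit s = orbit t"
    moreover have "t = (t - s) + s" using st by simp
    ultimately have "(F ^^ s) 0 = (F ^^ s) (orbit (t - s))" by (metis orbit_add orbit_def)
    hence "0 = orbit (t - s)" using inj_onD[OF funpow_inj[of s]] orbit_unit by simp
    thus False using zero_not_periodic[of "t - s"] st by (simp add: orbit_def)
  qed
qed

definition freq :: "nat \<Rightarrow> real set \<Rightarrow> real" where
  "freq n A = card {t. t \<le> n \<and> orbit t \<in> A} / (real n + 1)"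

lemma freq_diff_le:
  assumes "{t. t \<le> n \<and> orbit t \<in> A} \<subseteq> insert s {t. t \<le> n \<and> orbit t \<in> B}"
  shows "freq n A \<le> freq n B + 1 / (real n + 1)"
proof -
  have "card {t. t \<le> n \<and> orbit t \<in> A} \<le> card (insert s {t. t \<le> n \<and> orbit t \<in> B})"
    using assms by (intro card_mono) auto
  also have "\<dots> \<le> card {t. t \<le> n \<and> orbit t \<in> B} + 1" by (simp add: card_insert_if)
  finally have "real (card {t. t \<le> n \<and> orbit t \<in> A}) \<le> card {t. t \<le> n \<and> orbit t \<in> B} + 1" by linarith
  hence "freq n A \<le> (card {t. t \<le> n \<and> orbit t \<in> B} + 1) / (real n + 1)"
    unfolding freq_def by (intro divide_right_mono) auto
  thus ?thesis by (simp add: freq_def add_divide_distrib)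
qed

text \<open>
  An orbit that returns to a cell in a tower passes from the base to the base in between, and the
  return times to the base tend to infinity with the level.
\<close>

lemma freq_cell_bound:
  assumes R: "R \<ge> (1::nat)"
  obtains k where "\<And>n c. c < q * 2 ^ k \<Longrightarrow> freq n (cell q k c) \<le> 1 / R + 1 / (real n + 1)"
proof -
  have "\<exists>k. \<forall>y s. 0 \<le> y \<longrightarrow> y < 1 / 2 ^ k \<longrightarrow> 0 < s \<longrightarrow> s < R \<longrightarrow> 1 / 2 ^ k \<le> (F ^^ s) y"
  proof (rule return_time_unbounded[of R])
    fix k0 assume "\<And>k y s. k0 \<le> k \<Longrightarrow> 0 \<le> y \<Longrightarrow> y < 1 / 2 ^ k \<Longrightarrow> 0 < s \<Longrightarrow> s < R \<Longrightarrow> 1 / 2 ^ k \<le> (F ^^ s) y"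
    note this[OF order_refl]
    thus ?thesis by (intro exI[of _ k0] allI impI)
  qed
  then obtain k where k: "\<And>y s. 0 \<le> y \<Longrightarrow> y < 1 / 2 ^ k \<Longrightarrow> 0 < s \<Longrightarrow> s < R \<Longrightarrow> 1 / 2 ^ k \<le> (F ^^ s) y"
    by blast
  have "freq n (cell q k c) \<le> 1 / R + 1 / (real n + 1)" if c: "c < q * 2 ^ k" for n c
  proof -
    define A where "A = {t. t \<le> n \<and> orbit t \<in> cell q k c}"
    have gap: "s + R \<le> t" if st: "s \<in> A" "t \<in> A" "s < t" for s t
    proof (rule ccontr)
      assume no: "\<not> s + R \<le> t"
      have "c \<notin> cyclic_cells k"
        using cyclic_cell_subset_I_per[of c k] orbit_np[of s] st(1) by (auto simp: A_def I_np_def)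
      then obtain j where j: "j < q" "c \<in> tower k j"
        using cell_dichotomy[OF c] c by (auto simp: cyclic_cells_def)
      then obtain m where m: "(P k ^^ m) j = c" "\<And>i. 0 < i \<Longrightarrow> i \<le> m \<Longrightarrow> q \<le> (P k ^^ i) j"
        by (auto simp: tower_def)
      \<comment> \<open>The point of the base from which the tower carries \<open>y\<close> to the visit at time \<open>s\<close>.\<close>
      define y where "y = orbit s + (real j - real c) / (real q * 2 ^ k)"
      have y: "y \<in> cell q k j" unfolding y_def using st(1) by (intro cell_shift) (simp add: A_def)
      have yu: "y \<in> unit_ivl" using cell_subset_unit[OF base_less[OF j(1)] y] .
      have "(F ^^ m) y = orbit s"
        using funpow_translation[OF y base_less[OF j(1)], of m] m unfolding y_def
        by (simp add: diff_divide_distrib)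
      hence "(F ^^ (t - s)) ((F ^^ m) y) = orbit t" using orbit_add[of s "t - s"] st(3) by simp
      hence "(F ^^ m) ((F ^^ (t - s)) y) = orbit t" by (metis add.commute comp_apply funpow_add)
      hence "(F ^^ m) ((F ^^ (t - s)) y) \<in> cell q k ((P k ^^ m) j)" using st(2) m(1) by (simp add: A_def)
      hence "(F ^^ (t - s)) y \<in> cell q k j"
        using funpow_cell_iff[OF funpow_unit[OF yu] base_less[OF j(1)], of m] m(2) by blast
      hence "(F ^^ (t - s)) y < 1 / 2 ^ k" using cell_first_block j(1) by blast
      moreover have "1 / 2 ^ k \<le> (F ^^ (t - s)) y"
        using k[of y "t - s"] yu cell_first_block[OF y] j(1) st(3) no by auto
      ultimately show False by simp
    qed
    have "inj_on (\<lambda>t. t div R) A"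
    proof (rule linorder_inj_onI)
      fix s t assume "s < t" "s \<in> A" "t \<in> A"
      hence "(s + R) div R \<le> t div R" using gap by (intro div_le_mono) auto
      thus "s div R \<noteq> t div R" using R by simp
    qed auto
    moreover have "(\<lambda>t. t div R) ` A \<subseteq> {..n div R}" by (auto simp: A_def intro: div_le_mono)
    ultimately have "card A \<le> card {..n div R}" by (intro card_inj_on_le) auto
    hence "real (card A) \<le> real (n div R) + 1" by simp
    also have "real (n div R) \<le> real n / real R" by (rule of_nat_div_le_of_nat)
    finally have cA: "real (card A) \<le> real n / real R + 1" by simp
    have "freq n (cell q k c) \<le> (real n / real R + 1) / (real n + 1)"
      unfolding freq_def A_def[symmetric] using cA by (intro divide_right_mono) auto
    also have "\<dots> = (real n / (real n + 1)) * (1 / real R) + 1 / (real n + 1)"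
      by (simp add: add_divide_distrib)
    also have "\<dots> \<le> 1 * (1 / real R) + 1 / (real n + 1)"
      by (intro add_right_mono mult_right_mono) auto
    finally show ?thesis by simp
  qed
  thus ?thesis using that by blast
qed

lemma small_ball_cells:
  fixes x :: real and k :: nat
  defines "w \<equiv> 1 / (real q * 2 ^ k)"
  obtains C where "finite C" "card C \<le> 3" "C \<subseteq> {..<q * 2 ^ k}"
    "\<And>y. y \<in> unit_ivl \<Longrightarrow> \<bar>y - x\<bar> < w \<Longrightarrow> y \<in> (\<Union>c\<in>C. cell q k c)"
proof -
  \<comment> \<open>Only the cell of \<open>x\<close> and its two neighbours come that close to \<open>x\<close>.\<close>
  define f where "f = \<lfloor>real q * 2 ^ k * x\<rfloor>"
  define C where "C = {c. c < q * 2 ^ k \<and> int c \<in> {f - 1, f, f + 1}}"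
  have sub: "C \<subseteq> nat ` {f - 1, f, f + 1}" unfolding C_def by force
  have "card C \<le> card (nat ` {f - 1, f, f + 1})" using sub by (intro card_mono) auto
  also have "\<dots> \<le> card {f - 1, f, f + 1}" by (intro card_image_le) auto
  also have "\<dots> \<le> 3" by (simp add: card_insert_if)
  finally have "card C \<le> 3" .
  moreover have "finite C" using sub finite_subset by blast
  moreover have "y \<in> (\<Union>c\<in>C. cell q k c)" if y: "y \<in> unit_ivl" "\<bar>y - x\<bar> < w" for y
  proof -
    obtain c where c: "c < q * 2 ^ k" "y \<in> cell q k c" using cell_exists[OF y(1)] .
    define Q where "Q = real q * 2 ^ k"
    have Q: "Q > 0" using q_pos by (simp add: Q_def)
    have "Q * \<bar>y - x\<bar> < 1" using y(2) Q by (simp add: w_def Q_def[symmetric] field_simps)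
    hence "\<bar>Q * y - Q * x\<bar> < 1" using Q by (simp add: abs_mult flip: right_diff_distrib)
    moreover have "real c \<le> Q * y" "Q * y < real c + 1" using c(2) by (auto simp: in_cell Q_def)
    moreover have "of_int f \<le> Q * x" "Q * x < of_int f + 1" unfolding f_def Q_def by linarith+
    ultimately have "real_of_int (int c) < of_int (f + 2)" "real_of_int (f - 2) < of_int (int c)" by simp_all
    hence "int c < f + 2" "f - 2 < int c" by (simp_all only: of_int_less_iff)
    hence "c \<in> C" using c(1) by (auto simp: C_def)
    thus ?thesis using c(2) by blast
  qed
  moreover have "C \<subseteq> {..<q * 2 ^ k}" by (auto simp: C_def)
  ultimately show ?thesis using that by blast
qed

lemma freq_UN_le: "finite C \<Longrightarrow> freq n (\<Union>c\<in>C. A c) \<le> (\<Sum>c\<in>C. freq n (A c))"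
proof -
  assume C: "finite C"
  have "{t. t \<le> n \<and> orbit t \<in> (\<Union>c\<in>C. A c)} = (\<Union>c\<in>C. {t. t \<le> n \<and> orbit t \<in> A c})" by auto
  hence "card {t. t \<le> n \<and> orbit t \<in> (\<Union>c\<in>C. A c)} \<le> (\<Sum>c\<in>C. card {t. t \<le> n \<and> orbit t \<in> A c})"
    using card_UN_le[OF C] by simp
  hence "real (card {t. t \<le> n \<and> orbit t \<in> (\<Union>c\<in>C. A c)}) \<le> (\<Sum>c\<in>C. real (card {t. t \<le> n \<and> orbit t \<in> A c}))"
    by (simp only: of_nat_sum[symmetric] of_nat_le_iff)
  thus ?thesis unfolding freq_def sum_divide_distrib[symmetric] by (intro divide_right_mono) auto
qed

lemma freq_mono: "(\<And>t. orbit t \<in> A \<Longrightarrow> orbit t \<in> B) \<Longrightarrow> freq n A \<le> freq n B"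
  unfolding freq_def by (intro divide_right_mono of_nat_mono card_mono) auto

text \<open>
  A weak limit of the uniform distributions on initial pieces of the orbit of \<open>0\<close>.  It has no
  atoms, by the bound on the frequencies, so the frequencies of intervals converge.
\<close>

lemma limit_of_frequencies:
  obtains M :: "real measure" and r :: "nat \<Rightarrow> nat" where
    "prob_space M" "sets M = sets borel" "strict_mono r"
    "\<And>x. measure M {x} = 0"
    "\<And>a b. a \<le> b \<Longrightarrow> (\<lambda>n. freq (r n) {a..<b}) \<longlonglongrightarrow> measure M {a..<b}"
proof -
  define \<mu> where "\<mu> n = distr (measure_pmf (pmf_of_set {..n})) borel orbit" for n :: nat
  have meas: "measure (\<mu> n) A = freq n A" if "A \<in> sets borel" for n A
  proof -
    have "measure (\<mu> n) A = measure (measure_pmf (pmf_of_set {..n})) (orbit -` A)"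
      unfolding \<mu>_def using that by (simp add: measure_distr)
    also have "\<dots> = card ({..n} \<inter> orbit -` A) / card {..n}" by (rule measure_pmf_of_set) auto
    also have "{..n} \<inter> orbit -` A = {t. t \<le> n \<and> orbit t \<in> A}" by auto
    finally show ?thesis by (simp add: freq_def add.commute)
  qed
  have rd: "real_distribution (\<mu> n)" for n
    unfolding \<mu>_def by (intro prob_space.real_distribution_distr prob_space_measure_pmf) simp
  have full: "freq n A = 1" if "\<And>t. orbit t \<in> A" for n A
    unfolding freq_def using that by (simp add: add.commute)
  have "tight \<mu>" unfolding tight_def
  proof (intro conjI allI impI rd)
    fix \<epsilon> :: real assume "\<epsilon> > 0"
    have "orbit t \<in> {-1<..1}" for t using orbit_unit[of t] by auto
    thus "\<exists>a b. a < b \<and> (\<forall>n. 1 - \<epsilon> < measure (\<mu> n) {a<..b})"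
      using \<open>\<epsilon> > 0\<close> by (intro exI[of _ "-1"] exI[of _ 1]) (simp add: meas full)
  qed
  then obtain r M where r: "strict_mono r" and M: "real_distribution M" "weak_conv_m (\<mu> \<circ> id \<circ> r) M"
    using tight_imp_convergent_subsubsequence[of \<mu> id] by (auto simp: strict_mono_def)
  interpret M: real_distribution M by fact
  have cdf_diff: "measure M {a<..b} = cdf M b - cdf M a" if "a \<le> b" for a b
    using M.cdf_diff_eq[of a b] that by (cases "a = b") auto
  have conv: "(\<lambda>n. freq (r n) {a<..b}) \<longlonglongrightarrow> measure M {a<..b}"
    if "a \<le> b" "measure M {a} = 0" "measure M {b} = 0" for a b
  proof -
    have lim: "(\<lambda>n. cdf (\<mu> (r n)) x) \<longlonglongrightarrow> cdf M x" if "measure M {x} = 0" for x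
      using M(2) M.isCont_cdf[of x] that by (simp add: weak_conv_m_def weak_conv_def)
    have "cdf (\<mu> (r n)) b - cdf (\<mu> (r n)) a = freq (r n) {a<..b}" for n
    proof -
      interpret D: real_distribution "\<mu> (r n)" by (rule rd)
      have "cdf (\<mu> (r n)) b - cdf (\<mu> (r n)) a = measure (\<mu> (r n)) {a<..b}"
        using D.cdf_diff_eq[of a b] \<open>a \<le> b\<close> by (cases "a = b") auto
      thus ?thesis by (simp add: meas)
    qed
    thus ?thesis using tendsto_diff[OF lim[OF that(3)] lim[OF that(2)]] cdf_diff[OF that(1)] by simp
  qed
  have rn: "1 / (real (r n) + 1) \<le> 1 / (real n + 1)" for n
    using seq_suble[OF r, of n] by (intro divide_left_mono) auto
  have atom: "measure M {x} = 0" for x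
  proof -
    have bound: "measure M {x} \<le> 3 * (1 / real R)" if R: "R \<ge> 1" for R :: nat
    proof -
      obtain k where k: "\<And>n c. c < q * 2 ^ k \<Longrightarrow> freq n (cell q k c) \<le> 1 / R + 1 / (real n + 1)"
        using freq_cell_bound[OF R] by blast
      define w where "w = 1 / (real q * 2 ^ k)"
      have w: "w > 0" using q_pos by (simp add: w_def)
      obtain C where C: "finite C" "card C \<le> 3" "C \<subseteq> {..<q * 2 ^ k}"
        "\<And>y. y \<in> unit_ivl \<Longrightarrow> \<bar>y - x\<bar> < w \<Longrightarrow> y \<in> (\<Union>c\<in>C. cell q k c)"
        unfolding w_def using small_ball_cells[of k x] by blast
      have ne: "\<exists>y\<in>{a<..<b}. measure M {y} = 0" if "a < b" for a b :: real
      proof (rule ccontr)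
        assume "\<not> ?thesis"
        hence "{a<..<b} \<subseteq> {y. measure M {y} > 0}" by (auto simp: less_le)
        hence "countable {a<..<b}" using M.countable_atoms countable_subset by blast
        thus False using uncountable_open_interval[of a b] that by simp
      qed
      obtain a where a: "a \<in> {x - w<..<x}" "measure M {a} = 0" using ne[of "x - w" x] w by auto
      obtain b where b: "b \<in> {x<..<x + w}" "measure M {b} = 0" using ne[of x "x + w"] w by auto
      have "freq (r n) {a<..b} \<le> 3 * (1 / real R + 1 / (real n + 1))" for n
      proof -
        have "freq (r n) {a<..b} \<le> freq (r n) (\<Union>c\<in>C. cell q k c)"
        proof (rule freq_mono)
          fix t assume "orbit t \<in> {a<..b}"
          hence "\<bar>orbit t - x\<bar> < w" using a(1) b(1) by auto
          thus "orbit t \<in> (\<Union>c\<in>C. cell q k c)" by (intro C(4) orbit_unit)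
        qed
        also have "\<dots> \<le> (\<Sum>c\<in>C. freq (r n) (cell q k c))" by (rule freq_UN_le[OF C(1)])
        also have "\<dots> \<le> (\<Sum>c\<in>C. 1 / real R + 1 / (real n + 1))"
        proof (rule sum_mono)
          fix c assume "c \<in> C"
          hence "freq (r n) (cell q k c) \<le> 1 / real R + 1 / (real (r n) + 1)" using C(3) k by blast
          thus "freq (r n) (cell q k c) \<le> 1 / real R + 1 / (real n + 1)" using rn[of n] by linarith
        qed
        also have "\<dots> = card C * (1 / real R + 1 / (real n + 1))" by simp
        also have "\<dots> \<le> 3 * (1 / real R + 1 / (real n + 1))"
          using C(2) by (intro mult_right_mono) auto
        finally show ?thesis .
      qed
      moreover have "(\<lambda>n. freq (r n) {a<..b}) \<longlonglongrightarrow> measure M {a<..b}" using a b by (intro conv) auto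
      moreover have "(\<lambda>n. 3 * (1 / real R + 1 / (real n + 1))) \<longlonglongrightarrow> 3 * (1 / real R + 0)"
        by (intro tendsto_intros LIMSEQ_inverse_real_of_nat[unfolded inverse_eq_divide of_nat_Suc add.commute[of 1]])
      ultimately have "measure M {a<..b} \<le> 3 * (1 / real R + 0)"
        by (intro LIMSEQ_le) auto
      moreover have "measure M {x} \<le> measure M {a<..b}" using a b by (intro M.finite_measure_mono) auto
      ultimately show ?thesis by simp
    qed
    show ?thesis
    proof (rule ccontr)
      assume "measure M {x} \<noteq> 0"
      hence pos: "measure M {x} / 3 > 0" by (simp add: zero_less_measure_iff)
      then obtain n where "1 / real (Suc n) < measure M {x} / 3" using nat_approx_posE by blast
      thus False using bound[of "Suc n"] by simp
    qed
  qed
  have "(\<lambda>n. freq (r n) {a..<b}) \<longlonglongrightarrow> measure M {a..<b}" if ab: "a \<le> b" for a b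
  proof -
    have "measure M {a..<b} = measure M {a<..b}"
    proof (cases "a = b")
      case False
      hence "{a..<b} = insert a {a<..<b}" "{a<..b} = insert b {a<..<b}" using ab by auto
      thus ?thesis using M.finite_measure_Union[of "{a}" "{a<..<b}"] M.finite_measure_Union[of "{b}" "{a<..<b}"]
        atom by auto
    qed simp
    moreover have dlim: "(\<lambda>n. freq (r n) {a..<b} - freq (r n) {a<..b}) \<longlonglongrightarrow> 0"
    proof (rule Lim_null_comparison)
      show "(\<lambda>n. 1 / (real n + 1)) \<longlonglongrightarrow> 0"
        by (rule LIMSEQ_inverse_real_of_nat[unfolded inverse_eq_divide of_nat_Suc add.commute[of 1]])
      have one: "\<exists>s. {t. orbit t = x} \<subseteq> {s}" for x using orbit_inj by (auto simp: inj_def)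
      have "norm (freq (r n) {a..<b} - freq (r n) {a<..b}) \<le> 1 / (real n + 1)" for n
      proof -
        obtain s where "{t. orbit t = a} \<subseteq> {s}" using one by blast
        hence "freq (r n) {a..<b} \<le> freq (r n) {a<..b} + 1 / (real (r n) + 1)"
          by (intro freq_diff_le[of _ _ s]) force
        moreover obtain s' where "{t. orbit t = b} \<subseteq> {s'}" using one by blast
        hence "freq (r n) {a<..b} \<le> freq (r n) {a..<b} + 1 / (real (r n) + 1)"
          by (intro freq_diff_le[of _ _ s']) force
        ultimately show ?thesis using rn[of n] by simp
      qed
      thus "eventually (\<lambda>n. norm (freq (r n) {a..<b} - freq (r n) {a<..b}) \<le> 1 / (real n + 1)) sequentially"
        by simp
    qed
    ultimately show ?thesis using tendsto_add[OF dlim conv[OF ab atom atom]] by simp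
  qed
  thus ?thesis using that[OF M.prob_space_axioms _ r atom] by simp
qed

text \<open>
  A cell outside the first block and its preimage, which is a cell as well, are visited equally
  often up to one visit.  So the limit measure is invariant on such cells, hence on open sets.  It
  gives no mass to unvisited cells, among them the periodic ones.
\<close>

lemma carried_measure_exists:
  "\<exists>N\<in>np_measures. \<forall>k c. (\<forall>t. (F ^^ t) 0 \<notin> cell q k c) \<longrightarrow> mass N (cell q k c) = 0"
proof -
  obtain M :: "real measure" and r :: "nat \<Rightarrow> nat" where M: "prob_space M" "sets M = sets borel"
    and r: "strict_mono r" and atom: "\<And>x. measure M {x} = 0"
    and conv: "\<And>a b. a \<le> b \<Longrightarrow> (\<lambda>n. freq (r n) {a..<b}) \<longlonglongrightarrow> measure M {a..<b}"
    using limit_of_frequencies by blast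
  interpret M: prob_space M by fact
  have spM: "space M = UNIV" using sets_eq_imp_space_eq[OF M(2)] by simp
  have conv_cell: "(\<lambda>n. freq (r n) (cell q k c)) \<longlonglongrightarrow> measure M (cell q k c)" for k c
    unfolding cell_def using q_pos by (intro conv divide_right_mono) auto
  have unvisited: "measure M (cell q k c) = 0" if "\<And>t. orbit t \<notin> cell q k c" for k c
  proof -
    have "freq n (cell q k c) = 0" for n using that by (simp add: freq_def)
    thus ?thesis using conv_cell[of k c] LIMSEQ_unique[OF _ tendsto_const] by simp
  qed
  have unit1: "measure M {0..<1} = 1"
  proof -
    have "freq n {0..<1} = 1" for n using orbit_unit by (simp add: freq_def add.commute)
    thus ?thesis using conv[of 0 1] LIMSEQ_unique[OF _ tendsto_const] by simp
  qed
  have per0: "measure M (I_per q \<pi>) = 0"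
  proof -
    have "emeasure M (cell q k c) = 0" if c: "c \<in> cyclic_cells k" for k c
    proof -
      have "orbit t \<notin> cell q k c" for t
        using cyclic_cell_subset_I_per[OF c] orbit_np[of t] by (auto simp: I_np_def)
      thus ?thesis using unvisited by (simp add: M.emeasure_eq_measure)
    qed
    hence "(\<Union>c\<in>cyclic_cells k. cell q k c) \<in> null_sets M" for k
      using M(2) by (intro null_sets_UN') (auto simp: null_sets_def)
    hence "I_per q \<pi> \<in> null_sets M" unfolding I_per_eq by (intro null_sets_UN) auto
    thus ?thesis by (simp add: null_sets_def M.emeasure_eq_measure)
  qed
  have np1: "measure M (I_np q \<pi>) = 1"
  proof -
    have "I_per q \<pi> \<subseteq> unit_ivl" by (auto simp: I_per_def)
    thus ?thesis unfolding I_np_def using M.finite_measure_Diff[of "{0..<1}" "I_per q \<pi>"]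
      I_per_borel M(2) per0 unit1 by simp
  qed
  have shift: "measure M (cell q k c) = measure M (cell q k (P k c))"
    if c: "c < q * 2 ^ k" "q \<le> P k c" for k c
  proof -
    have step: "orbit t \<in> cell q k c \<longleftrightarrow> orbit (Suc t) \<in> cell q k (P k c)" for t
      using F_cell_iff[OF orbit_unit[of t] c] by (simp add: orbit_def)
    have "norm (freq n (cell q k c) - freq n (cell q k (P k c))) \<le> 1 / (real n + 1)" for n
    proof -
      define A where "A = {t. t \<le> n \<and> orbit t \<in> cell q k c}"
      define B where "B = {t. t \<le> n \<and> orbit t \<in> cell q k (P k c)}"
      have "Suc ` A \<subseteq> insert (Suc n) B" using step by (auto simp: A_def B_def)
      hence "card (Suc ` A) \<le> card (insert (Suc n) B)" by (intro card_mono) (auto simp: B_def)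
      moreover have "card (Suc ` A) = card A" by (rule card_image) simp
      ultimately have AB: "card A \<le> card B + 1" by (simp add: card_insert_if B_def split: if_splits)
      have "B \<subseteq> insert 0 (Suc ` A)"
      proof
        fix t assume "t \<in> B"
        thus "t \<in> insert 0 (Suc ` A)" using step by (cases t) (auto simp: A_def B_def)
      qed
      hence "card B \<le> card (insert 0 (Suc ` A))" by (intro card_mono) (auto simp: A_def)
      hence BA: "card B \<le> card A + 1" using \<open>card (Suc ` A) = card A\<close>
        by (simp add: card_insert_if A_def split: if_splits)
      have "\<bar>real (card A) - real (card B)\<bar> \<le> 1" using AB BA by linarith
      hence "\<bar>(real (card A) - real (card B)) / (real n + 1)\<bar> \<le> 1 / (real n + 1)"
        by (simp add: divide_right_mono)
      thus ?thesis by (simp add: freq_def A_def B_def diff_divide_distrib)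
    qed
    hence bnd: "\<forall>n. norm (freq (r n) (cell q k c) - freq (r n) (cell q k (P k c))) \<le> 1 / (real (r n) + 1)"
      by blast
    have lim0: "(\<lambda>n. 1 / (real (r n) + 1)) \<longlonglongrightarrow> 0"
      using LIMSEQ_subseq_LIMSEQ[OF LIMSEQ_inverse_real_of_nat r]
      by (simp add: comp_def inverse_eq_divide add.commute)
    have lim: "(\<lambda>n. freq (r n) (cell q k c) - freq (r n) (cell q k (P k c))) \<longlonglongrightarrow> 0"
      by (rule Lim_null_comparison[OF always_eventually[OF bnd] lim0])
    have "measure M (cell q k c) - measure M (cell q k (P k c)) = 0"
      using tendsto_diff[OF conv_cell conv_cell] lim by (rule LIMSEQ_unique)
    thus ?thesis by simp
  qed
  define U where "U = restrict_space M unit_ivl"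
  define M1 where "M1 = distr U borel F"
  define M2 where "M2 = distr U borel (\<lambda>x. x)"
  have F_meas: "F \<in> U \<rightarrow>\<^sub>M borel"
  proof (rule measurableI)
    fix A :: "real set" assume "A \<in> sets borel"
    hence "{x \<in> unit_ivl. F x \<in> A} \<in> sets M" using F_borel M(2) by simp
    moreover have "F -` A \<inter> space U = unit_ivl \<inter> {x \<in> unit_ivl. F x \<in> A}"
      by (auto simp: U_def space_restrict_space spM)
    ultimately show "F -` A \<inter> space U \<in> sets U" unfolding U_def sets_restrict_space by blast
  qed simp
  have id_meas: "(\<lambda>x. x) \<in> U \<rightarrow>\<^sub>M borel"
    unfolding U_def using M(2) by (intro measurable_restrict_space1) (simp cong: measurable_cong_sets)
  have emU: "emeasure U A = emeasure M A" if "A \<subseteq> unit_ivl" for A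
    unfolding U_def using that M(2) spM by (intro emeasure_restrict_space) auto
  have em1: "emeasure M1 A = emeasure M {x \<in> unit_ivl. F x \<in> A}" if "A \<in> sets borel" for A
  proof -
    have "F -` A \<inter> space U = {x \<in> unit_ivl. F x \<in> A}" by (auto simp: U_def space_restrict_space spM)
    moreover have "{x \<in> unit_ivl. F x \<in> A} \<subseteq> unit_ivl" by blast
    ultimately show ?thesis unfolding M1_def emeasure_distr[OF F_meas that] using emU by simp
  qed
  have em2: "emeasure M2 A = emeasure M (A \<inter> unit_ivl)" if "A \<in> sets borel" for A
  proof -
    have "(\<lambda>x. x) -` A \<inter> space U = A \<inter> unit_ivl" by (auto simp: U_def space_restrict_space spM)
    thus ?thesis unfolding M2_def emeasure_distr[OF id_meas that] using emU[of "A \<inter> unit_ivl"] by auto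
  qed
  have s12: "sets M1 = sets borel" "sets M2 = sets borel" by (simp_all add: M1_def M2_def)
  have cells12: "emeasure M1 (cell q k c) = emeasure M2 (cell q k c)" if c: "q \<le> c" "c < q * 2 ^ k" for k c
  proof -
    obtain d where d: "d < q * 2 ^ k" "P k d = c"
      using P_bij[of k] c(2) unfolding bij_betw_def by (metis (no_types, lifting) imageE lessThan_iff)
    have "{x \<in> unit_ivl. F x \<in> cell q k c} = cell q k d"
      using F_cell_iff[OF _ d(1)] d(2) c(1) cell_subset_unit[OF d(1)] by auto
    moreover have "cell q k c \<inter> unit_ivl = cell q k c" using cell_subset_unit[OF c(2)] by auto
    ultimately show ?thesis using em1[OF cell_borel] em2[OF cell_borel] shift[OF d(1)] d(2) c(1)
      by (simp add: M.emeasure_eq_measure)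
  qed
  have open12: "emeasure M1 A = emeasure M2 A" if A: "open A" for A
  proof -
    define V where "V k = (\<Union>c\<in>inner_cells k A. cell q k c)" for k
    have Vsets: "V k \<in> sets borel" for k unfolding V_def using finite_inner_cells by (intro sets.finite_UN) auto
    have eqV: "emeasure M1 (V k) = emeasure M2 (V k)" for k
    proof -
      have dis: "disjoint_family_on (cell q k) (inner_cells k A)"
        using cell_unique unfolding disjoint_family_on_def by blast
      have "emeasure M1 (V k) = (\<Sum>c\<in>inner_cells k A. emeasure M1 (cell q k c))"
        unfolding V_def using finite_inner_cells dis s12 by (intro sum_emeasure[symmetric]) auto
      also have "\<dots> = (\<Sum>c\<in>inner_cells k A. emeasure M2 (cell q k c))"
        by (intro sum.cong refl cells12) (auto simp: inner_cells_def)
      also have "\<dots> = emeasure M2 (V k)"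
        unfolding V_def using finite_inner_cells dis s12 by (intro sum_emeasure) auto
      finally show ?thesis .
    qed
    have inc: "incseq V" unfolding V_def by (rule inner_cells_mono)
    have UV: "(\<Union>k. V k) = A \<inter> {0<..<1}" unfolding V_def by (rule inner_cells_union[OF A])
    have Ab: "A \<in> sets borel" "A \<inter> {0<..<1} \<in> sets borel" using A by auto
    have "emeasure M1 A = emeasure M1 (A \<inter> {0<..<1})"
    proof -
      have "{x \<in> unit_ivl. F x \<in> A} = {x \<in> unit_ivl. F x \<in> A \<inter> {0<..<1}}" using F_range by auto
      thus ?thesis using em1[OF Ab(1)] em1[OF Ab(2)] by simp
    qed
    also have "\<dots> = (SUP k. emeasure M1 (V k))"
      unfolding UV[symmetric] using Vsets s12 inc by (intro SUP_emeasure_incseq[symmetric]) auto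
    also have "\<dots> = (SUP k. emeasure M2 (V k))" by (simp add: eqV)
    also have "\<dots> = emeasure M2 (A \<inter> {0<..<1})"
      unfolding UV[symmetric] using Vsets s12 inc by (intro SUP_emeasure_incseq) auto
    also have "\<dots> = emeasure M2 A"
    proof -
      have "A \<inter> unit_ivl \<subseteq> A \<inter> {0<..<1} \<inter> unit_ivl \<union> {0}" by auto
      hence "measure M (A \<inter> unit_ivl) \<le> measure M (A \<inter> {0<..<1} \<inter> unit_ivl) + measure M {0}"
        using A M(2) by (intro order_trans[OF M.finite_measure_mono measure_Un_le]) auto
      moreover have "measure M (A \<inter> {0<..<1} \<inter> unit_ivl) \<le> measure M (A \<inter> unit_ivl)"
        using A M(2) by (intro M.finite_measure_mono) auto
      ultimately show ?thesis using em2[OF Ab(1)] em2[OF Ab(2)] atom[of 0]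
        by (simp add: M.emeasure_eq_measure)
    qed
    finally show ?thesis .
  qed
  have "M1 = M2"
  proof (rule measure_eqI_generator_eq[where E = "{A. open A}" and \<Omega> = UNIV and A = "\<lambda>_. UNIV"])
    show "Int_stable {A::real set. open A}" by (auto simp: Int_stable_def)
    show "sets M1 = sigma_sets UNIV {A. open A}" "sets M2 = sigma_sets UNIV {A. open A}"
      unfolding s12 by (simp_all add: borel_def)
    show "emeasure M1 UNIV \<noteq> \<infinity>" using em1[of UNIV] by (simp add: M.emeasure_eq_measure)
  qed (use open12 in auto)
  hence inv: "emeasure M {x \<in> unit_ivl. F x \<in> A} = emeasure M (A \<inter> unit_ivl)" if "A \<in> sets borel" for A
    using em1[OF that] em2[OF that] by simp
  define N where "N = restrict_space M (I_np q \<pi>)"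
  have npM: "I_np q \<pi> \<in> sets M" using I_np_borel M(2) by simp
  have spN: "space N = I_np q \<pi>" by (simp add: N_def space_restrict_space spM)
  have emN: "emeasure N A = emeasure M A" if "A \<subseteq> I_np q \<pi>" for A
    unfolding N_def using npM that spM by (intro emeasure_restrict_space) auto
  have setsN: "A \<in> sets N \<longleftrightarrow> A \<in> sets borel \<and> A \<subseteq> I_np q \<pi>" for A
    unfolding N_def using npM M(2) spM by (subst sets_restrict_space_iff) auto
  have pre: "F -` A \<inter> space N = {x \<in> unit_ivl. F x \<in> A}" if "A \<in> sets N" for A
    using that F_np_iff I_np_unit unfolding spN setsN by auto
  have "N \<in> np_measures" unfolding invariant_measures_def
  proof (intro CollectI conjI ballI)
    show "prob_space N"
      by (rule prob_spaceI) (simp add: spN emN M.emeasure_eq_measure np1)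
    show "sets N = sets (borel_of (top_of_set (I_np q \<pi>)))"
      unfolding borel_of_top_of_set N_def by (simp add: M(2) cong: sets_restrict_space_cong)
    show "F \<in> N \<rightarrow>\<^sub>M N"
    proof (rule measurableI)
      show "F x \<in> space N" if "x \<in> space N" for x using that F_np_iff[OF I_np_unit] by (simp add: spN)
      show "F -` A \<inter> space N \<in> sets N" if A: "A \<in> sets N" for A
      proof -
        have "F -` A \<inter> space N \<subseteq> I_np q \<pi>" using spN by auto
        thus ?thesis using F_borel[of A] A unfolding pre[OF A] setsN by auto
      qed
    qed
    show "emeasure N (F -` A \<inter> space N) = emeasure N A" if A: "A \<in> sets N" for A
    proof -
      have sub: "F -` A \<inter> space N \<subseteq> I_np q \<pi>" "A \<subseteq> I_np q \<pi>" using spN A setsN by auto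
      have "A \<inter> unit_ivl = A" using sub(2) I_np_unit by auto
      hence "emeasure M (F -` A \<inter> space N) = emeasure M A"
        using inv[of A] A setsN unfolding pre[OF A] by simp
      thus ?thesis using emN[OF sub(1)] emN[OF sub(2)] by simp
    qed
  qed
  moreover have "mass N (cell q k c) = 0" if c: "\<forall>t. (F ^^ t) 0 \<notin> cell q k c" for k c
  proof -
    have "emeasure N (cell q k c \<inter> I_np q \<pi>) = emeasure M (cell q k c \<inter> I_np q \<pi>)" by (rule emN) auto
    also have "\<dots> \<le> emeasure M (cell q k c)" using M(2) by (intro emeasure_mono) auto
    also have "\<dots> = 0" using unvisited[of k c] c by (simp add: orbit_def M.emeasure_eq_measure)
    finally show ?thesis by (simp add: mass_def measure_def)
  qed
  ultimately show ?thesis by blast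
qed

end

section \<open>One-sided behaviour and periodic intervals\<close>

context rotated_odometer
begin

lemma x_hat_eq:
  assumes i: "i < q" "\<pi> i = q - 1"
  shows "x_hat q \<pi> = (real i + 1) / real q"
proof -
  have inj: "inj_on (rot q \<pi>) unit_ivl"
    using F_inj unfolding rot_odo_def by (rule inj_on_imageI2)
  have qp: "real q > 0" using q_pos by simp
  define A where "A = real (q - 1) - real i"
  have inv: "the_inv_into unit_ivl (rot q \<pi>) y = y - A / real q"
    if y: "y \<in> {real (q - 1) / real q<..<1}" for y
  proof (rule the_inv_into_f_eq[OF inj])
    define x where "x = y - A / real q"
    have qx: "real q * x = real q * y - A"
      using qp unfolding x_def by (simp add: right_diff_distrib)
    have "real (q - 1) < real q * y" "real q * y < real q" using y qp by (auto simp: field_simps)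
    hence x: "real i \<le> real q * x" "real q * x < real i + 1" using qx q_pos unfolding A_def by (auto simp: of_nat_diff)
    hence "x \<in> cell q 0 i" by (simp add: in_cell)
    thus "y - A / real q \<in> unit_ivl"
      unfolding x_def[symmetric] using i by (intro cell_subset_unit[of i 0]) auto
    have "\<lfloor>real q * x\<rfloor> = int i" using x by (simp add: floor_eq_iff)
    hence "rot q \<pi> x = x + A / real q" using i by (simp add: rot_def Let_def A_def)
    thus "rot q \<pi> (y - A / real q) = y" unfolding x_def by simp
  qed
  have "((\<lambda>y. y - A / real q) \<longlongrightarrow> 1 - A / real q) (at_left 1)"
    by (intro tendsto_intros)
  moreover have "eventually (\<lambda>y. y - A / real q = the_inv_into unit_ivl (rot q \<pi>) y) (at_left 1)"
  proof -
    have "real (q - 1) / real q < 1" using q_pos by simp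
    hence "eventually (\<lambda>y. y \<in> {real (q - 1) / real q<..<1}) (at_left 1)" by (rule eventually_at_leftI[rotated]) auto
    thus ?thesis by eventually_elim (simp add: inv)
  qed
  ultimately have "(the_inv_into unit_ivl (rot q \<pi>) \<longlongrightarrow> 1 - A / real q) (at_left 1)"
    by (rule Lim_transform_eventually)
  hence "x_hat q \<pi> = 1 - A / real q"
    unfolding x_hat_def by (intro tendsto_Lim) auto
  also have "\<dots> = (real i + 1) / real q" using q_pos by (simp add: A_def of_nat_diff field_simps)
  finally show ?thesis .
qed

text \<open>
  The pieces of the Kakutani map accumulate only at \<open>1\<close>, where its values are squeezed to \<open>0\<close>.
  Hence \<open>x_hat q \<pi>\<close>, the point that the rotation sends to \<open>1\<close> from the left, is the only point of \<open>(0,1]\<close> at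
  which the map is not a translation on a left neighbourhood.
\<close>

lemma left_behaviour:
  assumes z: "0 < z" "z \<le> 1"
  shows "\<exists>e>0. e \<le> z \<and>
    ((z = x_hat q \<pi> \<and> (\<forall>y\<in>{z-e<..<z}. F y \<le> 2 * (z - y))) \<or>
     (z \<noteq> x_hat q \<pi> \<and> (\<exists>w. e \<le> w \<and> w \<le> 1 \<and> (\<forall>y\<in>{z-e<..<z}. F y = w - (z - y)))))"
proof -
  \<comment> \<open>The cell of level \<open>0\<close> on the left side of \<open>z\<close>.\<close>
  define i where "i = nat (\<lceil>real q * z\<rceil> - 1)"
  have qp: "real q > 0" using q_pos by simp
  have "0 < real q * z" using qp z by simp
  hence "int i = \<lceil>real q * z\<rceil> - 1" unfolding i_def by simp
  hence ri: "real i < real q * z" "real q * z \<le> real i + 1" by linarith+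
  have "real q * z \<le> real q * 1" using qp z by (intro mult_left_mono) auto
  hence "real i < real q" using ri by linarith
  hence iq: "i < q" by simp
  have piq: "\<pi> i < q" using permutes_in_image[OF perm, of i] iq by simp
  define u where "u = z + (real (\<pi> i) - real i) / real q"
  have qu: "real q * u = real q * z + (real (\<pi> i) - real i)"
    using qp unfolding u_def by (simp add: distrib_left)
  have rot: "rot q \<pi> y = u - (z - y)" if "y \<in> {real i / real q<..<z}" for y
  proof -
    have "real i < real q * y" using that qp by (simp add: field_simps)
    moreover have "real q * y < real q * z" using that qp by simp
    ultimately have "\<lfloor>real q * y\<rfloor> = int i" using ri by (simp add: floor_eq_iff)
    thus ?thesis by (simp add: rot_def Let_def u_def)
  qed
  have u0: "0 < u"
  proof -
    have "0 < real q * u" using ri qu by linarith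
    thus ?thesis using qp by (simp add: zero_less_mult_iff)
  qed
  define e0 where "e0 = z - real i / real q"
  have e0: "e0 > 0" "e0 \<le> z" unfolding e0_def using ri(1) qp by (auto simp: field_simps)
  have rot_unit: "0 \<le> rot q \<pi> y \<and> rot q \<pi> y < 1" if "y \<in> {real i / real q<..<z}" for y
  proof -
    have "real q * rot q \<pi> y = real q * y + (real (\<pi> i) - real i)"
      unfolding rot[OF that] using qu by (simp add: algebra_simps)
    moreover have "real i < real q * y" using that qp by (simp add: field_simps)
    moreover have "real q * y < real q * z" using that qp by simp
    moreover have "real (\<pi> i) + 1 \<le> real q" using piq by simp
    ultimately have "0 < real q * rot q \<pi> y" "real q * rot q \<pi> y < real q * 1" using ri by linarith+
    thus ?thesis using qp by (simp add: zero_less_mult_iff)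
  qed
  have ule: "real q * u \<le> real q * 1" "real q * u = real q \<longleftrightarrow> z = x_hat q \<pi>"
  proof -
    have p1: "real (\<pi> i) + 1 \<le> real q" using piq by simp
    show "real q * u \<le> real q * 1" using qu ri p1 by linarith
    define j where "j = inv \<pi> (q - 1)"
    have pj: "\<pi> j = q - 1" unfolding j_def using permutes_inverses(1)[OF perm] by simp
    have jq: "j < q" using permutes_in_image[OF perm, of j] pj q_pos by simp
    have xh: "x_hat q \<pi> = (real j + 1) / real q" using x_hat_eq[OF jq pj] .
    show "real q * u = real q \<longleftrightarrow> z = x_hat q \<pi>"
    proof
      assume "real q * u = real q"
      hence "real (\<pi> i) + 1 = real q" and zi: "real q * z = real i + 1" using qu ri p1 by linarith+
      hence "\<pi> i = q - 1" by linarith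
      hence "i = j" using pj permutes_inj[OF perm] by (metis injD)
      thus "z = x_hat q \<pi>" unfolding xh using zi qp by (simp add: field_simps)
    next
      assume "z = x_hat q \<pi>"
      hence zj: "real q * z = real j + 1" unfolding xh using qp by simp
      hence "real i < real j + 1" "real j \<le> real i" using ri by linarith+
      hence "i = j" by linarith
      thus "real q * u = real q" using qu zj pj q_pos by (simp add: of_nat_diff)
    qed
  qed
  show ?thesis
  proof (cases "z = x_hat q \<pi>")
    case True
    hence u1: "u = 1" using ule(2) qp by simp
    have "F y \<le> 2 * (z - y)" if "y \<in> {z - e0<..<z}" for y
    proof -
      have y: "y \<in> {real i / real q<..<z}" using that by (simp add: e0_def)
      have "F y = kakutani (rot q \<pi> y)" by (simp add: rot_odo_def)
      also have "\<dots> \<le> 2 * (1 - rot q \<pi> y)" using rot_unit[OF y] by (intro kakutani_range) auto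
      finally show ?thesis by (simp add: rot[OF y] u1)
    qed
    thus ?thesis using True e0 by blast
  next
    case False
    have "u < 1" using ule False qp by (metis less_eq_real_def mult.right_neutral mult_le_cancel_left_pos)
    then obtain n :: nat where n: "n \<ge> 1" "1 - 2 / 2 ^ n < u" "u \<le> 1 - 1 / 2 ^ n"
      using kakutani_piece_exists_left[OF u0] by blast
    define h where "h = (1::real) / 2 ^ n"
    have "(2::real) ^ 1 \<le> 2 ^ n" using n(1) by (intro power_increasing) auto
    hence h: "0 < h" "h \<le> 1/2" by (auto simp: h_def field_simps)
    have n': "1 - 2 * h < u" "u \<le> 1 - h" using n by (simp_all add: h_def)
    define w where "w = u - (1 - 3 * h)"
    define e where "e = min e0 (u - (1 - 2 * h))"
    have e: "e > 0" "e \<le> z" "e \<le> w" "w \<le> 1" using e0 n' h by (auto simp: e_def w_def min_def)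
    have "F y = w - (z - y)" if y: "y \<in> {z - e<..<z}" for y
    proof -
      have y1: "y \<in> {real i / real q<..<z}" "u - (z - y) > 1 - 2 * h" "u - (z - y) < u"
        using y by (auto simp: e_def e0_def)
      have "kakutani (u - (z - y)) = u - (z - y) - (1 - 3 / 2 ^ n)"
        using n(1) y1(2,3) n'(2) by (intro kakutani_piece) (auto simp: h_def)
      thus ?thesis unfolding rot_odo_def comp_def rot[OF y1(1)] by (simp add: w_def h_def)
    qed
    thus ?thesis using False e by blast
  qed
qed

lemma translation_imp_continuous:
  assumes "e > 0" "\<And>y. \<bar>y - x\<bar> < e \<Longrightarrow> F y = F x + (y - x)"
  shows "continuous (at x within unit_ivl) F"
  unfolding continuous_within_eps_delta
proof (intro allI impI)
  fix d :: real assume d: "0 < d"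
  have "dist (F y) (F x) < d" if "dist y x < min d e" for y
    using assms(2)[of y] that by (simp add: dist_real_def)
  moreover have "min d e > 0" using d assms(1) by simp
  ultimately show "\<exists>e'>0. \<forall>y\<in>unit_ivl. dist y x < e' \<longrightarrow> dist (F y) (F x) < d" by blast
qed

text \<open>
  At \<open>x_hat q \<pi>\<close> the map jumps from \<open>0\<close> to a positive value; at any other point it is a translation
  on either side, and continuity forces the two translations to agree.
\<close>

lemma continuous_imp_translation:
  assumes x: "x \<in> {0<..<1}" and cont: "continuous (at x within unit_ivl) F"
  shows "\<exists>e>0. \<forall>y. \<bar>y - x\<bar> < e \<longrightarrow> y \<in> {0<..<1} \<and> F y = F x + (y - x) \<and>
    continuous (at y within unit_ivl) F"
proof -
  have eps: "\<exists>d>0. \<forall>y\<in>unit_ivl. \<bar>y - x\<bar> < d \<longrightarrow> \<bar>F y - F x\<bar> < \<epsilon>" if "\<epsilon> > 0" for \<epsilon>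
    using cont that unfolding continuous_within_eps_delta dist_real_def by blast
  have Fx: "F x > 0" using F_range[of x] x by simp
  have xu: "x \<in> unit_ivl" using x by simp
  from right_translation[OF xu] obtain e1 where e1: "e1 > 0"
    "\<And>y. y \<in> {x..<x+e1} \<Longrightarrow> y < 1 \<and> F y = F x + (y - x)" by blast
  obtain e2 where e2: "e2 > 0" "e2 \<le> x"
    and alt: "(x = x_hat q \<pi> \<and> (\<forall>y\<in>{x-e2<..<x}. F y \<le> 2 * (x - y))) \<or>
     (x \<noteq> x_hat q \<pi> \<and> (\<exists>w. e2 \<le> w \<and> w \<le> 1 \<and> (\<forall>y\<in>{x-e2<..<x}. F y = w - (x - y))))"
    using left_behaviour[of x] x by auto
  have left: "F y = F x + (y - x)" if "y \<in> {x-e2<..<x}" for y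
    using alt
  proof
    assume a: "x = x_hat q \<pi> \<and> (\<forall>y\<in>{x-e2<..<x}. F y \<le> 2 * (x - y))"
    obtain d where d: "d > 0" "\<And>y. y \<in> unit_ivl \<Longrightarrow> \<bar>y - x\<bar> < d \<Longrightarrow> \<bar>F y - F x\<bar> < F x / 2"
      using eps[of "F x / 2"] Fx by auto
    define m where "m = min (min d e2) (F x / 2)"
    have m: "m > 0" "m \<le> d" "m \<le> e2" "m \<le> F x / 2" using d(1) e2 Fx by (auto simp: m_def)
    define y' where "y' = x - m / 2"
    have "y' \<in> {x-e2<..<x}" using m by (simp add: y'_def)
    hence "F y' \<le> 2 * (x - y')" using a by blast
    moreover have "\<bar>F y' - F x\<bar> < F x / 2" using m e2 x by (intro d(2)) (auto simp: y'_def)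
    ultimately show ?thesis using m by (simp add: y'_def abs_less_iff)
  next
    assume "x \<noteq> x_hat q \<pi> \<and> (\<exists>w. e2 \<le> w \<and> w \<le> 1 \<and> (\<forall>y\<in>{x-e2<..<x}. F y = w - (x - y)))"
    then obtain w where w: "\<And>y. y \<in> {x-e2<..<x} \<Longrightarrow> F y = w - (x - y)" by blast
    have "w = F x"
    proof (rule ccontr)
      assume ne: "w \<noteq> F x"
      define \<epsilon> where "\<epsilon> = \<bar>w - F x\<bar> / 2"
      have \<epsilon>: "\<epsilon> > 0" using ne by (simp add: \<epsilon>_def)
      obtain d where d: "d > 0" "\<And>y. y \<in> unit_ivl \<Longrightarrow> \<bar>y - x\<bar> < d \<Longrightarrow> \<bar>F y - F x\<bar> < \<epsilon>"
        using eps[OF \<epsilon>] by auto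
      define m where "m = min (min d e2) \<epsilon>"
      have m: "m > 0" "m \<le> d" "m \<le> e2" "m \<le> \<epsilon>" using d(1) e2 \<epsilon> by (auto simp: m_def)
      define y' where "y' = x - m / 2"
      have "F y' = w - m / 2" using w[of y'] m by (simp add: y'_def)
      moreover have "\<bar>F y' - F x\<bar> < \<epsilon>" using m e2 x by (intro d(2)) (auto simp: y'_def)
      ultimately have "\<bar>w - F x\<bar> < \<epsilon> + m / 2" using m(1) by linarith
      moreover have "\<bar>w - F x\<bar> = 2 * \<epsilon>" by (simp add: \<epsilon>_def)
      ultimately show False using m(4) \<epsilon> by linarith
    qed
    thus ?thesis using w[OF that] by simp
  qed
  define e where "e = min e1 e2"
  have e: "e > 0" "e \<le> e1" "e \<le> e2" using e1(1) e2(1) by (auto simp: e_def)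
  have tr: "F y = F x + (y - x)" if "\<bar>y - x\<bar> < e" for y
    using left[of y] e1(2)[of y] e that by (cases "y < x") auto
  have "y \<in> {0<..<1} \<and> F y = F x + (y - x) \<and> continuous (at y within unit_ivl) F"
    if y: "\<bar>y - x\<bar> < e" for y
  proof (intro conjI tr[OF y])
    have "0 < y" using y e e2(2) by linarith
    moreover have "y < 1" using e1(2)[of y] y e x by (cases "y < x") auto
    ultimately show "y \<in> {0<..<1}" by simp
    show "continuous (at y within unit_ivl) F"
    proof (rule translation_imp_continuous[of "e - \<bar>y - x\<bar>"])
      fix y' assume "\<bar>y' - y\<bar> < e - \<bar>y - x\<bar>"
      hence "\<bar>y' - x\<bar> < e" by linarith
      thus "F y' = F y + (y' - y)" using tr[of y'] tr[OF y] by simp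
    qed (use y in simp)
  qed
  thus ?thesis using e(1) by blast
qed

lemma continuous_in_cell:
  assumes c: "c < q * 2 ^ k" "q \<le> P k c" and x: "x \<in> cell q k c" "x \<noteq> real c / (real q * 2 ^ k)"
  shows "continuous (at x within unit_ivl) F"
proof -
  define e where "e = min (x - real c / (real q * 2 ^ k)) ((real c + 1) / (real q * 2 ^ k) - x)"
  have "e > 0" using x by (auto simp: e_def cell_def)
  moreover have "F y = F x + (y - x)" if "\<bar>y - x\<bar> < e" for y
  proof -
    have y: "y \<in> cell q k c" using that by (auto simp: e_def cell_def)
    show ?thesis using F_translation[OF y c] F_translation[OF x(1) c] by simp
  qed
  ultimately show ?thesis by (rule translation_imp_continuous)
qed

lemma D0_unit: "D0 q \<pi> \<subseteq> unit_ivl" by (auto simp: D0_def)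

lemma D0_rational: "x \<in> D0 q \<pi> \<Longrightarrow> x \<in> \<rat>"
proof -
  assume "x \<in> D0 q \<pi>"
  then consider "x = 0" | n :: nat where "rot q \<pi> x = 1 - 1 / 2 ^ n"
    | "x \<in> unit_ivl" "\<not> continuous (at x within unit_ivl) F"
    by (auto simp: D0_def)
  thus "x \<in> \<rat>"
  proof cases
    case (2 n)
    have "x = (1 - 1 / 2 ^ n) - (real (\<pi> (nat \<lfloor>real q * x\<rfloor>)) - real (nat \<lfloor>real q * x\<rfloor>)) / real q"
      using 2 by (simp add: rot_def Let_def)
    moreover have "(1 - 1 / 2 ^ n) - (real (\<pi> (nat \<lfloor>real q * x\<rfloor>)) - real (nat \<lfloor>real q * x\<rfloor>)) / real q \<in> \<rat>"
      by (intro Rats_diff Rats_divide Rats_power Rats_of_nat Rats_1 Rats_number_of)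
    ultimately show ?thesis by (simp only:)
  next
    case 3
    obtain k c where c: "c < q * 2 ^ k" "x \<in> cell q k c" "q \<le> P k c" using translation_cell[OF 3(1)] .
    have "x = real c / (real q * 2 ^ k)" using continuous_in_cell[OF c(1,3,2)] 3(2) by blast
    thus ?thesis by simp
  qed simp
qed

lemma cut_points_unit: "cut_points q \<pi> \<subseteq> unit_ivl"
  using D0_unit funpow_unit unfolding cut_points_def by blast

lemma cut_points_rational: "cut_points q \<pi> \<subseteq> \<rat>"
proof
  fix y assume y: "y \<in> cut_points q \<pi>"
  hence yu: "y \<in> unit_ivl" using cut_points_unit by blast
  from y consider x n where "x \<in> D0 q \<pi>" "y = (F ^^ n) x" | x n where "x \<in> D0 q \<pi>" "(F ^^ n) y = x"
    by (auto simp: cut_points_def)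
  thus "y \<in> \<rat>"
  proof cases
    case 1
    have "((F ^^ n) x - x) + x \<in> \<rat>"
      using funpow_diff_rational[of x n] D0_rational[OF 1(1)] D0_unit 1(1) by (intro Rats_add) auto
    thus ?thesis using 1 by simp
  next
    case 2
    have "x - ((F ^^ n) y - y) \<in> \<rat>"
      by (intro Rats_diff D0_rational 2 funpow_diff_rational yu)
    moreover have "x - ((F ^^ n) y - y) = y" using 2(2) by simp
    ultimately show ?thesis by (simp only:)
  qed
qed

lemma cut_points_countable: "countable (cut_points q \<pi>)"
  using cut_points_rational countable_rat countable_subset by blast

lemma zero_cut_point: "0 \<in> cut_points q \<pi>"
  unfolding cut_points_def D0_def by (auto intro!: exI[of _ 0])

text \<open>
  Enlarge a periodic cell as long as no orbit of length \<open>n\<close> (its period) meets a discontinuity or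
  \<open>0\<close>.  On the resulting interval \<open>F\<^sup>n - id\<close> is locally constant, hence zero, and the growth stops
  at cut points or at \<open>1\<close>.
\<close>

lemma cyclic_cell_in_periodic_interval:
  assumes "c \<in> cyclic_cells k"
  obtains x y where "x \<in> cut_points q \<pi>" "y \<in> cut_points q \<pi> \<union> {1}" "{x..<y} \<subseteq> I_per q \<pi>"
    "x \<le> real c / (real q * 2 ^ k)" "(real c + 1) / (real q * 2 ^ k) \<le> y"
proof -
  have c: "c < q * 2 ^ k" "\<And>s. q \<le> (P k ^^ s) c" using assms by (auto simp: cyclic_cells_def)
  obtain n where n: "n \<ge> 1" "\<And>x. x \<in> cell q k c \<Longrightarrow> (F ^^ n) x = x"
    using cyclic_cell_period[OF assms] by blast
  define \<alpha> where "\<alpha> = real c / (real q * 2 ^ k)"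
  define \<beta> where "\<beta> = (real c + 1) / (real q * 2 ^ k)"
  have cell: "cell q k c = {\<alpha>..<\<beta>}" by (simp add: cell_def \<alpha>_def \<beta>_def)
  have ab: "\<alpha> < \<beta>" unfolding \<alpha>_def \<beta>_def using q_pos by (intro divide_strict_right_mono) auto
  have cu: "{\<alpha>..<\<beta>} \<subseteq> unit_ivl" using cell_subset_unit[OF c(1)] unfolding cell[symmetric] by blast
  have "\<alpha> \<in> {\<alpha>..<\<beta>}" using ab by simp
  hence "\<alpha> \<in> unit_ivl" using cu by blast
  hence a0: "0 \<le> \<alpha>" "\<alpha> < 1" by auto
  have b0: "0 < \<beta>" using a0 ab by linarith
  have b1: "\<beta> \<le> 1"
  proof (rule ccontr)
    assume "\<not> \<beta> \<le> 1"
    hence "1 \<in> {\<alpha>..<\<beta>}" using a0 by simp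
    hence "1 \<in> unit_ivl" using cu by blast
    thus False by simp
  qed
  define D1 where "D1 = {0} \<union> {x \<in> unit_ivl. \<not> continuous (at x within unit_ivl) F}"
  \<comment> \<open>The obstacles: points whose orbit of length \<open>n\<close> meets a discontinuity or \<open>0\<close>.\<close>
  define E where "E = {y \<in> unit_ivl. \<exists>t<n. (F ^^ t) y \<in> D1}"
  have D1: "D1 \<subseteq> D0 q \<pi>" by (auto simp: D1_def D0_def)
  have E_cut: "E \<subseteq> cut_points q \<pi>"
  proof
    fix y assume "y \<in> E"
    then obtain t where t: "y \<in> unit_ivl" "(F ^^ t) y \<in> D1" by (auto simp: E_def)
    show "y \<in> cut_points q \<pi>"
    proof (cases "(F ^^ t) y = 0")
      case True
      hence "t = 0" using funpow_pos[OF t(1), of t] by (cases t) auto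
      thus ?thesis using True zero_cut_point by simp
    next
      case False
      thus ?thesis using t D1 by (auto simp: cut_points_def)
    qed
  qed
  have E_open: "\<exists>e>0. \<forall>y. \<bar>y - s\<bar> < e \<longrightarrow> y \<notin> E \<and> (F ^^ n) y - y = (F ^^ n) s - s"
    if s: "s \<in> {0<..<1}" "s \<notin> E" for s
  proof -
    have "\<exists>e>0. \<forall>y. \<bar>y - s\<bar> < e \<longrightarrow> (F ^^ m) y = (F ^^ m) s + (y - s) \<and> (\<forall>t<m. (F ^^ t) y \<notin> D1)"
      if "m \<le> n" for m
      using that
    proof (induction m)
      case 0 show ?case by (intro exI[of _ 1]) simp
    next
      case (Suc m)
      then obtain e where e: "e > 0" "\<And>y. \<bar>y - s\<bar> < e \<Longrightarrow> (F ^^ m) y = (F ^^ m) s + (y - s)"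
        "\<And>y t. \<bar>y - s\<bar> < e \<Longrightarrow> t < m \<Longrightarrow> (F ^^ t) y \<notin> D1" by auto
      define x where "x = (F ^^ m) s"
      have xu: "x \<in> unit_ivl" unfolding x_def using s(1) by (intro funpow_unit) simp
      have "x \<notin> D1" using s Suc.prems unfolding x_def E_def by auto
      hence "x \<in> {0<..<1}" "continuous (at x within unit_ivl) F" using xu by (auto simp: D1_def)
      then obtain e' where e': "e' > 0" "\<And>y. \<bar>y - x\<bar> < e' \<Longrightarrow> y \<in> {0<..<1} \<and> F y = F x + (y - x) \<and>
        continuous (at y within unit_ivl) F" using continuous_imp_translation by blast
      have "(F ^^ Suc m) y = (F ^^ Suc m) s + (y - s) \<and> (\<forall>t<Suc m. (F ^^ t) y \<notin> D1)"
        if "\<bar>y - s\<bar> < min e e'" for y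
      proof -
        have y: "\<bar>y - s\<bar> < e" "\<bar>y - s\<bar> < e'" using that by simp_all
        have m: "(F ^^ m) y = x + (y - s)" using e(2)[OF y(1)] by (simp add: x_def)
        hence "\<bar>(F ^^ m) y - x\<bar> < e'" using y(2) by simp
        note r = e'(2)[OF this]
        have "(F ^^ m) y \<notin> D1" using r by (auto simp: D1_def)
        hence "(F ^^ t) y \<notin> D1" if "t < Suc m" for t
          using e(3)[OF y(1), of t] that by (cases "t = m") auto
        moreover have "(F ^^ Suc m) y = (F ^^ Suc m) s + (y - s)" using r m by (simp add: x_def)
        ultimately show ?thesis by blast
      qed
      moreover have "min e e' > 0" using e(1) e'(1) by simp
      ultimately show ?case by blast
    qed
    from this[OF order_refl] obtain e where e: "e > 0"
      "\<And>y. \<bar>y - s\<bar> < e \<Longrightarrow> (F ^^ n) y = (F ^^ n) s + (y - s) \<and> (\<forall>t<n. (F ^^ t) y \<notin> D1)" by blast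
    have "y \<notin> E \<and> (F ^^ n) y - y = (F ^^ n) s - s" if "\<bar>y - s\<bar> < e" for y
    proof
      show "y \<notin> E" using e(2)[OF that] unfolding E_def by blast
      show "(F ^^ n) y - y = (F ^^ n) s - s" using e(2)[OF that] by linarith
    qed
    thus ?thesis using e(1) by blast
  qed
  have inner: "y \<notin> E" if y: "y \<in> {\<alpha><..<\<beta>}" for y
  proof
    assume "y \<in> E"
    then obtain t where t: "(F ^^ t) y \<in> D1" by (auto simp: E_def)
    have yc: "y \<in> cell q k c" using y cell by auto
    have yu: "y \<in> unit_ivl" using cell_subset_unit[OF c(1) yc] .
    define d where "d = (P k ^^ t) c"
    have d: "d < q * 2 ^ k" "q \<le> P k d" using P_funpow_less[OF c(1)] c(2)[of "Suc t"] by (auto simp: d_def)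
    have tr: "(F ^^ t) y = y + (real d - real c) / (real q * 2 ^ k)"
      unfolding d_def using funpow_translation[OF yc c(1)] c(2) by blast
    have td: "(F ^^ t) y \<in> cell q k d"
      unfolding d_def using funpow_cell_iff[OF yu c(1)] c(2) yc by blast
    have "(F ^^ t) y \<noteq> real d / (real q * 2 ^ k)"
      unfolding tr using y by (auto simp: \<alpha>_def diff_divide_distrib)
    hence "continuous (at ((F ^^ t) y) within unit_ivl) F" using continuous_in_cell[OF d td] by blast
    moreover have "(F ^^ t) y \<noteq> 0" using funpow_pos[OF yu, of t] y a0 by (cases "t = 0") auto
    ultimately show False using t by (simp add: D1_def)
  qed
  define K where "K = E \<inter> {0..\<alpha>}"
  define x where "x = Sup K"
  have K0: "0 \<in> K" using a0 n(1) by (auto simp: K_def E_def D1_def intro!: exI[of _ 0])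
  have bdd: "bdd_above K" by (rule bdd_aboveI[of _ \<alpha>]) (auto simp: K_def)
  have x0: "0 \<le> x" "x \<le> \<alpha>" unfolding x_def using K0 bdd
    by (auto intro!: cSup_upper cSup_least simp: K_def)
  have xE: "x \<in> E"
  proof (rule ccontr)
    assume nE: "x \<notin> E"
    have "x \<noteq> 0" using nE K0 by (auto simp: K_def)
    hence "x \<in> {0<..<1}" using x0 a0 by auto
    then obtain e where e: "e > 0" "\<And>y. \<bar>y - x\<bar> < e \<Longrightarrow> y \<notin> E" using E_open nE by blast
    have "x - e < Sup K" using e(1) by (simp add: x_def)
    then obtain y where "y \<in> K" "x - e < y" using less_cSup_iff[of K "x - e"] K0 bdd by auto
    moreover have "y \<le> x" unfolding x_def using \<open>y \<in> K\<close> bdd by (rule cSup_upper)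
    ultimately show False using e(2)[of y] by (auto simp: K_def)
  qed
  have left: "y \<notin> E" if "x < y" "y \<le> \<alpha>" for y
  proof
    assume "y \<in> E"
    hence "y \<in> K" using that x0 by (simp add: K_def)
    hence "y \<le> x" unfolding x_def using bdd by (rule cSup_upper)
    thus False using that by simp
  qed
  obtain y where y: "y \<in> E \<union> {1}" "\<beta> \<le> y" "\<And>s. \<beta> \<le> s \<Longrightarrow> s < y \<Longrightarrow> s \<notin> E"
  proof (cases "E \<inter> {\<beta>..} = {}")
    case True
    show ?thesis by (rule that[of 1]) (use True b1 in auto)
  next
    case False
    define H where "H = E \<inter> {\<beta>..}"
    define y where "y = Inf H"
    have H: "H \<noteq> {}" using False by (simp add: H_def)
    have bb: "bdd_below H" by (rule bdd_belowI[of _ \<beta>]) (auto simp: H_def)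
    have yb: "\<beta> \<le> y" unfolding y_def using H by (intro cInf_greatest) (auto simp: H_def)
    have low: "y \<le> s" if "s \<in> H" for s unfolding y_def using that bb by (rule cInf_lower)
    have yE: "y \<in> E"
    proof (rule ccontr)
      assume nE: "y \<notin> E"
      obtain s where "s \<in> H" using H by blast
      hence "y < 1" using low[of s] by (auto simp: H_def E_def)
      hence "y \<in> {0<..<1}" using yb b0 by auto
      then obtain e where e: "e > 0" "\<And>s. \<bar>s - y\<bar> < e \<Longrightarrow> s \<notin> E" using E_open nE by blast
      have "Inf H < y + e" using e(1) by (simp add: y_def)
      then obtain s where "s \<in> H" "s < y + e" using cInf_less_iff[OF H bb] by auto
      thus False using e(2)[of s] low[of s] by (auto simp: H_def)
    qed
    show ?thesis
    proof (rule that[of y])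
      show "s \<notin> E" if "\<beta> \<le> s" "s < y" for s using low[of s] that by (auto simp: H_def)
    qed (use yE yb in auto)
  qed
  have y1: "y \<le> 1" using y(1) by (auto simp: E_def)
  have noE: "s \<notin> E" if s: "x < s" "s < y" for s
  proof -
    consider "s \<le> \<alpha>" | "s \<in> {\<alpha><..<\<beta>}" | "\<beta> \<le> s" by fastforce
    thus ?thesis using left s inner y(3) by cases blast+
  qed
  have id: "(F ^^ n) s = s" if s: "x < s" "s < y" for s
  proof -
    \<comment> \<open>A point of the original cell, where \<open>F\<^sup>n\<close> is known to be the identity.\<close>
    define m where "m = (\<alpha> + \<beta>) / 2"
    have m: "m \<in> {\<alpha>..<\<beta>}" "x < m" "m < y" using ab x0 y(2) by (auto simp: m_def)
    have "(F ^^ n) s - s = (F ^^ n) m - m"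
    proof (rule connected_local_const[where f = "\<lambda>s. (F ^^ n) s - s" and A = "{x<..<y}"])
      show "\<forall>a\<in>{x<..<y}. eventually (\<lambda>b. (F ^^ n) a - a = (F ^^ n) b - b) (at a within {x<..<y})"
      proof
        fix a assume a: "a \<in> {x<..<y}"
        hence "a \<in> {0<..<1}" "a \<notin> E" using x0 y1 noE by auto
        then obtain e where e: "e > 0" "\<And>b. \<bar>b - a\<bar> < e \<Longrightarrow> (F ^^ n) b - b = (F ^^ n) a - a"
          using E_open by blast
        show "eventually (\<lambda>b. (F ^^ n) a - a = (F ^^ n) b - b) (at a within {x<..<y})"
        proof -
          have "(F ^^ n) a - a = (F ^^ n) b - b" if "dist b a < e" for b
            using e(2)[of b] that by (simp add: dist_real_def)
          thus ?thesis unfolding eventually_at using e(1) by blast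
        qed
      qed
    qed (use s m in auto)
    thus ?thesis using n(2)[of m] m(1) cell by simp
  qed
  have xu: "x \<in> unit_ivl" using xE by (simp add: E_def)
  have "(F ^^ n) x = x"
  proof -
    obtain e where e: "e > 0" "\<And>s u. s \<le> n \<Longrightarrow> u \<in> {x..<x+e} \<Longrightarrow> (F ^^ s) u = (F ^^ s) x + (u - x)"
      using right_translation_funpow[OF xu, of n] by blast
    have xy: "x < y" using x0(2) ab y(2) by linarith
    define u where "u = x + min e (y - x) / 2"
    have u: "u \<in> {x..<x+e}" "x < u" "u < y" using e(1) xy by (auto simp: u_def min_def field_simps)
    show ?thesis using e(2)[OF order_refl u(1)] id[OF u(2,3)] by simp
  qed
  hence "(F ^^ n) s = s" if "s \<in> {x..<y}" for s using id[of s] that by (cases "s = x") auto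
  hence "{x..<y} \<subseteq> I_per q \<pi>" using n(1) x0 y1 by (auto simp: I_per_def)
  thus ?thesis using that[of x y] xE y(1,2) E_cut x0(2) unfolding \<alpha>_def \<beta>_def by blast
qed

end

section \<open>The order topology of the split interval\<close>

lemma topspace_order_topology_on: "topspace (order_topology_on S) = S"
  unfolding order_topology_on_def topology_generated_by_topspace by auto

lemma openin_rays:
  assumes "a \<in> S"
  shows "openin (order_topology_on S) {x \<in> S. x < a}" "openin (order_topology_on S) {x \<in> S. a < x}"
  unfolding order_topology_on_def by (rule topology_generated_by_Basis, use assms in blast)+

lemma Hausdorff_order_topology_on: "Hausdorff_space (order_topology_on S)"
proof -
  have sep: "\<exists>U V. openin (order_topology_on S) U \<and> openin (order_topology_on S) V \<and> a \<in> U \<and> b \<in> V \<and> disjnt U V"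
    if ab: "a \<in> S" "b \<in> S" "a < b" for a b
  proof (cases "\<exists>c\<in>S. a < c \<and> c < b")
    case True
    then obtain c where c: "c \<in> S" "a < c" "c < b" by blast
    have "disjnt {x \<in> S. x < c} {x \<in> S. c < x}" by (auto simp: disjnt_def)
    thus ?thesis using openin_rays[OF c(1)] ab c by blast
  next
    case False
    hence "disjnt {x \<in> S. x < b} {x \<in> S. a < x}" by (auto simp: disjnt_def)
    thus ?thesis using openin_rays(1)[OF ab(2)] openin_rays(2)[OF ab(1)] ab by blast
  qed
  show ?thesis unfolding Hausdorff_space_def topspace_order_topology_on
  proof (intro allI impI, elim conjE)
    fix a b assume ab: "a \<in> S" "b \<in> S" "a \<noteq> b"
    show "\<exists>U V. openin (order_topology_on S) U \<and> openin (order_topology_on S) V \<and> a \<in> U \<and> b \<in> V \<and> disjnt U V"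
    proof (cases "a < b")
      case True thus ?thesis using sep[OF ab(1,2)] by blast
    next
      case False
      hence "b < a" using ab(3) by simp
      from sep[OF ab(2,1) this] obtain U V where UV: "openin (order_topology_on S) U"
        "openin (order_topology_on S) V" "b \<in> U" "a \<in> V" "disjnt U V" by blast
      have "disjnt V U" using UV(5) by (rule disjnt_sym)
      thus ?thesis using UV by blast
    qed
  qed
qed

lemma split_real_less [simp]:
  "Minus x < Minus y \<longleftrightarrow> x < y" "Minus x < Plus y \<longleftrightarrow> x \<le> y"
  "Plus x < Minus y \<longleftrightarrow> x < y" "Plus x < Plus y \<longleftrightarrow> x < y"
  by (auto simp: less_split_real_def)

fun val :: "split_real \<Rightarrow> real" where
  "val (Plus x) = x"
| "val (Minus x) = x"

context rotated_odometer
begin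

abbreviation "D \<equiv> cut_points q \<pi>"
abbreviation "Istar \<equiv> I_star q \<pi>"
abbreviation "X \<equiv> I_star_top q \<pi>"

lemma topspace_X [simp]: "topspace X = Istar"
  by (simp add: I_star_top_def topspace_order_topology_on)

lemma Plus_in_Istar [simp]: "Plus x \<in> Istar \<longleftrightarrow> x \<in> unit_ivl"
  by (auto simp: I_star_def)

lemma Minus_in_Istar: "Minus x \<in> Istar \<longleftrightarrow> (x \<in> D \<and> x \<noteq> 0) \<or> x = 1"
  by (auto simp: I_star_def)

lemma Minus_range: "Minus x \<in> Istar \<Longrightarrow> 0 < x \<and> x \<le> 1"
  using cut_points_unit by (fastforce simp: Minus_in_Istar)

lemma openin_less: "a \<in> Istar \<Longrightarrow> openin X {p \<in> Istar. p < a}"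
  and openin_greater: "a \<in> Istar \<Longrightarrow> openin X {p \<in> Istar. a < p}"
  unfolding I_star_top_def by (rule openin_rays, assumption)+

lemma Hausdorff_X: "Hausdorff_space X"
  unfolding I_star_top_def by (rule Hausdorff_order_topology_on)

definition right_nhd :: "real \<Rightarrow> split_real set \<Rightarrow> bool" where
  "right_nhd x U \<longleftrightarrow> (\<exists>e>0. \<forall>p\<in>Istar. Plus x \<le> p \<longrightarrow> p < Plus (x + e) \<longrightarrow> p \<in> U)"

definition left_nhd :: "split_real \<Rightarrow> split_real set \<Rightarrow> bool" where
  "left_nhd a U \<longleftrightarrow> (\<exists>e>0. \<forall>p\<in>Istar. Plus (val a - e) < p \<longrightarrow> p \<le> a \<longrightarrow> p \<in> U)"

lemma right_nhd_Int: "right_nhd x U \<Longrightarrow> right_nhd x V \<Longrightarrow> right_nhd x (U \<inter> V)"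
proof -
  assume "right_nhd x U" "right_nhd x V"
  then obtain e e' where e: "e > 0" "\<And>p. p \<in> Istar \<Longrightarrow> Plus x \<le> p \<Longrightarrow> p < Plus (x + e) \<Longrightarrow> p \<in> U"
    and e': "e' > 0" "\<And>p. p \<in> Istar \<Longrightarrow> Plus x \<le> p \<Longrightarrow> p < Plus (x + e') \<Longrightarrow> p \<in> V"
    unfolding right_nhd_def by blast
  have le: "Plus (x + min e e') \<le> Plus (x + e)" "Plus (x + min e e') \<le> Plus (x + e')" by auto
  have "p \<in> U \<inter> V" if "p \<in> Istar" "Plus x \<le> p" "p < Plus (x + min e e')" for p
    using e(2)[OF that(1,2)] e'(2)[OF that(1,2)] less_le_trans[OF that(3) le(1)] less_le_trans[OF that(3) le(2)]
    by blast
  moreover have "min e e' > 0" using e(1) e'(1) by simp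
  ultimately show ?thesis unfolding right_nhd_def by blast
qed

lemma left_nhd_Int: "left_nhd a U \<Longrightarrow> left_nhd a V \<Longrightarrow> left_nhd a (U \<inter> V)"
proof -
  assume "left_nhd a U" "left_nhd a V"
  then obtain e e' where e: "e > 0" "\<And>p. p \<in> Istar \<Longrightarrow> Plus (val a - e) < p \<Longrightarrow> p \<le> a \<Longrightarrow> p \<in> U"
    and e': "e' > 0" "\<And>p. p \<in> Istar \<Longrightarrow> Plus (val a - e') < p \<Longrightarrow> p \<le> a \<Longrightarrow> p \<in> V"
    unfolding left_nhd_def by blast
  have le: "Plus (val a - e) \<le> Plus (val a - min e e')" "Plus (val a - e') \<le> Plus (val a - min e e')" by auto
  have "p \<in> U \<inter> V" if "p \<in> Istar" "Plus (val a - min e e') < p" "p \<le> a" for p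
    using e(2)[OF that(1) _ that(3)] e'(2)[OF that(1) _ that(3)] le_less_trans[OF le(1) that(2)]
      le_less_trans[OF le(2) that(2)] by blast
  moreover have "min e e' > 0" using e(1) e'(1) by simp
  ultimately show ?thesis unfolding left_nhd_def by blast
qed

lemma right_nhd_mono: "right_nhd x U \<Longrightarrow> U \<subseteq> V \<Longrightarrow> right_nhd x V"
  unfolding right_nhd_def by (meson subsetD)

lemma left_nhd_mono: "left_nhd a U \<Longrightarrow> U \<subseteq> V \<Longrightarrow> left_nhd a V"
  unfolding left_nhd_def by (meson subsetD)

lemma right_nhd_less:
  assumes "Plus x < a" shows "right_nhd x {p \<in> Istar. p < a}"
proof -
  have "x < val a" using assms by (cases a) auto
  hence "Plus (x + (val a - x) / 2) < a" by (cases a) (auto simp: field_simps)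
  hence "p < a" if "p < Plus (x + (val a - x) / 2)" for p using that by (rule less_trans[rotated])
  moreover have "(val a - x) / 2 > 0" using \<open>x < val a\<close> by simp
  ultimately show ?thesis unfolding right_nhd_def by blast
qed

lemma left_nhd_greater:
  assumes "val a < val b" shows "left_nhd b {p \<in> Istar. a < p}"
proof -
  have "a < Plus (val b - (val b - val a) / 2)" using assms by (cases a) (auto simp: field_simps)
  hence "a < p" if "Plus (val b - (val b - val a) / 2) < p" for p using that by (rule less_trans)
  moreover have "(val b - val a) / 2 > 0" using assms by simp
  ultimately show ?thesis unfolding left_nhd_def by blast
qed

text \<open>
  If \<open>x\<close> is a positive cut point, then \<open>Minus x\<close> and \<open>Plus x\<close> are neighbours in the order: the former
  is approached from the left and the latter from the right.  A point that has not been split is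
  approached from both sides.
\<close>

lemma openin_X_nhds:
  assumes "openin X U"
  shows "\<And>x. Plus x \<in> U \<Longrightarrow> right_nhd x U"
    "\<And>x. Plus x \<in> U \<Longrightarrow> x \<notin> D \<Longrightarrow> left_nhd (Plus x) U"
    "\<And>z. Minus z \<in> U \<Longrightarrow> left_nhd (Minus z) U"
proof -
  define good where "good U \<longleftrightarrow> (\<forall>x. Plus x \<in> U \<longrightarrow> right_nhd x U) \<and>
    (\<forall>x. Plus x \<in> U \<longrightarrow> x \<notin> D \<longrightarrow> left_nhd (Plus x) U) \<and> (\<forall>z. Minus z \<in> U \<longrightarrow> left_nhd (Minus z) U)" for U
  define rays where "rays = insert Istar ((\<lambda>a. {x \<in> Istar. x < a}) ` Istar \<union> (\<lambda>a. {x \<in> Istar. a < x}) ` Istar)"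
  have "generate_topology_on rays U"
    using assms unfolding I_star_top_def order_topology_on_def rays_def
    by (simp add: openin_topology_generated_by_iff)
  hence "good U"
  proof (induction rule: generate_topology_on.induct)
    case Empty show ?case by (simp add: good_def)
  next
    case (Int U V)
    thus ?case unfolding good_def using right_nhd_Int left_nhd_Int by (metis IntE)
  next
    case (UN K)
    show ?case unfolding good_def
    proof (intro conjI allI impI)
      fix x assume "Plus x \<in> \<Union> K"
      then obtain U where U: "U \<in> K" "Plus x \<in> U" by blast
      hence "right_nhd x U" using UN unfolding good_def by blast
      thus "right_nhd x (\<Union> K)" by (rule right_nhd_mono) (use U in blast)
    next
      fix x assume x: "Plus x \<in> \<Union> K" "x \<notin> D"
      then obtain U where U: "U \<in> K" "Plus x \<in> U" by blast
      hence "left_nhd (Plus x) U" using UN x(2) unfolding good_def by blast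
      thus "left_nhd (Plus x) (\<Union> K)" by (rule left_nhd_mono) (use U in blast)
    next
      fix z assume "Minus z \<in> \<Union> K"
      then obtain U where U: "U \<in> K" "Minus z \<in> U" by blast
      hence "left_nhd (Minus z) U" using UN unfolding good_def by blast
      thus "left_nhd (Minus z) (\<Union> K)" by (rule left_nhd_mono) (use U in blast)
    qed
  next
    case (Basis U)
    have down: "left_nhd a {p \<in> Istar. p < b}" if "a < b" for a b
      unfolding left_nhd_def using le_less_trans[OF _ that] by (intro exI[of _ 1]) auto
    have up: "right_nhd x {p \<in> Istar. b < p}" if "b < Plus x" for b x
      unfolding right_nhd_def using less_le_trans[OF that] by (intro exI[of _ 1]) auto
    have triv: "right_nhd x Istar" "left_nhd a Istar" for x a
      unfolding right_nhd_def left_nhd_def by (intro exI[of _ 1], simp)+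
    from Basis consider "U = Istar" | a where "a \<in> Istar" "U = {p \<in> Istar. p < a}"
      | a where "a \<in> Istar" "U = {p \<in> Istar. a < p}" unfolding rays_def by blast
    thus ?case
    proof cases
      case 1 thus ?thesis using triv by (simp add: good_def)
    next
      case 2 thus ?thesis using right_nhd_less down by (auto simp: good_def)
    next
      case (3 a)
      have "left_nhd (Plus x) U" if "Plus x \<in> U" "x \<notin> D" for x
      proof -
        have ax: "a < Plus x" "x \<in> unit_ivl" using that(1) 3 by auto
        have "val a < x"
        proof (cases a)
          case (Minus y)
          hence "y \<in> D \<or> y = 1" using 3(1) by (auto simp: Minus_in_Istar)
          hence "y \<noteq> x" using that(2) ax(2) by auto
          thus ?thesis using ax(1) Minus by auto
        qed (use ax in auto)
        thus ?thesis unfolding 3 by (intro left_nhd_greater) simp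
      qed
      moreover have "left_nhd (Minus z) U" if "Minus z \<in> U" for z
      proof -
        have "a < Minus z" using that 3 by auto
        hence "val a < z" by (cases a) auto
        thus ?thesis unfolding 3 by (intro left_nhd_greater) simp
      qed
      ultimately show ?thesis using up 3 by (auto simp: good_def)
    qed
  qed
  thus "\<And>x. Plus x \<in> U \<Longrightarrow> right_nhd x U" "\<And>x. Plus x \<in> U \<Longrightarrow> x \<notin> D \<Longrightarrow> left_nhd (Plus x) U"
    "\<And>z. Minus z \<in> U \<Longrightarrow> left_nhd (Minus z) U" unfolding good_def by blast+
qed

section \<open>The minimal set\<close>

abbreviation "Fs \<equiv> F_star q \<pi>"

lemma Fs_Plus [simp]: "Fs (Plus x) = Plus (F x)" by (simp add: F_star_def)

lemma Fs_Minus_x_hat [simp]: "Fs (Minus (x_hat q \<pi>)) = Plus 0" by (simp add: F_star_def)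

lemma Fs_Minus:
  assumes z: "0 < z" "z \<le> 1" "z \<noteq> x_hat q \<pi>"
    and e: "e > 0" "e \<le> w" "w \<le> 1" "\<And>y. y \<in> {z-e<..<z} \<Longrightarrow> F y = w - (z - y)"
  shows "Fs (Minus z) = (if w \<in> D \<union> {1} then Minus w else Plus w)"
proof -
  define l where "l = (if w \<in> D \<union> {1} then Minus w else Plus w)"
  have w0: "0 < w" using e by linarith
  have lI: "l \<in> Istar" using w0 e(3) by (auto simp: l_def Minus_in_Istar)
  have vl: "val l = w" by (simp add: l_def)
  have lim: "limitin X (\<lambda>y. Plus (F y)) l (at_left z)"
    unfolding limitin_def topspace_X
  proof (intro conjI lI allI impI)
    fix U assume U: "openin X U \<and> l \<in> U"
    hence "left_nhd l U" using openin_X_nhds(2,3)[of U] by (auto simp: l_def split: if_splits)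
    then obtain d where d: "d > 0" "\<And>p. p \<in> Istar \<Longrightarrow> Plus (w - d) < p \<Longrightarrow> p \<le> l \<Longrightarrow> p \<in> U"
      unfolding left_nhd_def vl by blast
    have "Plus (F y) \<in> U" if y: "y \<in> {z - min d e<..<z}" for y
    proof -
      have y': "z - d < y" "z - e < y" "y < z" using y by auto
      have Fy: "F y = w - (z - y)" using e(4) y' by simp
      hence "0 < F y" "F y < 1" "w - d < F y" "F y < w" using y' e w0 by auto
      thus ?thesis using d(2)[of "Plus (F y)"] by (auto simp: l_def)
    qed
    moreover have "z - min d e < z" using d(1) e(1) by simp
    ultimately show "eventually (\<lambda>y. Plus (F y) \<in> U) (at_left z)"
      by (intro eventually_at_leftI[of "z - min d e"]) auto
  qed
  have "(THE l. limitin X (\<lambda>y. Plus (F y)) l (at_left z)) = l"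
  proof (rule the_equality)
    show "limitin X (\<lambda>y. Plus (F y)) l (at_left z)" by (rule lim)
    fix l' assume "limitin X (\<lambda>y. Plus (F y)) l' (at_left z)"
    thus "l' = l" using limitin_Hausdorff_unique[OF _ lim _ Hausdorff_X] by simp
  qed
  thus ?thesis using z(3) by (simp add: F_star_def l_def)
qed

lemma I_per_star_openin: "openin X (I_per_star q \<pi>)"
  unfolding I_per_star_def
proof (intro openin_Union ballI, clarify)
  fix x y assume xy: "x \<in> D" "y \<in> D \<union> {1}" "{x..<y} \<subseteq> I_per q \<pi>"
  show "openin X ({Plus x..Minus y} \<inter> Istar)"
  proof (cases "x < y")
    case False
    hence "{Plus x..Minus y} \<inter> Istar = {}" by auto
    thus ?thesis by simp
  next
    case True
    have "x \<in> I_per q \<pi>" using xy(3) True by auto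
    moreover have "0 \<notin> I_per q \<pi>" using zero_np by (simp add: I_np_def)
    ultimately have "x \<noteq> 0" by auto
    hence Mx: "Minus x \<in> Istar" using xy(1) by (simp add: Minus_in_Istar)
    have gt: "Plus x \<le> p \<longleftrightarrow> Minus x < p" for p by (cases p) auto
    have le: "p \<le> Minus y \<longleftrightarrow> p < Plus y" for p by (cases p) auto
    have "openin X {p \<in> Istar. p < Plus y}"
    proof (cases "y = 1")
      case True
      have "{p \<in> Istar. p < Plus y} = Istar"
        using True Minus_range by (auto simp: I_star_def dest: subsetD[OF cut_points_unit])
      thus ?thesis using openin_topspace[of X] by simp
    next
      case False
      hence "Plus y \<in> Istar" using xy(2) cut_points_unit by auto
      thus ?thesis by (rule openin_less)
    qed
    moreover have "{Plus x..Minus y} \<inter> Istar = {p \<in> Istar. Minus x < p} \<inter> {p \<in> Istar. p < Plus y}"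
      using gt le by auto
    ultimately show ?thesis using openin_Int[OF openin_greater[OF Mx]] by (simp only:)
  qed
qed

lemma I_np_star_closedin: "closedin X (I_np_star q \<pi>)"
  unfolding I_np_star_def using I_per_star_openin closedin_diff[OF closedin_topspace] by force

lemma Plus_np_star: "Plus x \<in> I_np_star q \<pi> \<longleftrightarrow> x \<in> I_np q \<pi>"
proof
  assume x: "x \<in> I_np q \<pi>"
  have "Plus x \<notin> I_per_star q \<pi>"
  proof
    assume "Plus x \<in> I_per_star q \<pi>"
    then obtain a b where "{a..<b} \<subseteq> I_per q \<pi>" "a \<le> x" "x < b" by (auto simp: I_per_star_def)
    hence "x \<in> I_per q \<pi>" by auto
    thus False using x by (simp add: I_np_def)
  qed
  thus "Plus x \<in> I_np_star q \<pi>" using I_np_unit[OF x] by (simp add: I_np_star_def)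
next
  assume x: "Plus x \<in> I_np_star q \<pi>"
  hence xu: "x \<in> unit_ivl" by (simp add: I_np_star_def)
  have "x \<notin> I_per q \<pi>"
  proof
    assume "x \<in> I_per q \<pi>"
    then obtain k c where c: "c \<in> cyclic_cells k" "x \<in> cell q k c" by (rule I_per_in_cyclic_cell)
    obtain a b where ab: "a \<in> D" "b \<in> D \<union> {1}" "{a..<b} \<subseteq> I_per q \<pi>"
      "a \<le> real c / (real q * 2 ^ k)" "(real c + 1) / (real q * 2 ^ k) \<le> b"
      using cyclic_cell_in_periodic_interval[OF c(1)] .
    have "Plus x \<in> {Plus a..Minus b} \<inter> Istar" using ab(4,5) c(2) xu by (auto simp: cell_def)
    hence "Plus x \<in> I_per_star q \<pi>" unfolding I_per_star_def using ab(1-3) by blast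
    thus False using x by (simp add: I_np_star_def)
  qed
  thus "x \<in> I_np q \<pi>" using xu by (simp add: I_np_def)
qed

lemma Minus_np_star_not_cyclic:
  assumes z: "Minus z \<in> I_np_star q \<pi>"
    and c: "real c / (real q * 2 ^ k) < z" "z \<le> (real c + 1) / (real q * 2 ^ k)"
  shows "c \<notin> cyclic_cells k"
proof
  assume "c \<in> cyclic_cells k"
  then obtain a b where ab: "a \<in> D" "b \<in> D \<union> {1}" "{a..<b} \<subseteq> I_per q \<pi>"
    "a \<le> real c / (real q * 2 ^ k)" "(real c + 1) / (real q * 2 ^ k) \<le> b"
    by (rule cyclic_cell_in_periodic_interval)
  have "Minus z \<in> {Plus a..Minus b} \<inter> Istar" using ab(4,5) c z by (auto simp: I_np_star_def)
  hence "Minus z \<in> I_per_star q \<pi>" unfolding I_per_star_def using ab(1-3) by blast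
  thus False using z by (simp add: I_np_star_def)
qed

definition orbit_closure :: "split_real set" where
  "orbit_closure = X closure_of (range (\<lambda>t. Plus (orbit t)))"

lemma orbit_closure_subset_np: "orbit_closure \<subseteq> I_np_star q \<pi>"
  unfolding orbit_closure_def using Plus_np_star orbit_np I_np_star_closedin
  by (intro closure_of_minimal) auto

lemma orbit_closure_subset: "orbit_closure \<subseteq> Istar"
  using orbit_closure_subset_np by (auto simp: I_np_star_def)

lemma orbit_in_orbit_closure: "Plus (orbit t) \<in> orbit_closure"
proof -
  have "range (\<lambda>t. Plus (orbit t)) \<subseteq> topspace X" using orbit_unit by (auto simp: image_subset_iff)
  thus ?thesis unfolding orbit_closure_def using closure_of_subset by blast
qed

definition approached_right :: "real \<Rightarrow> bool" where
  "approached_right x \<longleftrightarrow> (\<forall>e>0. \<exists>t. orbit t \<in> {x..<x+e})"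

definition approached_left :: "real \<Rightarrow> bool" where
  "approached_left x \<longleftrightarrow> (\<forall>e>0. \<exists>t. orbit t \<in> {x-e<..<x})"

lemma closure_orbit_iff: "p \<in> orbit_closure \<longleftrightarrow> p \<in> Istar \<and> (\<forall>U. openin X U \<and> p \<in> U \<longrightarrow> (\<exists>t. Plus (orbit t) \<in> U))"
  unfolding orbit_closure_def in_closure_of by auto

lemma Plus_in_orbit_closure:
  assumes x: "x \<in> unit_ivl"
  shows "Plus x \<in> orbit_closure \<longleftrightarrow> approached_right x \<or> (x \<notin> D \<and> approached_left x)"
proof
  assume a: "approached_right x \<or> (x \<notin> D \<and> approached_left x)"
  have "\<exists>t. Plus (orbit t) \<in> U" if U: "openin X U" "Plus x \<in> U" for U
    using a
  proof
    assume r: "approached_right x"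
    obtain e where e: "e > 0" "\<And>p. p \<in> Istar \<Longrightarrow> Plus x \<le> p \<Longrightarrow> p < Plus (x + e) \<Longrightarrow> p \<in> U"
      using openin_X_nhds(1)[OF U] unfolding right_nhd_def by blast
    obtain t where "orbit t \<in> {x..<x+e}" using r e(1) unfolding approached_right_def by blast
    thus ?thesis using e(2)[of "Plus (orbit t)"] orbit_unit[of t] by auto
  next
    assume l: "x \<notin> D \<and> approached_left x"
    obtain e where e: "e > 0" "\<And>p. p \<in> Istar \<Longrightarrow> Plus (x - e) < p \<Longrightarrow> p \<le> Plus x \<Longrightarrow> p \<in> U"
      using openin_X_nhds(2)[OF U] l unfolding left_nhd_def by auto
    obtain t where "orbit t \<in> {x-e<..<x}" using l e(1) unfolding approached_left_def by blast
    thus ?thesis using e(2)[of "Plus (orbit t)"] orbit_unit[of t] by auto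
  qed
  thus "Plus x \<in> orbit_closure" unfolding closure_orbit_iff using x by auto
next
  assume O: "Plus x \<in> orbit_closure"
  hence hit: "\<exists>t. Plus (orbit t) \<in> U" if "openin X U" "Plus x \<in> U" for U
    using that unfolding closure_orbit_iff by blast
  show "approached_right x \<or> (x \<notin> D \<and> approached_left x)"
  proof (rule disjCI)
    assume no: "\<not> (x \<notin> D \<and> approached_left x)"
    show "approached_right x" unfolding approached_right_def
    proof (intro allI impI)
      fix e :: real assume e: "0 < e"
      define b where "b = x + min e (1 - x) / 2"
      have b: "x < b" "b < x + e" "b < 1" using e x by (auto simp: b_def min_def field_simps)
      hence bI: "Plus b \<in> Istar" using x by auto
      define V where "V = {p \<in> Istar. p < Plus b}"
      have V: "openin X V" "Plus x \<in> V" unfolding V_def using openin_less[OF bI] x b by auto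
      have "\<exists>U. openin X U \<and> Plus x \<in> U \<and> (\<forall>t. Plus (orbit t) \<in> U \<longrightarrow> x \<le> orbit t)"
      proof (cases "x = 0")
        case True
        thus ?thesis using V orbit_unit by auto
      next
        case x0: False
        show ?thesis
        proof (cases "x \<in> D")
          case True
          hence "Minus x \<in> Istar" using x0 by (simp add: Minus_in_Istar)
          hence "openin X {p \<in> Istar. Minus x < p}" by (rule openin_greater)
          thus ?thesis using x by (intro exI[of _ "{p \<in> Istar. Minus x < p}"]) auto
        next
          case False
          then obtain e' where e': "e' > 0" "\<And>t. orbit t \<notin> {x-e'<..<x}"
            using no unfolding approached_left_def by blast
          define a where "a = max (x - e') 0"
          have a: "0 \<le> a" "a < x" "x - e' \<le> a" using e'(1) x x0 by (auto simp: a_def)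
          hence "Plus a \<in> Istar" using x by auto
          hence "openin X {p \<in> Istar. Plus a < p}" by (rule openin_greater)
          moreover have "x \<le> orbit t" if "a < orbit t" for t using e'(2)[of t] a that by force
          ultimately show ?thesis using x a by (intro exI[of _ "{p \<in> Istar. Plus a < p}"]) auto
        qed
      qed
      then obtain U where U: "openin X U" "Plus x \<in> U" "\<And>t. Plus (orbit t) \<in> U \<Longrightarrow> x \<le> orbit t" by blast
      have "openin X (U \<inter> V)" using U(1) V(1) by (rule openin_Int)
      then obtain t where t: "Plus (orbit t) \<in> U \<inter> V" using hit[of "U \<inter> V"] U(2) V(2) by blast
      hence "orbit t \<in> {x..<x+e}" using U(3)[of t] b by (auto simp: V_def)
      thus "\<exists>t. orbit t \<in> {x..<x+e}" by blast
    qed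
  qed
qed

lemma Minus_in_orbit_closure:
  assumes z: "Minus z \<in> Istar"
  shows "Minus z \<in> orbit_closure \<longleftrightarrow> approached_left z"
proof
  assume l: "approached_left z"
  have "\<exists>t. Plus (orbit t) \<in> U" if U: "openin X U" "Minus z \<in> U" for U
  proof -
    obtain e where e: "e > 0" "\<And>p. p \<in> Istar \<Longrightarrow> Plus (z - e) < p \<Longrightarrow> p \<le> Minus z \<Longrightarrow> p \<in> U"
      using openin_X_nhds(3)[OF U] unfolding left_nhd_def by auto
    obtain t where "orbit t \<in> {z-e<..<z}" using l e(1) unfolding approached_left_def by blast
    thus ?thesis using e(2)[of "Plus (orbit t)"] orbit_unit[of t] by auto
  qed
  thus "Minus z \<in> orbit_closure" unfolding closure_orbit_iff using z by auto
next
  assume O: "Minus z \<in> orbit_closure"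
  have z01: "0 < z" "z \<le> 1" using Minus_range[OF z] by auto
  show "approached_left z" unfolding approached_left_def
  proof (intro allI impI)
    fix e :: real assume e: "0 < e"
    define a where "a = max (z - e) 0"
    have a: "0 \<le> a" "a < z" "z - e \<le> a" using e z01 by (auto simp: a_def)
    hence aI: "Plus a \<in> Istar" using z01 by auto
    define V where "V = {p \<in> Istar. Plus a < p}"
    have V: "openin X V" "Minus z \<in> V" unfolding V_def using openin_greater[OF aI] z a by auto
    have "\<exists>U. openin X U \<and> Minus z \<in> U \<and> (\<forall>t. Plus (orbit t) \<in> U \<longrightarrow> orbit t < z)"
    proof (cases "z = 1")
      case True
      thus ?thesis using V orbit_unit by (intro exI[of _ V]) auto
    next
      case False
      hence "Plus z \<in> Istar" using z01 by auto
      hence "openin X {p \<in> Istar. p < Plus z}" by (rule openin_less)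
      thus ?thesis using z by (intro exI[of _ "{p \<in> Istar. p < Plus z}"]) auto
    qed
    then obtain U where U: "openin X U" "Minus z \<in> U" "\<And>t. Plus (orbit t) \<in> U \<Longrightarrow> orbit t < z" by blast
    have "openin X (U \<inter> V)" using U(1) V(1) by (rule openin_Int)
    then obtain t where t: "Plus (orbit t) \<in> U \<inter> V" using O U(2) V(2) unfolding closure_orbit_iff by blast
    hence "orbit t \<in> {z-e<..<z}" using U(3)[of t] a by (auto simp: V_def)
    thus "\<exists>t. orbit t \<in> {z-e<..<z}" by blast
  qed
qed

lemma orbit_Suc: "orbit (Suc t) = F (orbit t)" by (simp add: orbit_def)

text \<open>
  If a point \<open>z\<close> is approached from the left by the orbit of \<open>0\<close>, then so is the left limit \<open>w\<close> of
  the map at \<open>z\<close>.  The point of the closure that represents this approach is \<open>Minus w\<close> or, if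
  \<open>w\<close> has not been split, \<open>Plus w\<close>.
\<close>

lemma left_limit_in_orbit_closure:
  assumes e: "e > 0" "e \<le> w" "w \<le> 1" "\<And>y. y \<in> {z-e<..<z} \<Longrightarrow> F y = w - (z - y)"
    and z: "approached_left z"
  shows "(if w \<in> D \<union> {1} then Minus w else Plus w) \<in> orbit_closure"
proof -
  have "approached_left w" unfolding approached_left_def
  proof (intro allI impI)
    fix d :: real assume "0 < d"
    hence "min d e > 0" using e(1) by simp
    then obtain t where t: "orbit t \<in> {z - min d e<..<z}" using z unfolding approached_left_def by blast
    hence t': "z - d < orbit t" "z - e < orbit t" "orbit t < z" by auto
    have "orbit (Suc t) = w - (z - orbit t)" unfolding orbit_Suc using t' by (intro e(4)) simp
    hence "orbit (Suc t) \<in> {w-d<..<w}" using t' by auto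
    thus "\<exists>t. orbit t \<in> {w-d<..<w}" by blast
  qed
  moreover have "0 < w" using e by linarith
  ultimately show ?thesis using e(3) Minus_in_orbit_closure[of w] Plus_in_orbit_closure[of w] by (auto simp: Minus_in_Istar)
qed

lemma zero_in_orbit_closure: "Plus 0 \<in> orbit_closure" using orbit_in_orbit_closure[of 0] by (simp add: orbit_def)

lemma Fs_orbit_closure: "Fs ` orbit_closure \<subseteq> orbit_closure"
proof clarify
  fix p assume p: "p \<in> orbit_closure"
  show "Fs p \<in> orbit_closure"
  proof (cases p)
    case (Plus x)
    have x: "x \<in> unit_ivl" using p Plus orbit_closure_subset by auto
    have Fx: "F x \<in> unit_ivl" using F_unit[OF x] .
    from p have "approached_right x \<or> (x \<notin> D \<and> approached_left x)" unfolding Plus Plus_in_orbit_closure[OF x] .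
    thus ?thesis
    proof
      assume r: "approached_right x"
      obtain e where e: "e > 0" "\<And>y. y \<in> {x..<x+e} \<Longrightarrow> F y = F x + (y - x)"
        using right_translation[OF x] by blast
      have "approached_right (F x)" unfolding approached_right_def
      proof (intro allI impI)
        fix d :: real assume "0 < d"
        hence "min d e > 0" using e(1) by simp
        then obtain t where t: "orbit t \<in> {x..<x + min d e}" using r unfolding approached_right_def by blast
        hence t': "x \<le> orbit t" "orbit t < x + d" "orbit t < x + e" by auto
        have "orbit (Suc t) = F x + (orbit t - x)" unfolding orbit_Suc using t' by (intro e(2)) simp
        hence "orbit (Suc t) \<in> {F x..<F x + d}" using t' by auto
        thus "\<exists>t. orbit t \<in> {F x..<F x + d}" by blast
      qed
      thus ?thesis using Plus_in_orbit_closure[OF Fx] Plus by simp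
    next
      assume l: "x \<notin> D \<and> approached_left x"
      have x0: "x \<noteq> 0" using l zero_cut_point by auto
      have "D0 q \<pi> \<subseteq> D" unfolding cut_points_def by (auto intro!: exI[of _ 0])
      hence "x \<notin> D0 q \<pi>" using l by blast
      hence "continuous (at x within unit_ivl) F" using x by (auto simp: D0_def)
      moreover have "x \<in> {0<..<1}" using x x0 by auto
      ultimately obtain e where e: "e > 0" "\<And>y. \<bar>y - x\<bar> < e \<Longrightarrow> F y = F x + (y - x)"
        using continuous_imp_translation by blast
      have FD: "F x \<notin> D"
      proof
        assume "F x \<in> D"
        then consider s n where "s \<in> D0 q \<pi>" "F x = (F ^^ n) s" | s n where "s \<in> D0 q \<pi> - {0}" "(F ^^ n) (F x) = s"
          by (auto simp: cut_points_def)
        thus False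
        proof cases
          case (1 s n)
          have su: "s \<in> unit_ivl" using 1 D0_unit by blast
          show False
          proof (cases n)
            case 0
            have "F x \<noteq> 0" using F_range[OF x] by simp
            hence "x \<in> D" unfolding cut_points_def using 0 1 x by (auto intro!: exI[of _ 1])
            thus False using l by simp
          next
            case (Suc m)
            hence "F x = F ((F ^^ m) s)" using 1 by simp
            hence "x = (F ^^ m) s" using inj_onD[OF F_inj _ x funpow_unit[OF su]] by blast
            hence "x \<in> D" unfolding cut_points_def using 1 by blast
            thus False using l by simp
          qed
        next
          case (2 s n)
          hence "(F ^^ Suc n) x = s" by (simp add: funpow_swap1)
          hence "x \<in> D" unfolding cut_points_def using 2 x by blast
          thus False using l by simp
        qed
      qed
      define e' where "e' = min e (F x)"
      have e': "e' > 0" "e' \<le> e" "e' \<le> F x" using e(1) F_range[OF x] by (auto simp: e'_def)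
      have "F y = F x - (x - y)" if "y \<in> {x-e'<..<x}" for y using e(2)[of y] that e' by auto
      moreover have "F x \<le> 1" using Fx by simp
      ultimately have "(if F x \<in> D \<union> {1} then Minus (F x) else Plus (F x)) \<in> orbit_closure"
        using e' l by (intro left_limit_in_orbit_closure[of e' "F x" x]) auto
      thus ?thesis using FD Fx Plus by auto
    qed
  next
    case (Minus z)
    have zI: "Minus z \<in> Istar" using p Minus orbit_closure_subset by auto
    have z: "0 < z" "z \<le> 1" using Minus_range[OF zI] by auto
    have l: "approached_left z" using p Minus_in_orbit_closure[OF zI] Minus by simp
    show ?thesis
    proof (cases "z = x_hat q \<pi>")
      case True
      thus ?thesis using Minus zero_in_orbit_closure by simp
    next
      case False
      then obtain e w where e: "e > 0" "e \<le> w" "w \<le> 1" "\<And>y. y \<in> {z-e<..<z} \<Longrightarrow> F y = w - (z - y)"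
        using left_behaviour[OF z] by blast
      have eq: "Fs (Minus z) = (if w \<in> D \<union> {1} then Minus w else Plus w)"
        by (rule Fs_Minus[OF z False e])
      show ?thesis unfolding Minus eq by (rule left_limit_in_orbit_closure[OF e l])
    qed
  qed
qed

text \<open>
  A point outside the periodic intervals has no periodic cell on its side, so its orbit has to enter
  every block \<open>[0, 2\<^sup>-\<^sup>k)\<close>; in the split interval this means that it accumulates at \<open>Plus 0\<close>.
\<close>

lemma zero_in_closed_invariant:
  assumes cl: "closedin X N" and sub: "N \<subseteq> I_np_star q \<pi>" and ne: "N \<noteq> {}" and inv: "Fs ` N \<subseteq> N"
  shows "Plus 0 \<in> N"
proof (rule ccontr)
  assume no: "Plus 0 \<notin> N"
  have "openin X (Istar - N)" using cl by (simp add: closedin_def)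
  moreover have "Plus 0 \<in> Istar - N" using no by simp
  ultimately have "right_nhd 0 (Istar - N)" by (rule openin_X_nhds(1))
  then obtain e where e: "e > 0" "\<And>p. p \<in> Istar \<Longrightarrow> Plus 0 \<le> p \<Longrightarrow> p < Plus (0 + e) \<Longrightarrow> p \<in> Istar - N"
    unfolding right_nhd_def by blast
  have NI: "N \<subseteq> Istar" using sub by (auto simp: I_np_star_def)
  obtain k where k: "(1::real) / 2 ^ k \<le> e" using block_small e(1) by blast
  have noPlus: "Plus x \<notin> N" for x
  proof
    assume xN: "Plus x \<in> N"
    hence "x \<in> I_np q \<pi>" using sub Plus_np_star by blast
    then obtain t where t: "(F ^^ t) x < 1 / 2 ^ k" using np_enters_block by blast
    have orb: "Plus ((F ^^ s) x) \<in> N" for s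
    proof (induction s)
      case (Suc s)
      hence "Fs (Plus ((F ^^ s) x)) \<in> N" using inv by blast
      thus ?case by simp
    qed (use xN in simp)
    have "(F ^^ t) x \<in> unit_ivl" using orb[of t] NI by auto
    thus False using e(2)[of "Plus ((F ^^ t) x)"] orb[of t] t k by auto
  qed
  have big: "1 / 2 ^ k < w" if "Minus w \<in> N" for w
  proof (rule ccontr)
    assume "\<not> 1 / 2 ^ k < w"
    hence "w \<le> e" using k by linarith
    thus False using e(2)[of "Minus w"] that NI Minus_range[of w] by auto
  qed
  obtain p where "p \<in> N" using ne by blast
  then obtain z0 where z0: "Minus z0 \<in> N" using noPlus by (cases p) auto
  define Q where "Q = real q * 2 ^ k"
  have Q: "Q > 0" using q_pos by (simp add: Q_def)
  \<comment> \<open>The cell of level \<open>k\<close> on the left side of \<open>z\<close>; its right end point is included.\<close>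
  define left_cell where "left_cell z c \<longleftrightarrow> Minus z \<in> N \<and> c < q * 2 ^ k \<and> real c / Q < z \<and> z \<le> (real c + 1) / Q" for z c
  have step: "q \<le> P k c \<and> left_cell (z + (real (P k c) - real c) / Q) (P k c)" if a: "left_cell z c" for z c
  proof -
    have zN: "Minus z \<in> N" and c: "c < q * 2 ^ k" "real c / Q < z" "z \<le> (real c + 1) / Q"
      using a by (auto simp: left_cell_def)
    have z: "0 < z" "z \<le> 1" using Minus_range zN NI by auto
    have "z \<noteq> x_hat q \<pi>" using inv zN noPlus by (metis Fs_Minus_x_hat image_subset_iff)
    then obtain d w where d: "d > 0" "d \<le> w" "w \<le> 1" "\<And>y. y \<in> {z-d<..<z} \<Longrightarrow> F y = w - (z - y)"
      using left_behaviour[OF z] by blast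
    have "Fs (Minus z) = (if w \<in> D \<union> {1} then Minus w else Plus w)"
      by (rule Fs_Minus[OF z \<open>z \<noteq> x_hat q \<pi>\<close> d])
    moreover have "Fs (Minus z) \<in> N" using inv zN by blast
    ultimately have wN: "Minus w \<in> N" using noPlus[of w] by (auto split: if_splits)
    define m where "m = min d (min (z - real c / Q) (w - 1 / 2 ^ k))"
    have m: "m > 0" "m \<le> d" "m \<le> z - real c / Q" "m \<le> w - 1 / 2 ^ k"
      using d(1) c(2) big[OF wN] by (auto simp: m_def)
    \<comment> \<open>A point so close to \<open>z\<close> that it lies in the same cell and its image is outside the block.\<close>
    define y where "y = z - m / 2"
    have y: "z - d < y" "y < z" "real c / Q < y" "z - y < w - 1 / 2 ^ k"
      using m unfolding y_def by linarith+
    have yc: "y \<in> cell q k c" using y c by (auto simp: cell_def Q_def)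
    have Fy: "F y = w - (z - y)" using d(4) y by simp
    hence "\<not> F y < 1 / 2 ^ k" using y(4) by simp
    hence qP: "q \<le> P k c" using F_in_block_iff[OF yc c(1)] by simp
    have "F y = y + (real (P k c) - real c) / Q" unfolding Q_def using F_translation[OF yc c(1) qP] .
    hence w: "w = z + (real (P k c) - real c) / Q" using Fy by simp
    have "real (P k c) / Q < w" "w \<le> (real (P k c) + 1) / Q"
      using c unfolding w by (auto simp: diff_divide_distrib add_divide_distrib)
    thus ?thesis using qP wN P_less[OF c(1)] w by (simp add: left_cell_def)
  qed
  obtain c0 where c0: "left_cell z0 c0"
  proof -
    define c where "c = nat (\<lceil>Q * z0\<rceil> - 1)"
    have z: "0 < z0" "z0 \<le> 1" using Minus_range z0 NI by auto
    have "0 < Q * z0" using Q z by simp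
    hence "int c = \<lceil>Q * z0\<rceil> - 1" unfolding c_def by simp
    hence c: "real c < Q * z0" "Q * z0 \<le> real c + 1" by linarith+
    have "Q * z0 \<le> Q * 1" using Q z by (intro mult_left_mono) auto
    hence "real c < real (q * 2 ^ k)" using c by (simp add: Q_def)
    hence "c < q * 2 ^ k" by (simp only: of_nat_less_iff)
    thus ?thesis using that[of c] z0 c Q by (auto simp: left_cell_def field_simps)
  qed
  have "\<exists>z. left_cell z ((P k ^^ s) c0)" for s
  proof (induction s)
    case (Suc s) thus ?case using step by auto
  qed (use c0 in auto)
  hence ge: "q \<le> (P k ^^ Suc s) c0" for s using step by fastforce
  have "q \<le> (P k ^^ s) c0" for s
  proof -
    obtain n where n: "n \<ge> 1" "(P k ^^ n) c0 = c0" using P_recurrent c0 by (auto simp: left_cell_def)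
    show ?thesis using ge[of "s - 1"] ge[of "n - 1"] n by (cases s) auto
  qed
  hence "c0 \<in> cyclic_cells k" using c0 by (simp add: cyclic_cells_def left_cell_def)
  moreover have "Minus z0 \<in> I_np_star q \<pi>" using z0 sub by blast
  ultimately show False using Minus_np_star_not_cyclic[of z0 c0 k] c0 unfolding left_cell_def Q_def by blast
qed

lemma orbit_closure_least:
  assumes "closedin X N" "N \<subseteq> I_np_star q \<pi>" "N \<noteq> {}" "Fs ` N \<subseteq> N"
  shows "orbit_closure \<subseteq> N"
proof -
  have "Plus (orbit t) \<in> N" for t
  proof (induction t)
    case 0 show ?case using zero_in_closed_invariant[OF assms] by (simp add: orbit_def)
  next
    case (Suc t)
    hence "Fs (Plus (orbit t)) \<in> N" using assms(4) by blast
    thus ?case by (simp add: orbit_Suc)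
  qed
  thus ?thesis unfolding orbit_closure_def using assms(1) by (intro closure_of_minimal) auto
qed

lemma minimal_set_iff: "minimal_set (I_np_star_top q \<pi>) Fs M \<longleftrightarrow> M = orbit_closure"
proof -
  have np: "I_np_star q \<pi> \<subseteq> Istar" by (auto simp: I_np_star_def)
  have closed: "closedin (I_np_star_top q \<pi>) N \<longleftrightarrow> closedin X N \<and> N \<subseteq> I_np_star q \<pi>" for N
    unfolding I_np_star_top_def using closedin_closed_subtopology[OF I_np_star_closedin] by blast
  have inv: "closed_invariant (I_np_star_top q \<pi>) Fs N \<longleftrightarrow>
      N \<noteq> {} \<and> closedin X N \<and> N \<subseteq> I_np_star q \<pi> \<and> Fs ` N \<subseteq> N" for N
    unfolding closed_invariant_def closed by blast
  have "closedin X orbit_closure" unfolding orbit_closure_def by (rule closedin_closure_of)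
  hence O: "closed_invariant (I_np_star_top q \<pi>) Fs orbit_closure"
    unfolding inv using zero_in_orbit_closure orbit_closure_subset_np Fs_orbit_closure by blast
  have least: "orbit_closure \<subseteq> N" if "closed_invariant (I_np_star_top q \<pi>) Fs N" for N
    using that orbit_closure_least unfolding inv by blast
  show ?thesis unfolding minimal_set_def using O least by (metis psubsetE psubsetI subset_antisym)
qed

lemma I_min_star_eq: "I_min_star q \<pi> = orbit_closure"
  unfolding I_min_star_def minimal_set_iff by simp

end

section \<open>Measures on the minimal set\<close>

text \<open>The preimages of a point without period are disjoint and have equal mass.\<close>

lemma invariant_measure_atom_zero:
  assumes M: "M \<in> invariant_measures X T" and p: "{p} \<in> sets M"
    and aper: "\<And>n. n \<ge> 1 \<Longrightarrow> (T ^^ n) p \<noteq> p"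
  shows "measure M {p} = 0"
proof (rule ccontr)
  assume "measure M {p} \<noteq> 0"
  hence pos: "measure M {p} > 0" by (simp add: zero_less_measure_iff)
  interpret prob_space M using invariant_measuresD(1)[OF M] .
  define A where "A n = (T ^^ n) -` {p} \<inter> space M" for n
  have A: "A n \<in> sets M" "measure M (A n) = measure M {p}" for n
    using invariant_measure_funpow[OF M p] by (auto simp: A_def)
  have disj: "A m \<inter> A n = {}" if mn: "m < n" for m n
  proof (rule ccontr)
    assume "A m \<inter> A n \<noteq> {}"
    then obtain x where x: "(T ^^ m) x = p" "(T ^^ n) x = p" by (auto simp: A_def)
    have "n = (n - m) + m" using mn by simp
    hence "(T ^^ n) x = (T ^^ (n - m)) ((T ^^ m) x)" by (metis comp_apply funpow_add)
    hence "(T ^^ (n - m)) p = p" using x by simp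
    moreover have "n - m \<ge> 1" using mn by simp
    ultimately show False using aper by blast
  qed
  obtain n where n: "1 < real n * measure M {p}" using pos reals_Archimedean3 by blast
  have "disjoint_family_on A {..<n}"
    unfolding disjoint_family_on_def using disj by (metis Int_commute linorder_neqE_nat)
  hence "measure M (\<Union>i<n. A i) = (\<Sum>i<n. measure M (A i))"
    using A(1) by (intro finite_measure_finite_Union) auto
  also have "\<dots> = real n * measure M {p}" by (simp add: A(2))
  finally show False using n prob_le_1[of "\<Union>i<n. A i"] by simp
qed

context rotated_odometer
begin

abbreviation "Y \<equiv> subtopology X orbit_closure"

lemma topspace_Y: "topspace Y = orbit_closure"
  by (simp only: topspace_subtopology topspace_X Int_absorb1[OF orbit_closure_subset])

lemma space_borel_Y [simp]: "space (borel_of Y) = orbit_closure"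
  unfolding borel_of_def topspace_Y by (simp add: space_measure_of_conv)

lemma sets_borel_Y: "sets (borel_of Y) = sigma_sets orbit_closure {U. openin Y U}"
  unfolding borel_of_def topspace_Y by (rule sets_measure_of) (use openin_subset[of Y] topspace_Y in blast)

lemma open_in_borel_Y: "openin X U \<Longrightarrow> U \<inter> orbit_closure \<in> sets (borel_of Y)"
  unfolding sets_borel_Y by (intro sigma_sets.Basic) (auto simp: openin_subtopology)

text \<open>
  Away from the countably many cut points the topology at \<open>Plus x\<close> is that of the real line, so
  the trace of an open set on the line is open up to a countable set.
\<close>

lemma Plus_preimage_open_borel:
  assumes U: "openin X U" shows "{x. Plus x \<in> U} \<in> sets borel"
proof -
  define V where "V = {x. Plus x \<in> U}"
  have sub: "U \<subseteq> Istar" using openin_subset[OF U] by simp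
  have "x \<in> interior V" if x: "x \<in> V" "x \<notin> D" for x
  proof -
    have PU: "Plus x \<in> U" using x by (simp add: V_def)
    have xu: "x \<in> unit_ivl" using PU sub by auto
    have x0: "x \<noteq> 0" using x(2) zero_cut_point by auto
    obtain e where e: "e > 0" "\<And>p. p \<in> Istar \<Longrightarrow> Plus x \<le> p \<Longrightarrow> p < Plus (x + e) \<Longrightarrow> p \<in> U"
      using openin_X_nhds(1)[OF U PU] unfolding right_nhd_def by blast
    obtain e' where e': "e' > 0" "\<And>p. p \<in> Istar \<Longrightarrow> Plus (x - e') < p \<Longrightarrow> p \<le> Plus x \<Longrightarrow> p \<in> U"
      using openin_X_nhds(2)[OF U PU x(2)] unfolding left_nhd_def by auto
    define d where "d = min (min e e') (min x (1 - x))"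
    have d: "d > 0" "d \<le> e" "d \<le> e'" "d \<le> x" "d \<le> 1 - x" using e(1) e'(1) xu x0 by (auto simp: d_def)
    have "{x-d<..<x+d} \<subseteq> V"
    proof
      fix y assume y: "y \<in> {x-d<..<x+d}"
      have "Plus y \<in> Istar" using y d by auto
      thus "y \<in> V" using e(2)[of "Plus y"] e'(2)[of "Plus y"] y d by (cases "x \<le> y") (auto simp: V_def)
    qed
    thus ?thesis using d(1) by (intro interiorI[of "{x-d<..<x+d}"]) auto
  qed
  hence "V = interior V \<union> (V \<inter> D)" using interior_subset[of V] by blast
  moreover have "V \<inter> D \<in> sets borel"
  proof (rule sets.countable)
    show "countable (V \<inter> D)" using cut_points_countable by (rule countable_Int2)
  qed simp
  ultimately have "V \<in> sets borel" using open_interior[of V] by (metis borel_open sets.Un)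
  thus ?thesis by (simp add: V_def)
qed

lemma orbit_closure_trace_borel: "{x. Plus x \<in> orbit_closure} \<in> sets borel"
proof -
  have "openin X (Istar - orbit_closure)" unfolding orbit_closure_def using closedin_closure_of[of X] by (simp add: closedin_def)
  hence "{x. Plus x \<in> Istar - orbit_closure} \<in> sets borel" by (rule Plus_preimage_open_borel)
  moreover have "{x. Plus x \<in> orbit_closure} = unit_ivl - {x. Plus x \<in> Istar - orbit_closure}" using orbit_closure_subset by auto
  ultimately show ?thesis by simp
qed

definition Minuses :: "split_real set" where "Minuses = {p \<in> orbit_closure. \<exists>z. p = Minus z}"

lemma Minuses_countable: "countable Minuses"
proof (rule countable_subset)
  show "Minuses \<subseteq> Minus ` (D \<union> {1})"
  proof
    fix p assume "p \<in> Minuses"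
    then obtain z where z: "p = Minus z" "Minus z \<in> Istar"
      using orbit_closure_subset by (auto simp: Minuses_def)
    hence "z \<in> D \<union> {1}" by (auto simp: Minus_in_Istar)
    thus "p \<in> Minus ` (D \<union> {1})" using z(1) by blast
  qed
  show "countable (Minus ` (D \<union> {1}))" using cut_points_countable by simp
qed

lemma finite_closedin_X: "finite S \<Longrightarrow> S \<subseteq> Istar \<Longrightarrow> closedin X S"
  using Hausdorff_imp_t1_space[OF Hausdorff_X] by (simp add: t1_space_closedin_finite)

lemma singleton_borel_Y: assumes "p \<in> orbit_closure" shows "{p} \<in> sets (borel_of Y)"
proof -
  have "closedin X {p}" using assms orbit_closure_subset by (intro finite_closedin_X) auto
  hence "(Istar - {p}) \<inter> orbit_closure \<in> sets (borel_of Y)" by (intro open_in_borel_Y) (simp add: closedin_def)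
  hence "space (borel_of Y) - (Istar - {p}) \<inter> orbit_closure \<in> sets (borel_of Y)" by (rule sets.compl_sets)
  moreover have "space (borel_of Y) - (Istar - {p}) \<inter> orbit_closure = {p}" using assms orbit_closure_subset by auto
  ultimately show ?thesis by simp
qed

lemma countable_borel_Y:
  assumes "countable S" "S \<subseteq> orbit_closure" shows "S \<in> sets (borel_of Y)"
proof (rule sets.countable)
  show "{p} \<in> sets (borel_of Y)" if "p \<in> S" for p
    using that assms(2) by (intro singleton_borel_Y) auto
qed (rule assms(1))

lemma val_measurable: "val \<in> borel_measurable (borel_of Y)"
  unfolding borel_measurable_iff_le
proof
  fix a :: real
  have v: "0 \<le> val p \<and> val p \<le> 1" if "p \<in> orbit_closure" for p
    using that orbit_closure_subset Minus_range by (cases p) (force simp: subset_iff)+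
  consider "a < 0" | "a \<ge> 1" | "a \<in> unit_ivl" by fastforce
  thus "{w \<in> space (borel_of Y). val w \<le> a} \<in> sets (borel_of Y)"
  proof cases
    case 1
    hence "{w \<in> space (borel_of Y). val w \<le> a} = {}" using v by force
    thus ?thesis by (simp only: sets.empty_sets)
  next
    case 2
    hence "{w \<in> space (borel_of Y). val w \<le> a} = space (borel_of Y)" using v by force
    thus ?thesis by (simp only: sets.top)
  next
    case 3
    have gt: "Plus a < p \<longleftrightarrow> a < val p" for p by (cases p) auto
    have "openin X {p \<in> Istar. Plus a < p}" using 3 by (intro openin_greater) simp
    hence "{p \<in> Istar. Plus a < p} \<inter> orbit_closure \<in> sets (borel_of Y)" by (rule open_in_borel_Y)
    hence "space (borel_of Y) - {p \<in> Istar. Plus a < p} \<inter> orbit_closure \<in> sets (borel_of Y)" by (rule sets.compl_sets)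
    moreover have "space (borel_of Y) - {p \<in> Istar. Plus a < p} \<inter> orbit_closure = {w \<in> space (borel_of Y). val w \<le> a}"
      using orbit_closure_subset by (auto simp: gt)
    ultimately show ?thesis by simp
  qed
qed

lemma sets_borel_Y_iff: "A \<in> sets (borel_of Y) \<longleftrightarrow> A \<subseteq> orbit_closure \<and> {x. Plus x \<in> A} \<in> sets borel"
proof
  assume A: "A \<in> sets (borel_of Y)"
  have "{x. Plus x \<in> A} \<in> sets borel"
    using A unfolding sets_borel_Y
  proof (induction rule: sigma_sets.induct)
    case (Basic A)
    then obtain U where U: "openin X U" "A = U \<inter> orbit_closure" by (auto simp: openin_subtopology)
    have "{x. Plus x \<in> A} = {x. Plus x \<in> U} \<inter> {x. Plus x \<in> orbit_closure}" using U by auto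
    thus ?case using Plus_preimage_open_borel[OF U(1)] orbit_closure_trace_borel by auto
  next
    case Empty show ?case by simp
  next
    case (Compl A)
    have "{x. Plus x \<in> orbit_closure - A} = {x. Plus x \<in> orbit_closure} - {x. Plus x \<in> A}" by auto
    thus ?case using Compl orbit_closure_trace_borel by auto
  next
    case (Union A)
    have "{x. Plus x \<in> (\<Union>i. A i)} = (\<Union>i. {x. Plus x \<in> A i})" by auto
    thus ?case using Union by auto
  qed
  thus "A \<subseteq> orbit_closure \<and> {x. Plus x \<in> A} \<in> sets borel" using sets.sets_into_space[OF A] by simp
next
  assume A: "A \<subseteq> orbit_closure \<and> {x. Plus x \<in> A} \<in> sets borel"
  define S where "S = {x. Plus x \<in> A}"
  have "val -` S \<inter> space (borel_of Y) \<in> sets (borel_of Y)"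
    using A by (intro measurable_sets[OF val_measurable]) (simp add: S_def)
  moreover have "Minuses \<in> sets (borel_of Y)"
    by (intro countable_borel_Y Minuses_countable) (simp add: Minuses_def)
  moreover have "A \<inter> Minuses \<in> sets (borel_of Y)"
    using A by (intro countable_borel_Y countable_Int2 Minuses_countable) blast
  ultimately have "(val -` S \<inter> space (borel_of Y) - Minuses) \<union> (A \<inter> Minuses) \<in> sets (borel_of Y)" by auto
  moreover have "(val -` S \<inter> space (borel_of Y) - Minuses) \<union> (A \<inter> Minuses) = A"
  proof (rule set_eqI)
    fix p show "p \<in> (val -` S \<inter> space (borel_of Y) - Minuses) \<union> (A \<inter> Minuses) \<longleftrightarrow> p \<in> A"
      using A by (cases p) (auto simp: S_def Minuses_def)
  qed
  ultimately show "A \<in> sets (borel_of Y)" by simp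
qed

abbreviation "Y_measures \<equiv> invariant_measures Y Fs"

lemma funpow_Fs_Plus: "(Fs ^^ n) (Plus x) = Plus ((F ^^ n) x)"
  by (induction n) auto

lemma funpow_Fs_orbit_closure: "p \<in> orbit_closure \<Longrightarrow> (Fs ^^ n) p \<in> orbit_closure"
  by (induction n) (use Fs_orbit_closure in auto)

text \<open>A periodic orbit would be a closed invariant set and contain \<open>Plus 0\<close>.\<close>

lemma orbit_closure_aperiodic:
  assumes p: "p \<in> orbit_closure" and n: "n \<ge> 1" shows "(Fs ^^ n) p \<noteq> p"
proof
  assume per: "(Fs ^^ n) p = p"
  define N where "N = (\<lambda>t. (Fs ^^ t) p) ` {..<n}"
  have NO: "N \<subseteq> orbit_closure" using funpow_Fs_orbit_closure[OF p] by (auto simp: N_def)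
  have "Fs ` N \<subseteq> N"
  proof clarify
    fix r assume "r \<in> N"
    then obtain t where t: "t < n" "r = (Fs ^^ t) p" by (auto simp: N_def)
    have "Fs r = (Fs ^^ (Suc t mod n)) p" using funpow_mod_eq[OF per, of "Suc t"] t by simp
    thus "Fs r \<in> N" using n by (auto simp: N_def)
  qed
  moreover have "closedin X N" using NO orbit_closure_subset by (intro finite_closedin_X) (auto simp: N_def)
  moreover have "N \<noteq> {}" using n by (auto simp: N_def lessThan_empty_iff)
  ultimately have "Plus 0 \<in> N" using zero_in_closed_invariant NO orbit_closure_subset_np by blast
  then obtain t where t: "Plus 0 = (Fs ^^ t) p" by (auto simp: N_def)
  have "(Fs ^^ n) (Plus 0) = (Fs ^^ t) ((Fs ^^ n) p)" unfolding t by (metis add.commute comp_apply funpow_add)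
  hence "Plus ((F ^^ n) 0) = Plus 0" unfolding per t[symmetric] funpow_Fs_Plus .
  thus False using zero_not_periodic[OF n] by simp
qed

lemma Y_measureD:
  assumes "M \<in> Y_measures"
  shows "prob_space M" "sets M = sets (borel_of Y)" "space M = orbit_closure"
  using invariant_measuresD(1,2)[OF assms] sets_eq_imp_space_eq[OF invariant_measuresD(2)[OF assms]] by auto

lemma Y_measure_countable_null:
  assumes M: "M \<in> Y_measures" and S: "countable S" "S \<subseteq> orbit_closure"
  shows "S \<in> null_sets M"
proof -
  interpret prob_space M using Y_measureD(1)[OF M] .
  have "{p} \<in> null_sets M" if "p \<in> S" for p
  proof -
    have pO: "p \<in> orbit_closure" using that S by auto
    have s: "{p} \<in> sets M" using singleton_borel_Y[OF pO] Y_measureD(2)[OF M] by simp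
    have "measure M {p} = 0" by (rule invariant_measure_atom_zero[OF M s orbit_closure_aperiodic[OF pO]])
    thus ?thesis using s by (auto simp: null_sets_def emeasure_eq_measure)
  qed
  hence "(\<Union>p\<in>S. {p}) \<in> null_sets M" using S(1) by (intro null_sets_UN') auto
  thus ?thesis by simp
qed

fun to_np :: "split_real \<Rightarrow> real" where
  "to_np (Plus x) = x"
| "to_np (Minus z) = 0"

text \<open>
  An invariant measure on the minimal set gives no mass to the countably many points \<open>Minus z\<close>, so
  it lives on the line.  The map \<open>to_np\<close> sends these points to \<open>0\<close>, a point of the aperiodic part.
\<close>

definition push :: "split_real measure \<Rightarrow> real measure" where
  "push M = distr M (borel_of (top_of_set (I_np q \<pi>))) to_np"

lemma np_borel_sets: "A \<in> sets (borel_of (top_of_set (I_np q \<pi>))) \<longleftrightarrow> A \<in> sets borel \<and> A \<subseteq> I_np q \<pi>"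
  unfolding borel_of_top_of_set using I_np_borel by (subst sets_restrict_space_iff) auto

lemma to_np_in_np: "p \<in> orbit_closure \<Longrightarrow> to_np p \<in> I_np q \<pi>"
  using orbit_closure_subset_np Plus_np_star zero_np by (cases p) auto

lemma to_np_measurable:
  assumes "M \<in> Y_measures" shows "to_np \<in> M \<rightarrow>\<^sub>M borel_of (top_of_set (I_np q \<pi>))"
proof (rule measurableI)
  show "to_np p \<in> space (borel_of (top_of_set (I_np q \<pi>)))" if "p \<in> space M" for p
    using that to_np_in_np Y_measureD(3)[OF assms] by (simp add: borel_of_top_of_set)
  fix A assume A: "A \<in> sets (borel_of (top_of_set (I_np q \<pi>)))"
  have "{x. Plus x \<in> to_np -` A \<inter> orbit_closure} = A \<inter> {x. Plus x \<in> orbit_closure}" by auto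
  hence "to_np -` A \<inter> orbit_closure \<in> sets (borel_of Y)"
    unfolding sets_borel_Y_iff using A orbit_closure_trace_borel by (auto simp: np_borel_sets)
  thus "to_np -` A \<inter> space M \<in> sets M" using Y_measureD[OF assms] by simp
qed

lemma measure_push:
  assumes M: "M \<in> Y_measures" and A: "A \<in> sets borel" "A \<subseteq> I_np q \<pi>" and S: "S \<in> sets M"
    and eq: "\<And>x. Plus x \<in> orbit_closure \<Longrightarrow> x \<in> A \<longleftrightarrow> Plus x \<in> S"
  shows "emeasure (push M) A = emeasure M S"
proof -
  have A': "A \<in> sets (borel_of (top_of_set (I_np q \<pi>)))" using A np_borel_sets by blast
  have Mi: "Minuses \<in> null_sets M"
    using Y_measure_countable_null[OF M Minuses_countable] by (auto simp: Minuses_def)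
  have "emeasure (push M) A = emeasure M (to_np -` A \<inter> space M)"
    unfolding push_def by (rule emeasure_distr[OF to_np_measurable[OF M] A'])
  also have "\<dots> = emeasure M (to_np -` A \<inter> space M - Minuses)"
    using Mi measurable_sets[OF to_np_measurable[OF M] A'] by (intro emeasure_Diff_null_set[symmetric])
  also have "to_np -` A \<inter> space M - Minuses = S - Minuses"
  proof (rule set_eqI)
    fix p show "p \<in> to_np -` A \<inter> space M - Minuses \<longleftrightarrow> p \<in> S - Minuses"
      using eq sets.sets_into_space[OF S] Y_measureD(3)[OF M] by (cases p) (auto simp: Minuses_def)
  qed
  also have "emeasure M (S - Minuses) = emeasure M S"
    using Mi S by (intro emeasure_Diff_null_set)
  finally show ?thesis .
qed

lemma push_np_measure:
  assumes M: "M \<in> Y_measures"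
  shows "push M \<in> np_measures" "carried (push M)"
proof -
  interpret M: prob_space M using Y_measureD(1)[OF M] .
  \<comment> \<open>Any invariant measure shows that \<open>F\<close> is Borel measurable on the aperiodic part.\<close>
  obtain N0 where N0: "N0 \<in> np_measures" using carried_measure_exists by blast
  have sp: "sets (push M) = sets (borel_of (top_of_set (I_np q \<pi>)))" "space (push M) = I_np q \<pi>"
    by (simp_all add: push_def borel_of_top_of_set)
  have Fm: "F \<in> push M \<rightarrow>\<^sub>M push M"
    using invariant_measuresD(3)[OF N0] measurable_cong_sets[of N0 "push M" N0 "push M"]
      invariant_measuresD(2)[OF N0] sp(1) by simp
  show np: "push M \<in> np_measures" unfolding invariant_measures_def
  proof (intro CollectI conjI ballI Fm sp(1))
    show "prob_space (push M)" unfolding push_def by (rule M.prob_space_distr[OF to_np_measurable[OF M]])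
    fix A assume A: "A \<in> sets (push M)"
    define S where "S = to_np -` A \<inter> space M"
    have S: "S \<in> sets M" unfolding S_def using measurable_sets[OF to_np_measurable[OF M]] A sp by simp
    have A2: "A \<in> sets borel" "A \<subseteq> I_np q \<pi>" using A sp np_borel_sets by auto
    have FA: "F -` A \<inter> I_np q \<pi> \<in> sets borel"
      using measurable_sets[OF Fm A] sp np_borel_sets by auto
    have "emeasure (push M) (F -` A \<inter> I_np q \<pi>) = emeasure M (Fs -` S \<inter> space M)"
    proof (rule measure_push[OF M FA])
      show "Fs -` S \<inter> space M \<in> sets M" using invariant_measuresD(5)[OF M S] .
      fix x assume x: "Plus x \<in> orbit_closure"
      hence "Plus (F x) \<in> orbit_closure" using Fs_orbit_closure by force
      thus "x \<in> F -` A \<inter> I_np q \<pi> \<longleftrightarrow> Plus x \<in> Fs -` S \<inter> space M"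
        using x to_np_in_np[OF x] Y_measureD(3)[OF M] by (simp add: S_def)
    qed auto
    also have "\<dots> = emeasure M S" using M S by (simp add: invariant_measures_def)
    also have "\<dots> = emeasure (push M) A"
      by (rule measure_push[OF M A2 S, symmetric]) (simp add: S_def Y_measureD(3)[OF M])
    finally show "emeasure (push M) (F -` A \<inter> space (push M)) = emeasure (push M) A" by (simp add: sp)
  qed
  show "carried (push M)" unfolding carried_def
  proof (intro allI impI)
    fix k i assume i: "i < q" and unvisited: "\<forall>t. (F ^^ t) 0 \<notin> cell q k i"
    define \<alpha> where "\<alpha> = real i / (real q * 2 ^ k)"
    define \<beta> where "\<beta> = (real i + 1) / (real q * 2 ^ k)"
    have cell: "cell q k i = {\<alpha>..<\<beta>}" by (simp add: cell_def \<alpha>_def \<beta>_def)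
    have no: "orbit t \<notin> {\<alpha>..<\<beta>}" for t using unvisited unfolding orbit_def cell by blast
    define S where "S = orbit_closure \<inter> {Plus \<alpha>}"
    have Sn: "S \<in> null_sets M" unfolding S_def by (intro Y_measure_countable_null[OF M]) auto
    have "emeasure (push M) (cell q k i \<inter> I_np q \<pi>) = emeasure M S"
    proof (rule measure_push[OF M])
      show "cell q k i \<inter> I_np q \<pi> \<in> sets borel" using I_np_borel by auto
      show "S \<in> sets M" using Sn by auto
      fix x assume x: "Plus x \<in> orbit_closure"
      have xu: "x \<in> unit_ivl" using x orbit_closure_subset by auto
      have "\<not> (\<alpha> < x \<and> x < \<beta>)"
      proof
        assume ab: "\<alpha> < x \<and> x < \<beta>"
        from x have "approached_right x \<or> approached_left x" using Plus_in_orbit_closure[OF xu] by blast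
        thus False
        proof
          assume "approached_right x"
          then obtain t where "orbit t \<in> {x..<x + (\<beta> - x)}" using ab unfolding approached_right_def by (metis diff_gt_0_iff_gt)
          thus False using no[of t] ab by auto
        next
          assume "approached_left x"
          then obtain t where "orbit t \<in> {x - (x - \<alpha>)<..<x}" using ab unfolding approached_left_def by (metis diff_gt_0_iff_gt)
          thus False using no[of t] ab by auto
        qed
      qed
      moreover have "\<alpha> < \<beta>" unfolding \<alpha>_def \<beta>_def using q_pos by (intro divide_strict_right_mono) auto
      ultimately show "x \<in> cell q k i \<inter> I_np q \<pi> \<longleftrightarrow> Plus x \<in> S"
        using x to_np_in_np[OF x] unfolding cell S_def by auto
    qed auto
    thus "mass (push M) (cell q k i) = 0" using Sn by (simp add: mass_def measure_def null_sets_def)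
  qed
qed

lemma Y_measures_unique:
  assumes M: "M \<in> Y_measures" and N: "N \<in> Y_measures" shows "M = N"
proof -
  obtain \<delta> :: real where "\<delta> > 0" and overlap:
    "\<And>M N A. M \<in> np_measures \<Longrightarrow> N \<in> np_measures \<Longrightarrow> carried M \<Longrightarrow> carried N \<Longrightarrow> A \<in> sets M \<Longrightarrow>
      \<delta> \<le> measure M A + measure N (space M - A)" using carried_overlap by blast
  show ?thesis
  proof (rule invariant_measure_unique_if_overlapping[OF \<open>\<delta> > 0\<close> _ M N])
    fix M N B assume M: "M \<in> Y_measures" and N: "N \<in> Y_measures" and B: "B \<in> sets M"
    define A where "A = {x. Plus x \<in> B}"
    have BO: "B \<subseteq> orbit_closure" and Ab: "A \<in> sets borel"
      using B Y_measureD(2)[OF M] sets_borel_Y_iff unfolding A_def by auto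
    have Anp: "A \<subseteq> I_np q \<pi>" using BO orbit_closure_subset_np Plus_np_star by (auto simp: A_def)
    have spM: "space (push M) = I_np q \<pi>" by (simp add: push_def borel_of_top_of_set)
    have "A \<in> sets (push M)" using Ab Anp by (simp add: push_def np_borel_sets)
    hence "\<delta> \<le> measure (push M) A + measure (push N) (space (push M) - A)"
      using push_np_measure[OF M] push_np_measure[OF N] by (intro overlap)
    moreover have "emeasure (push M) A = emeasure M B"
      using Ab Anp B by (intro measure_push[OF M]) (auto simp: A_def)
    moreover have "emeasure (push N) (space (push M) - A) = emeasure N (space M - B)"
    proof (rule measure_push[OF N])
      show "space (push M) - A \<in> sets borel" using Ab I_np_borel by (simp add: spM)
      show "space M - B \<in> sets N" using B invariant_measures_same_sets[OF M N] by auto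
      fix x assume x: "Plus x \<in> orbit_closure"
      thus "x \<in> space (push M) - A \<longleftrightarrow> Plus x \<in> space M - B"
        using to_np_in_np[OF x] Y_measureD(3)[OF M] by (simp add: spM A_def)
    qed (simp add: spM)
    ultimately show "\<delta> \<le> measure M B + measure N (space M - B)" by (simp add: measure_def)
  qed
qed

lemma Fs_borel_Y: "A \<in> sets (borel_of Y) \<Longrightarrow> Fs -` A \<inter> orbit_closure \<in> sets (borel_of Y)"
proof -
  assume A: "A \<in> sets (borel_of Y)"
  hence S: "{x. Plus x \<in> A} \<in> sets borel" using sets_borel_Y_iff by blast
  have "{x. Plus x \<in> Fs -` A \<inter> orbit_closure} = {x. Plus x \<in> orbit_closure} \<inter> {x \<in> unit_ivl. F x \<in> {x. Plus x \<in> A}}"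
    using orbit_closure_subset by auto
  thus ?thesis unfolding sets_borel_Y_iff using F_borel[OF S] orbit_closure_trace_borel by auto
qed

text \<open>
  If \<open>Plus x\<close> is outside the closure of the orbit of \<open>0\<close>, then \<open>x\<close> is a cut point or lies in an
  unvisited cell.  The measure obtained from the frequencies gives no mass to these points.
\<close>

lemma Y_measure_exists: "Y_measures \<noteq> {}"
proof -
  obtain N where N: "N \<in> np_measures" and unv:
    "\<forall>k c. (\<forall>t. (F ^^ t) 0 \<notin> cell q k c) \<longrightarrow> mass N (cell q k c) = 0"
    using carried_measure_exists by blast
  interpret N: prob_space N using np_measureD(1)[OF N] .
  have spN: "space N = I_np q \<pi>" using np_measureD(2)[OF N] .
  have setsN: "A \<in> sets N \<longleftrightarrow> A \<in> sets borel \<and> A \<subseteq> I_np q \<pi>" for A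
    using invariant_measuresD(2)[OF N] np_borel_sets by simp
  define W where "W = {x \<in> I_np q \<pi>. Plus x \<notin> orbit_closure}"
  have W: "W \<in> sets N"
  proof -
    have "W = I_np q \<pi> - {x. Plus x \<in> orbit_closure}" by (auto simp: W_def)
    thus ?thesis unfolding setsN using I_np_borel orbit_closure_trace_borel by auto
  qed
  define unvisited where "unvisited k = {c. c < q * 2 ^ k \<and> (\<forall>t. (F ^^ t) 0 \<notin> cell q k c)}" for k
  have Wsub: "W \<subseteq> (\<Union>d\<in>D \<inter> I_np q \<pi>. {d}) \<union> (\<Union>k. \<Union>c\<in>unvisited k. cell q k c \<inter> I_np q \<pi>)"
  proof
    fix x assume x: "x \<in> W"
    hence xn: "x \<in> I_np q \<pi>" and xO: "Plus x \<notin> orbit_closure" by (auto simp: W_def)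
    have xu: "x \<in> unit_ivl" using I_np_unit[OF xn] .
    show "x \<in> (\<Union>d\<in>D \<inter> I_np q \<pi>. {d}) \<union> (\<Union>k. \<Union>c\<in>unvisited k. cell q k c \<inter> I_np q \<pi>)"
    proof (cases "x \<in> D")
      case True thus ?thesis using xn by blast
    next
      case False
      hence nr: "\<not> approached_right x" and nl: "\<not> approached_left x" using xO Plus_in_orbit_closure[OF xu] by auto
      from nr obtain e where e: "e > 0" "\<And>t. orbit t \<notin> {x..<x+e}" unfolding approached_right_def by blast
      from nl obtain e' where e': "e' > 0" "\<And>t. orbit t \<notin> {x-e'<..<x}" unfolding approached_left_def by blast
      obtain k where k: "(1::real) / 2 ^ k \<le> e" "(1::real) / 2 ^ k \<le> e'"
        using block_small[of "min e e'"] e(1) e'(1) by auto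
      obtain c where c: "c < q * 2 ^ k" "x \<in> cell q k c" using cell_exists[OF xu] .
      have "(F ^^ t) 0 \<notin> cell q k c" for t
      proof
        assume "(F ^^ t) 0 \<in> cell q k c"
        hence "\<bar>orbit t - x\<bar> < (real c + 1) / (real q * 2 ^ k) - real c / (real q * 2 ^ k)"
          using c(2) by (auto simp: cell_def orbit_def)
        also have "\<dots> = 1 / (real q * 2 ^ k)" by (simp add: add_divide_distrib)
        also have "\<dots> \<le> 1 / 2 ^ k" using q_pos by (intro divide_left_mono) auto
        finally have "\<bar>orbit t - x\<bar> < e" "\<bar>orbit t - x\<bar> < e'" using k by linarith+
        thus False using e(2)[of t] e'(2)[of t] by (cases "x \<le> orbit t") auto
      qed
      thus ?thesis using c xn by (auto simp: unvisited_def)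
    qed
  qed
  have "W \<in> null_sets N"
  proof (rule null_sets_subset[OF _ W Wsub])
    have "{d} \<in> null_sets N" if d: "d \<in> D \<inter> I_np q \<pi>" for d
    proof -
      have s: "{d} \<in> sets N" unfolding setsN using d by auto
      have "(F ^^ n) d \<noteq> d" if "n \<ge> 1" for n using d that by (auto simp: I_np_def I_per_def)
      hence "measure N {d} = 0" using invariant_measure_atom_zero[OF N s] by blast
      thus ?thesis using s by (auto simp: null_sets_def N.emeasure_eq_measure)
    qed
    moreover have "countable (D \<inter> I_np q \<pi>)" using cut_points_countable by (rule countable_Int1)
    ultimately have "(\<Union>d\<in>D \<inter> I_np q \<pi>. {d}) \<in> null_sets N" by (intro null_sets_UN')
    moreover have "(\<Union>c\<in>unvisited k. cell q k c \<inter> I_np q \<pi>) \<in> null_sets N" for k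
    proof (rule null_sets_UN')
      fix c assume "c \<in> unvisited k"
      hence "mass N (cell q k c) = 0" using unv by (auto simp: unvisited_def)
      thus "cell q k c \<inter> I_np q \<pi> \<in> null_sets N"
        using np_measureD(4)[OF N cell_borel] by (auto simp: null_sets_def mass_def N.emeasure_eq_measure)
    qed simp
    ultimately show "(\<Union>d\<in>D \<inter> I_np q \<pi>. {d}) \<union> (\<Union>k. \<Union>c\<in>unvisited k. cell q k c \<inter> I_np q \<pi>) \<in> null_sets N"
      by (intro null_sets.Un null_sets_UN) auto
  qed
  define h where "h x = (if Plus x \<in> orbit_closure then Plus x else Plus 0)" for x
  have hO: "h x \<in> orbit_closure" for x using zero_in_orbit_closure by (simp add: h_def)
  have hm: "h \<in> N \<rightarrow>\<^sub>M borel_of Y"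
  proof (rule measurableI)
    show "h x \<in> space (borel_of Y)" for x using hO by simp
    fix A assume "A \<in> sets (borel_of Y)"
    hence A: "A \<subseteq> orbit_closure" "{x. Plus x \<in> A} \<in> sets borel" using sets_borel_Y_iff by auto
    have "h -` A \<inter> space N = ({x. Plus x \<in> A} \<inter> I_np q \<pi>) \<union> (if Plus 0 \<in> A then W else {})"
      using A(1) by (auto simp: h_def W_def spN split: if_splits)
    moreover have "{x. Plus x \<in> A} \<inter> I_np q \<pi> \<in> sets N" using A(2) I_np_borel by (auto simp: setsN)
    ultimately show "h -` A \<inter> space N \<in> sets N" using W by auto
  qed
  define M where "M = distr N (borel_of Y) h"
  have Fsm: "Fs \<in> borel_of Y \<rightarrow>\<^sub>M borel_of Y"
    using Fs_borel_Y Fs_orbit_closure by (intro measurableI) (auto simp: image_subset_iff)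
  have "M \<in> Y_measures" unfolding invariant_measures_def
  proof (intro CollectI conjI ballI)
    show "prob_space M" unfolding M_def by (rule N.prob_space_distr[OF hm])
    show "sets M = sets (borel_of Y)" by (simp add: M_def)
    show "Fs \<in> M \<rightarrow>\<^sub>M M" unfolding M_def using Fsm by simp
    fix A assume "A \<in> sets M"
    hence A: "A \<in> sets (borel_of Y)" by (simp add: M_def)
    have hA: "h -` A \<inter> I_np q \<pi> \<in> sets N" using measurable_sets[OF hm A] spN by simp
    have hFA: "h -` (Fs -` A \<inter> orbit_closure) \<inter> I_np q \<pi> \<in> sets N"
      using measurable_sets[OF hm Fs_borel_Y[OF A]] spN by simp
    have FhA: "F -` (h -` A \<inter> I_np q \<pi>) \<inter> I_np q \<pi> \<in> sets N"
      using measurable_sets[OF invariant_measuresD(3)[OF N] hA] spN by simp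
    have "emeasure M (Fs -` A \<inter> space M) = emeasure N (h -` (Fs -` A \<inter> orbit_closure) \<inter> I_np q \<pi>)"
      unfolding M_def using emeasure_distr[OF hm Fs_borel_Y[OF A]] by (simp add: spN)
    also have "\<dots> = emeasure N (h -` (Fs -` A \<inter> orbit_closure) \<inter> I_np q \<pi> - W)"
      using \<open>W \<in> null_sets N\<close> hFA by (intro emeasure_Diff_null_set[symmetric])
    also have "h -` (Fs -` A \<inter> orbit_closure) \<inter> I_np q \<pi> - W = F -` (h -` A \<inter> I_np q \<pi>) \<inter> I_np q \<pi> - W"
    proof (rule set_eqI)
      fix x
      show "x \<in> h -` (Fs -` A \<inter> orbit_closure) \<inter> I_np q \<pi> - W \<longleftrightarrow> x \<in> F -` (h -` A \<inter> I_np q \<pi>) \<inter> I_np q \<pi> - W"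
      proof (cases "x \<in> I_np q \<pi> \<and> Plus x \<in> orbit_closure")
        case True
        hence "Plus (F x) \<in> orbit_closure" using Fs_orbit_closure by force
        moreover have "F x \<in> I_np q \<pi>" using True F_np_iff[OF I_np_unit] by blast
        ultimately show ?thesis using True by (simp add: h_def)
      next
        case False
        thus ?thesis by (auto simp: W_def)
      qed
    qed
    also have "emeasure N (F -` (h -` A \<inter> I_np q \<pi>) \<inter> I_np q \<pi> - W) = emeasure N (F -` (h -` A \<inter> I_np q \<pi>) \<inter> I_np q \<pi>)"
      using \<open>W \<in> null_sets N\<close> FhA by (intro emeasure_Diff_null_set)
    also have "\<dots> = emeasure N (h -` A \<inter> I_np q \<pi>)"
      using N hA unfolding invariant_measures_def spN[symmetric] by blast
    also have "\<dots> = emeasure M A" unfolding M_def using emeasure_distr[OF hm A] by (simp add: spN)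
    finally show "emeasure M (Fs -` A \<inter> space M) = emeasure M A" .
  qed
  thus ?thesis by blast
qed

lemma orbit_closure_uniquely_ergodic: "uniquely_ergodic Y Fs"
  unfolding uniquely_ergodic_def using Y_measure_exists Y_measures_unique by blast

end

section \<open>Ergodic measures and unique ergodicity of rotated odometers\<close>

theorem theorem1p6:
  fixes q :: nat and \<pi> :: "nat \<Rightarrow> nat"
  assumes "q \<ge> 1" and "\<pi> permutes {..<q}"
  shows "finite (ergodic_measures (top_of_set (I_np q \<pi>)) (rot_odo q \<pi>))
    \<and> card (ergodic_measures (top_of_set (I_np q \<pi>)) (rot_odo q \<pi>)) \<le> q
    \<and> (\<exists>!M. minimal_set (I_np_star_top q \<pi>) (F_star q \<pi>) M)
    \<and> uniquely_ergodic (subtopology (I_star_top q \<pi>) (I_min_star q \<pi>)) (F_star q \<pi>)"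
proof -
  interpret rotated_odometer q \<pi> using assms by unfold_locales
  have "finite (ergodic_measures (top_of_set (I_np q \<pi>)) F) \<and>
      card (ergodic_measures (top_of_set (I_np q \<pi>)) F) \<le> q"
    by (rule finite_if_finite_subsets_card_bdd) (use card_ergodic_subset in blast)
  moreover have "\<exists>!M. minimal_set (I_np_star_top q \<pi>) (F_star q \<pi>) M"
    unfolding minimal_set_iff by simp
  moreover have "uniquely_ergodic (subtopology (I_star_top q \<pi>) (I_min_star q \<pi>)) (F_star q \<pi>)"
    unfolding I_min_star_eq by (rule orbit_closure_uniquely_ergodic)
  ultimately show ?thesis by blast
qed

end
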